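(* Let $p$ be a prime, and let $a,b,r$ be positive integers such that $a=2b$ and $r\ge 3$. Let $n=ar$. Then there exists a finite $p$-group $G$ with properties (P1), (P2) and (P3) such that $|G/Z(G)|=p^{2n}$ and the Chermak-Delgado lattice $\mathcal{CD}(G)$ is a quasi-antichain of width $w=p^a+1$, in which the number of abelian atoms is $t=p^b+1$.
   Context: For a finite group $G$ and $H\le G$, the Chermak-Delgado measure of $H$ in $G$ is $m_G(H)=|H|\,|C_G(H)|$. Put $m^*(G)=\max\{m_G(H)\mid H\le G\}$ and $\mathcal{CD}(G)=\{H\le G\mid m_G(H)=m^*(G)\}$. It is known that $\mathcal{CD}(G)$, ordered by inclusion, is a lattice of subgroups of $G$, called the Chermak-Delgado lattice of $G$. A quasi-antichain is a lattice consisting of a maximum, a minimum, and the atoms of the lattice; its width $w$ is the number of atoms, and $w\ge 3$ is assumed. An abelian atom is an atom of $\mathcal{CD}(G)$ that is an abelian group. Let $M_1,\dots,M_w$ be all the atoms of $\mathcal{CD}(G)$. Properties (P1)-(P3) are: (P1) Both $G/Z(G)$ and $G'$ are elementary abelian. (P2) $M_i/Z(G)\cong M_j/Z(G)$ and $G/Z(G)=M_i/Z(G)\times M_j/Z(G)$ for $i\ne j$. (P3) Let $M_1=\langle x_1,\dots,x_n\rangle Z(G)$ and $M_2=\langle y_1,\dots,y_n\rangle Z(G)$, where $M_1/Z(G)$ and $M_2/Z(G)$ are elementary abelian of order $p^n$. Then for each $k\ge 3$ one has $M_k=\langle x_1y_1',\dots,x_ny_n'\rangle Z(G)$ for some $y_1',\dots,y_n'$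 with $M_2=\langle y_1',\dots,y_n'\rangle Z(G)$; moreover there is an invertible $n\times n$ matrix $(c^{(k)}_{ij})$ over $\mathbb{F}_p$ with $y_j'\equiv\prod_{i=1}^n y_i^{c^{(k)}_{ij}} \pmod{Z(G)}$ for $j=1,\dots,n$. *)

theory Defs
  imports
    "HOL-Algebra.Generated_Groups"
    "HOL-Algebra.Lattice"
    "HOL-Number_Theory.Residues"
begin

definition centralizer :: "('a, 'b) monoid_scheme \<Rightarrow> 'a set \<Rightarrow> 'a set" where
  "centralizer G H = {g \<in> carrier G. \<forall>h\<in>H. g \<otimes>\<^bsub>G\<^esub> h = h \<otimes>\<^bsub>G\<^esub> g}"

definition group_center :: "('a, 'b) monoid_scheme \<Rightarrow> 'a set" where
  "group_center G = centralizer G (carrier G)"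

definition finite_p_group :: "nat \<Rightarrow> ('a, 'b) monoid_scheme \<Rightarrow> bool" where
  "finite_p_group p G \<longleftrightarrow> group G \<and> finite (carrier G) \<and> (\<exists>k. order G = p ^ k)"

definition elementary_abelian :: "nat \<Rightarrow> ('a, 'b) monoid_scheme \<Rightarrow> bool" where
  "elementary_abelian p G \<longleftrightarrow> comm_group G \<and> (\<forall>x\<in>carrier G. x [^]\<^bsub>G\<^esub> p = \<one>\<^bsub>G\<^esub>)"

definition internal_direct_product ::
    "('a, 'b) monoid_scheme \<Rightarrow> 'a set \<Rightarrow> 'a set \<Rightarrow> bool" where
  "internal_direct_product G A B \<longleftrightarrow>
     A \<lhd> G \<and> B \<lhd> G \<and> A <#>\<^bsub>G\<^esub> B = carrier G \<and> A \<inter> B = {\<one>\<^bsub>G\<^esub>}"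

definition cd_measure :: "('a, 'b) monoid_scheme \<Rightarrow> 'a set \<Rightarrow> nat" where
  "cd_measure G H = card H * card (centralizer G H)"

definition cd_max :: "('a, 'b) monoid_scheme \<Rightarrow> nat" where
  "cd_max G = Max {cd_measure G H | H. subgroup H G}"

definition CD :: "('a, 'b) monoid_scheme \<Rightarrow> 'a set gorder" where
  "CD G = \<lparr>carrier = {H. subgroup H G \<and> cd_measure G H = cd_max G},
           eq = (=), le = (\<subseteq>)\<rparr>"

definition atoms :: "('a, 'b) gorder_scheme \<Rightarrow> 'a set" where
  "atoms L = {x \<in> carrier L. x \<noteq> \<bottom>\<^bsub>L\<^esub> \<and>
     (\<forall>y\<in>carrier L. y \<sqsubseteq>\<^bsub>L\<^esub> x \<longrightarrow> y = \<bottom>\<^bsub>L\<^esub> \<or> y = x)}"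

definition quasi_antichain :: "nat \<Rightarrow> ('a, 'b) gorder_scheme \<Rightarrow> bool" where
  "quasi_antichain w L \<longleftrightarrow>
     bounded_lattice L \<and> carrier L = {\<bottom>\<^bsub>L\<^esub>, \<top>\<^bsub>L\<^esub>} \<union> atoms L \<and>
     finite (atoms L) \<and> card (atoms L) = w \<and> w \<ge> 3"

definition abelian_atoms :: "('a, 'b) monoid_scheme \<Rightarrow> 'a set set" where
  "abelian_atoms G = {M \<in> atoms (CD G). comm_group (G\<lparr>carrier := M\<rparr>)}"

text \<open>The quotient \<open>M/Z(G)\<close> for \<open>Z(G) \<le> M \<le> G\<close>. Every member of \<open>CD G\<close> contains
  \<open>Z(G)\<close>, as otherwise multiplying it by \<open>Z(G)\<close> would increase its measure.
  The carrier consists of cosets of \<open>Z(G)\<close> in \<open>G\<close>, so it is a subset of the carrier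
  of \<open>G Mod Z(G)\<close>.\<close>

definition mod_center :: "('a, 'b) monoid_scheme \<Rightarrow> 'a set \<Rightarrow> 'a set monoid" where
  "mod_center G M = (G\<lparr>carrier := M\<rparr>) Mod (group_center G)"

text \<open>The subgroup \<open>\<langle>x\<^sub>1, \<dots>, x\<^sub>n\<rangle> Z(G)\<close>.\<close>

definition gen_center :: "('a, 'b) monoid_scheme \<Rightarrow> nat \<Rightarrow> (nat \<Rightarrow> 'a) \<Rightarrow> 'a set" where
  "gen_center G n x = generate G (x ` {1..n}) <#>\<^bsub>G\<^esub> group_center G"

text \<open>The product \<open>x\<^sub>1 x\<^sub>2 \<cdots> x\<^sub>n\<close> in this order; \<open>G\<close> need not be commutative.\<close>

definition ordered_prod :: "('a, 'b) monoid_scheme \<Rightarrow> nat \<Rightarrow> (nat \<Rightarrow> 'a) \<Rightarrow> 'a" where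
  "ordered_prod G n x = foldr (\<otimes>\<^bsub>G\<^esub>) (map x [1..<Suc n]) \<one>\<^bsub>G\<^esub>"

text \<open>An \<open>n \<times> n\<close> matrix over \<open>R\<close> is a function on index pairs from \<open>{1..n}\<close>.\<close>

definition matrix_over :: "('r, 'm) ring_scheme \<Rightarrow> nat \<Rightarrow> (nat \<Rightarrow> nat \<Rightarrow> 'r) \<Rightarrow> bool" where
  "matrix_over R n c \<longleftrightarrow> (\<forall>i\<in>{1..n}. \<forall>j\<in>{1..n}. c i j \<in> carrier R)"

definition inverse_matrices ::
    "('r, 'm) ring_scheme \<Rightarrow> nat \<Rightarrow> (nat \<Rightarrow> nat \<Rightarrow> 'r) \<Rightarrow> (nat \<Rightarrow> nat \<Rightarrow> 'r) \<Rightarrow> bool" where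
  "inverse_matrices R n c d \<longleftrightarrow>
     (\<forall>i\<in>{1..n}. \<forall>j\<in>{1..n}.
        (\<Oplus>\<^bsub>R\<^esub>k\<in>{1..n}. c i k \<otimes>\<^bsub>R\<^esub> d k j) = (if i = j then \<one>\<^bsub>R\<^esub> else \<zero>\<^bsub>R\<^esub>) \<and>
        (\<Oplus>\<^bsub>R\<^esub>k\<in>{1..n}. d i k \<otimes>\<^bsub>R\<^esub> c k j) = (if i = j then \<one>\<^bsub>R\<^esub> else \<zero>\<^bsub>R\<^esub>))"

definition invertible_matrix ::
    "('r, 'm) ring_scheme \<Rightarrow> nat \<Rightarrow> (nat \<Rightarrow> nat \<Rightarrow> 'r) \<Rightarrow> bool" where
  "invertible_matrix R n c \<longleftrightarrow>
     matrix_over R n c \<and> (\<exists>d. matrix_over R n d \<and> inverse_matrices R n c d)"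

definition P1 :: "nat \<Rightarrow> ('a, 'b) monoid_scheme \<Rightarrow> bool" where
  "P1 p G \<longleftrightarrow>
     elementary_abelian p (G Mod group_center G) \<and>
     elementary_abelian p (G\<lparr>carrier := derived G (carrier G)\<rparr>)"

definition P2 :: "('a, 'b) monoid_scheme \<Rightarrow> bool" where
  "P2 G \<longleftrightarrow>
     (\<forall>M\<in>atoms (CD G). \<forall>N\<in>atoms (CD G). M \<noteq> N \<longrightarrow>
        mod_center G M \<cong> mod_center G N \<and>
        internal_direct_product (G Mod group_center G)
          (carrier (mod_center G M)) (carrier (mod_center G N)))"

text \<open>The numbering of the atoms and the generators \<open>x\<^sub>i\<close>, \<open>y\<^sub>i\<close> are arbitrary: \<open>M1\<close>, \<open>M2\<close>
  range over all pairs of distinct atoms, and \<open>M\<close> over all the remaining ones.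
  The entries of \<open>c\<close> are the representatives in \<open>{0..p - 1}\<close>, used as integer exponents.\<close>

definition P3 :: "nat \<Rightarrow> nat \<Rightarrow> ('a, 'b) monoid_scheme \<Rightarrow> bool" where
  "P3 p n G \<longleftrightarrow>
     (\<forall>M1\<in>atoms (CD G). \<forall>M2\<in>atoms (CD G). M1 \<noteq> M2 \<longrightarrow>
        elementary_abelian p (mod_center G M1) \<and> order (mod_center G M1) = p ^ n \<and>
        elementary_abelian p (mod_center G M2) \<and> order (mod_center G M2) = p ^ n \<and>
        (\<forall>x\<in>{1..n} \<rightarrow> carrier G. \<forall>y\<in>{1..n} \<rightarrow> carrier G.
           M1 = gen_center G n x \<and> M2 = gen_center G n y \<longrightarrow>
           (\<forall>M\<in>atoms (CD G) - {M1, M2}.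
              \<exists>y'\<in>{1..n} \<rightarrow> carrier G.
                M = gen_center G n (\<lambda>i. x i \<otimes>\<^bsub>G\<^esub> y' i) \<and>
                M2 = gen_center G n y' \<and>
                (\<exists>c. invertible_matrix (residue_ring (int p)) n c \<and>
                   (\<forall>j\<in>{1..n}.
                      group_center G #>\<^bsub>G\<^esub> y' j =
                      group_center G #>\<^bsub>G\<^esub> ordered_prod G n (\<lambda>i. y i [^]\<^bsub>G\<^esub> c i j))))))"

end

theory Submission
  imports Defs "HOL-Algebra.QuotRing" "HOL-Computational_Algebra.Polynomial"
begin

text \<open>
  Put \<open>q = p\<^sup>b\<close> and let \<open>F\<close> be the field of order \<open>q\<^sup>2 = p\<^sup>a\<close> with the involution \<open>x \<mapsto> x\<^sup>q\<close>.
  On \<open>E = F\<^sup>2\<close> take the skew-hermitian form \<open>h(s, t) = s\<^sub>1\<^sup>q t\<^sub>2 - s\<^sub>2\<^sup>q t\<^sub>1\<close>, and let \<open>G\<close> be the central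
  extension of \<open>E\<^sup>r\<close> by the \<open>r \<times> r\<close> matrices over \<open>F\<close> with cocycle \<open>(h(x\<^sub>i, y\<^sub>j))\<close>, so that \<open>x\<close> and
  \<open>y\<close> commute iff \<open>h(x\<^sub>i, y\<^sub>j) = h(y\<^sub>i, x\<^sub>j)\<close> for all \<open>i\<close>, \<open>j\<close>. A line \<open>l\<close> of \<open>E\<close> gives the
  subgroup \<open>M\<^sub>l\<close> of all elements with every coordinate in \<open>l\<close>. Its centralizer is the subgroup of
  the conjugate line, since \<open>h(s, t) = 0\<close> iff \<open>t\<close> lies on the conjugate of the line of \<open>s\<close>.
  There are \<open>q\<^sup>2 + 1\<close> lines, of which \<open>q + 1\<close> are self-conjugate; these give the abelian atoms.

  For the upper bound on the measure let \<open>U\<close> and \<open>W\<close> commute. If \<open>U\<close> is not contained in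
  some \<open>M\<^sub>l\<close>, then it contains elements with independent coordinates, and three coordinates of the
  form (one of them skew, hence from a proper subset of \<open>F\<close>) determine an element of \<open>W\<close> up to the
  center: \<open>|W : Z| < |F|\<^sup>3\<close>. If this holds for both subgroups, then
  \<open>|U : Z| |W : Z| < |F|\<^sup>6 \<le> |F|\<^sup>2\<^sup>r\<close>; this is where \<open>r \<ge> 3\<close> enters. If \<open>U\<close> is a noncentral subgroup of
  \<open>M\<^sub>l\<close>, then either \<open>W\<close> is contained in the subgroup of the conjugate line, or
  \<open>|U : Z| \<le> |F|\<close> and \<open>|W : Z| \<le> |F|\<^sup>r\<^sup>+\<^sup>1\<close>.
\<close>

text \<open>The conjugation is what makes t smaller than w. For the plain determinant form every
  line is orthogonal to itself, and all p^a + 1 atoms would be abelian. Twisting one argument leaves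
  only the vertical line and the lines whose slope lies in the subfield of order q self-orthogonal,
  which gives q + 1 = p^b + 1. The centre keeps all r^2 values h(x_i, y_j) apart, so that commuting
  is one equation for every pair of indices and not a single equation between sums; this keeps
  centralizers small. The pairs (Z, G) and (\<open>M l\<close>, \<open>M (sg l)\<close>) all have
  the product of orders |F|^(2r) |Z|^2, and the proof has to exclude every other commuting pair that
  reaches this value. For r = 3 a bound |F|^3 |Z| on each of two subgroups would still allow
  equality; the strict inequality that comes from the skew value closes this gap. The estimate is
  stated for any two commuting subgroups and not for a subgroup with its centralizer. In this form
  it is symmetric, and it also identifies the centre and the centralizers of the atoms.\<close>

hide_const (open) Polynomial.order
hide_fact (open) Polynomial.order_def

section \<open>Quasi-antichains, complements and bases\<close>

text \<open>By incomparability no member of \<open>A\<close> contains two different members of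
  \<open>A\<close> or lies in both. So \<open>t\<close> is their only upper bound in the family and
  \<open>z\<close> their only lower bound, and joins and meets exist.\<close>

lemma quasi_antichain_subsets:
  fixes z t :: "'a set"
  assumes fin: "finite A" and card: "card A = w" "w \<ge> 3"
    and zt: "\<And>m. m \<in> A \<Longrightarrow> z \<subset> m \<and> m \<subset> t"
    and anti: "\<And>m m'. m \<in> A \<Longrightarrow> m' \<in> A \<Longrightarrow> m \<subseteq> m' \<Longrightarrow> m = m'"
  defines "P \<equiv> \<lparr>carrier = {z, t} \<union> A, eq = (=), le = (\<subseteq>)\<rparr>"
  shows "quasi_antichain w P" "atoms P = A"
proof -
  have cP: "carrier P = {z, t} \<union> A" and eqP: "eq P = (=)" and leP: "le P = (\<subseteq>)"
    by (auto simp: P_def)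
  have "A \<noteq> {}" using card by auto
  then have zt': "z \<subset> t" using zt by blast
  interpret partial_order P
    by unfold_locales (auto simp: P_def)
  have lz: "least P z (carrier P)" and gt: "greatest P t (carrier P)"
    using zt zt' unfolding least_def greatest_def cP leP by auto
  have cases: "x \<subseteq> y \<or> y \<subseteq> x \<or> x \<in> A \<and> y \<in> A \<and> x \<noteq> y"
    if "x \<in> carrier P" "y \<in> carrier P" for x y
    using that zt zt' unfolding cP by blast
  have tC: "t \<in> carrier P" and zC: "z \<in> carrier P" by (auto simp: cP)
  have le_t: "x \<subseteq> t" and z_le: "z \<subseteq> x" if "x \<in> carrier P" for x using that zt zt' unfolding cP by auto
  have sup: "\<exists>s. least P s (Upper P {x, y})" if xy: "x \<in> carrier P" "y \<in> carrier P" for x y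
  proof -
    have U: "Upper P {x, y} = {u \<in> carrier P. x \<subseteq> u \<and> y \<subseteq> u}" using xy unfolding Upper_def leP by auto
    have L: "least P s (Upper P {x, y}) \<longleftrightarrow> s \<in> carrier P \<and> x \<subseteq> s \<and> y \<subseteq> s \<and>
       (\<forall>u\<in>carrier P. x \<subseteq> u \<and> y \<subseteq> u \<longrightarrow> s \<subseteq> u)" for s
      unfolding least_def U leP by auto
    consider "x \<subseteq> y" | "y \<subseteq> x" | "x \<in> A" "y \<in> A" "x \<noteq> y" using cases[OF xy] by auto
    then show ?thesis
    proof cases
      case 1 with xy show ?thesis unfolding L by blast
    next
      case 2 with xy show ?thesis unfolding L by blast
    next
      case 3
      have "u = t" if "u \<in> carrier P" "x \<subseteq> u" "y \<subseteq> u" for u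
      proof (rule ccontr)
        assume "u \<noteq> t"
        then have "u \<in> A" using that zt[OF 3(1)] unfolding cP by auto
        then show False using anti[OF 3(1) _ that(2)] anti[OF 3(2) _ that(3)] 3(3) by simp
      qed
      then show ?thesis using le_t[OF xy(1)] le_t[OF xy(2)] tC unfolding L by blast
    qed
  qed
  have inf: "\<exists>s. greatest P s (Lower P {x, y})" if xy: "x \<in> carrier P" "y \<in> carrier P" for x y
  proof -
    have U: "Lower P {x, y} = {u \<in> carrier P. u \<subseteq> x \<and> u \<subseteq> y}" using xy unfolding Lower_def leP by auto
    have L: "greatest P s (Lower P {x, y}) \<longleftrightarrow> s \<in> carrier P \<and> s \<subseteq> x \<and> s \<subseteq> y \<and>
       (\<forall>u\<in>carrier P. u \<subseteq> x \<and> u \<subseteq> y \<longrightarrow> u \<subseteq> s)" for s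
      unfolding greatest_def U leP by auto
    consider "x \<subseteq> y" | "y \<subseteq> x" | "x \<in> A" "y \<in> A" "x \<noteq> y" using cases[OF xy] by auto
    then show ?thesis
    proof cases
      case 1 with xy show ?thesis unfolding L by blast
    next
      case 2 with xy show ?thesis unfolding L by blast
    next
      case 3
      have "u = z" if "u \<in> carrier P" "u \<subseteq> x" "u \<subseteq> y" for u
      proof (rule ccontr)
        assume "u \<noteq> z"
        then have "u \<in> A" using that zt[OF 3(1)] unfolding cP by auto
        then show False using anti[OF _ 3(1) that(2)] anti[OF _ 3(2) that(3)] 3(3) by simp
      qed
      then show ?thesis using z_le[OF xy(1)] z_le[OF xy(2)] zC unfolding L by blast
    qed
  qed
  interpret bounded_lattice P
    by unfold_locales (use sup inf lz gt in auto)
  have b: "\<bottom>\<^bsub>P\<^esub> = z" using bottom_eq[of z] lz by (auto simp: least_def)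
  have tp: "\<top>\<^bsub>P\<^esub> = t" using top_eq[of t] gt by (auto simp: greatest_def)
  show at: "atoms P = A"
  proof
    show "atoms P \<subseteq> A"
    proof
      fix x assume x: "x \<in> atoms P"
      then have "x \<in> {z, t} \<union> A" "x \<noteq> z" and *: "\<forall>y\<in>{z, t} \<union> A. y \<subseteq> x \<longrightarrow> y = z \<or> y = x"
        unfolding atoms_def cP leP b by auto
      moreover have "x \<noteq> t" using * zt \<open>A \<noteq> {}\<close> by blast
      ultimately show "x \<in> A" by auto
    qed
    show "A \<subseteq> atoms P" using zt anti unfolding atoms_def cP leP b by blast
  qed
  show "quasi_antichain w P" unfolding quasi_antichain_def
    using bounded_lattice_axioms fin card by (simp add: at b tp cP)
qed

lemma (in group) inv_mult_eq_one_imp_eq: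
  assumes "x \<in> carrier G" "y \<in> carrier G" "inv x \<otimes> y = \<one>"
  shows "x = y"
  using inv_equality[OF assms(3,2)] assms(1,2) inv_closed inv_inv by metis

lemma (in group) inv_mult_cancel_left:
  assumes "x \<in> carrier G" "y \<in> carrier G" "z \<in> carrier G"
  shows "inv (x \<otimes> y) \<otimes> (x \<otimes> z) = inv y \<otimes> z"
proof -
  have "inv x \<otimes> (x \<otimes> z) = z" using assms by (simp add: m_assoc[symmetric])
  then show ?thesis using assms by (simp add: inv_mult_group m_assoc)
qed

text \<open>Of three pairwise complementary subgroups, each is the graph of an isomorphism between the
  other two. Applied to three atoms modulo the center, this gives (P2) and (P3).\<close>

lemma (in comm_group) complement_graph:
  assumes A: "subgroup A G" and B: "subgroup B G" and C: "subgroup C G"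
    and int: "A \<inter> C = {\<one>}" "C \<inter> B = {\<one>}"
    and prod: "A <#> B = carrier G" "A <#> C = carrier G" "C <#> B = carrier G"
  obtains \<phi> where "\<phi> \<in> iso (G\<lparr>carrier := A\<rparr>) (G\<lparr>carrier := B\<rparr>)"
    "(\<lambda>x. x \<otimes> \<phi> x) \<in> hom (G\<lparr>carrier := A\<rparr>) G" "(\<lambda>x. x \<otimes> \<phi> x) ` A = C"
proof -
  note mem = subgroup.mem_carrier[OF A] subgroup.mem_carrier[OF B] subgroup.mem_carrier[OF C]
  note cl = subgroup.m_closed[OF A] subgroup.m_closed[OF B] subgroup.m_closed[OF C]
  note icl = subgroup.m_inv_closed[OF A] subgroup.m_inv_closed[OF B] subgroup.m_inv_closed[OF C]
  have ex: "\<exists>y. y \<in> B \<and> x \<otimes> y \<in> C" if x: "x \<in> A" for x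
  proof -
    have "x \<in> C <#> B" using prod mem x by auto
    then obtain c b where cb: "c \<in> C" "b \<in> B" "x = c \<otimes> b" by (auto simp: set_mult_def)
    then have "x \<otimes> inv b = c" using mem by (simp add: m_assoc)
    then show ?thesis using cb icl by (intro exI[of _ "inv b"]) auto
  qed
  define \<phi> where "\<phi> x = (SOME y. y \<in> B \<and> x \<otimes> y \<in> C)" for x
  have \<phi>: "\<phi> x \<in> B" "x \<otimes> \<phi> x \<in> C" if "x \<in> A" for x
    using someI_ex[OF ex[OF that]] by (auto simp: \<phi>_def)
  \<comment> \<open>Two candidates for the same \<open>x\<close> differ by an element of
    \<open>C \<inter> B\<close>. Hence the chosen value is forced, and since a product of candidates
    is again a candidate, \<open>\<phi>\<close> is a homomorphism. Below,
    \<open>A \<inter> C\<close> gives injectivity, \<open>A <#> C\<close> surjectivity, and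
    \<open>A <#> B\<close> shows that the graph is all of \<open>C\<close>.\<close>
  have uniq: "y = \<phi> x" if x: "x \<in> A" and y: "y \<in> B" "x \<otimes> y \<in> C" for x y
  proof -
    have "inv (x \<otimes> y) \<otimes> (x \<otimes> \<phi> x) \<in> C" using y \<phi>(2)[OF x] cl icl by blast
    moreover have "inv (x \<otimes> y) \<otimes> (x \<otimes> \<phi> x) = inv y \<otimes> \<phi> x"
      using mem x y \<phi>(1)[OF x] by (simp add: inv_mult_cancel_left)
    ultimately have "inv y \<otimes> \<phi> x \<in> C \<inter> B" using y \<phi>(1)[OF x] cl icl by auto
    then show ?thesis using int(2) inv_mult_eq_one_imp_eq[of y "\<phi> x"] mem y(1) \<phi>(1)[OF x] by simp
  qed
  have hom: "\<phi> (x \<otimes> x') = \<phi> x \<otimes> \<phi> x'" if x: "x \<in> A" "x' \<in> A" for x x'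
  proof -
    have "(x \<otimes> x') \<otimes> (\<phi> x \<otimes> \<phi> x') = (x \<otimes> \<phi> x) \<otimes> (x' \<otimes> \<phi> x')"
      using x \<phi> mem by (simp add: m_ac)
    then have "(x \<otimes> x') \<otimes> (\<phi> x \<otimes> \<phi> x') \<in> C" using \<phi> x cl by metis
    then show ?thesis using uniq[of "x \<otimes> x'" "\<phi> x \<otimes> \<phi> x'"] x \<phi> cl by auto
  qed
  have inj: "inj_on \<phi> A"
  proof (rule inj_onI)
    fix x x' assume x: "x \<in> A" "x' \<in> A" "\<phi> x = \<phi> x'"
    have "inv (x \<otimes> \<phi> x) \<otimes> (x' \<otimes> \<phi> x') \<in> C"
      using cl(3)[OF icl(3)[OF \<phi>(2)[OF x(1)]] \<phi>(2)[OF x(2)]] .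
    moreover have "inv (x \<otimes> \<phi> x) \<otimes> (x' \<otimes> \<phi> x') = inv x \<otimes> x'"
      using inv_mult_cancel_left[of "\<phi> x'" x x'] mem(1)[OF x(1)] mem(1)[OF x(2)] mem(2)[OF \<phi>(1)[OF x(2)]]
      unfolding x(3) m_comm[OF mem(1)[OF x(1)] mem(2)[OF \<phi>(1)[OF x(2)]]]
        m_comm[OF mem(1)[OF x(2)] mem(2)[OF \<phi>(1)[OF x(2)]]] by blast
    ultimately have "inv x \<otimes> x' \<in> A \<inter> C" using x cl icl by auto
    then show "x = x'" using int(1) inv_mult_eq_one_imp_eq[of x x'] mem x by simp
  qed
  have surj: "\<phi> ` A = B"
  proof
    show "\<phi> ` A \<subseteq> B" using \<phi> by auto
    show "B \<subseteq> \<phi> ` A"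
    proof
      fix y assume y: "y \<in> B"
      then have "y \<in> A <#> C" using prod mem by auto
      then obtain a c where ac: "a \<in> A" "c \<in> C" "y = a \<otimes> c" by (auto simp: set_mult_def)
      then have "inv a \<otimes> y = c" using mem by (simp add: m_assoc[symmetric])
      then have "y = \<phi> (inv a)" using uniq[of "inv a" y] icl ac y by auto
      then show "y \<in> \<phi> ` A" using ac icl by blast
    qed
  qed
  have surjC: "(\<lambda>x. x \<otimes> \<phi> x) ` A = C"
  proof
    show "(\<lambda>x. x \<otimes> \<phi> x) ` A \<subseteq> C" using \<phi> by auto
    show "C \<subseteq> (\<lambda>x. x \<otimes> \<phi> x) ` A"
    proof
      fix c assume c: "c \<in> C"
      then have "c \<in> A <#> B" using prod mem by auto
      then obtain a b where ab: "a \<in> A" "b \<in> B" "c = a \<otimes> b" by (auto simp: set_mult_def)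
      then have "b = \<phi> a" using uniq c by auto
      then show "c \<in> (\<lambda>x. x \<otimes> \<phi> x) ` A" using ab by auto
    qed
  qed
  show thesis
  proof (rule that[OF _ _ surjC])
    show "\<phi> \<in> iso (G\<lparr>carrier := A\<rparr>) (G\<lparr>carrier := B\<rparr>)"
      using hom inj surj by (auto simp: iso_def hom_def bij_betw_def)
    show "(\<lambda>x. x \<otimes> \<phi> x) \<in> hom (G\<lparr>carrier := A\<rparr>) G"
      using hom mem \<phi> by (auto simp: hom_def m_ac)
  qed
qed

lemma (in group) generate_hom_image:
  assumes A: "subgroup A G" and f: "f \<in> hom (G\<lparr>carrier := A\<rparr>) G" and X: "X \<subseteq> A" "generate G X = A"
  shows "generate G (f ` X) = f ` A"
proof -
  have gc: "generate (G\<lparr>carrier := A\<rparr>) X = A" using generate_consistent[OF X(1) A] X(2) by simp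
  interpret group_hom "G\<lparr>carrier := A\<rparr>" G f
    by (simp add: f group_hom_axioms_def group_hom_def A subgroup_imp_group is_group)
  show ?thesis using generate_img[of X] X(1) gc by simp
qed

section \<open>Coordinates over the prime field in an elementary abelian group\<close>

text \<open>A linear combination in multiplicative notation. The exponents are integers rather than
  residues, so that they can be added and composed first and reduced modulo p at the end.\<close>

definition (in comm_group) lin_prod :: "nat \<Rightarrow> (nat \<Rightarrow> 'a) \<Rightarrow> (nat \<Rightarrow> int) \<Rightarrow> 'a" where
  "lin_prod n y c = finprod G (\<lambda>i. y i [^] c i) {1..n}"

context comm_group begin

lemma lin_prod_closed: "y \<in> {1..n} \<rightarrow> carrier G \<Longrightarrow> lin_prod n y c \<in> carrier G"
  by (auto simp: lin_prod_def Pi_def intro!: finprod_closed)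

lemma lin_prod_cong: "y \<in> {1..n} \<rightarrow> carrier G \<Longrightarrow> (\<And>i. i \<in> {1..n} \<Longrightarrow> y i [^] c i = y i [^] d i) \<Longrightarrow>
    lin_prod n y c = lin_prod n y d"
  unfolding lin_prod_def by (intro finprod_cong) (auto simp: Pi_def simp_implies_def)

lemma lin_prod_add: "y \<in> {1..n} \<rightarrow> carrier G \<Longrightarrow>
   lin_prod n y (\<lambda>i. c i + d i) = lin_prod n y c \<otimes> lin_prod n y d"
proof -
  assume y: "y \<in> {1..n} \<rightarrow> carrier G"
  have "lin_prod n y (\<lambda>i. c i + d i) = finprod G (\<lambda>i. y i [^] c i \<otimes> y i [^] d i) {1..n}"
    unfolding lin_prod_def using y by (intro finprod_cong) (auto simp: Pi_def int_pow_mult simp_implies_def)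
  then show ?thesis unfolding lin_prod_def using y by (subst (asm) finprod_multf) (auto simp: Pi_def)
qed

lemma lin_prod_zero: "y \<in> {1..n} \<rightarrow> carrier G \<Longrightarrow> lin_prod n y (\<lambda>_. 0) = \<one>"
  unfolding lin_prod_def by simp

lemma lin_prod_single:
  assumes "y \<in> {1..n} \<rightarrow> carrier G" "j \<in> {1..n}"
  shows "lin_prod n y (\<lambda>i. if i = j then 1 else 0) = y j"
proof -
  have "lin_prod n y (\<lambda>i. if i = j then 1 else 0) = finprod G (\<lambda>i. if j = i then y i else \<one>) {1..n}"
    unfolding lin_prod_def using assms by (intro finprod_cong) (auto simp: Pi_def simp_implies_def)
  also have "\<dots> = y j" using assms by (intro finprod_singleton) auto
  finally show ?thesis .
qed

lemma lin_prod_nat_pow: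
  "y \<in> {1..n} \<rightarrow> carrier G \<Longrightarrow> lin_prod n y c [^] (m::nat) = lin_prod n y (\<lambda>i. int m * c i)"
proof (induction m)
  case (Suc m)
  have "lin_prod n y (\<lambda>i. int (Suc m) * c i) = lin_prod n y (\<lambda>i. int m * c i + c i)"
    by (simp add: algebra_simps)
  then show ?case using Suc by (simp add: lin_prod_add)
qed (simp add: lin_prod_zero)

text \<open>Substituting linear combinations into a linear combination multiplies the coefficient
  matrices. The outer exponents are nonnegative so that natural powers of a product suffice; the
  reduced representatives used later satisfy this.\<close>

lemma lin_prod_compose:
  assumes y: "y \<in> {1..n} \<rightarrow> carrier G" and d: "\<And>j. j \<in> {1..n} \<Longrightarrow> d j \<ge> 0"
  shows "lin_prod n (\<lambda>j. lin_prod n y (\<lambda>i. c i j)) d = lin_prod n y (\<lambda>i. \<Sum>j=1..n. c i j * d j)"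
proof -
  have "finprod G (\<lambda>j. lin_prod n y (\<lambda>i. c i j) [^] d j) J = lin_prod n y (\<lambda>i. \<Sum>j\<in>J. c i j * d j)"
    if "finite J" "J \<subseteq> {1..n}" for J using that
  proof (induction J)
    case (insert j J)
    obtain m where m: "d j = int m" using d[of j] insert.prems nonneg_int_cases by auto
    have "lin_prod n y (\<lambda>i. c i j) [^] d j = lin_prod n y (\<lambda>i. c i j * d j)"
      unfolding m int_pow_int by (simp add: lin_prod_nat_pow[OF y] mult.commute)
    then show ?case using insert by (simp add: lin_prod_add[OF y] lin_prod_closed[OF y])
  qed (simp add: lin_prod_zero[OF y])
  then show ?thesis by (simp add: lin_prod_def[of n "\<lambda>j. lin_prod n y (\<lambda>i. c i j)"])
qed

lemma generate_subset_lin_prod: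
  assumes y: "y \<in> {1..n} \<rightarrow> carrier G"
  shows "generate G (y ` {1..n}) \<subseteq> range (lin_prod n y)"
proof (rule generate_subgroup_incl)
  show "y ` {1..n} \<subseteq> range (lin_prod n y)"
    using lin_prod_single[OF y] by (metis image_subsetI rangeI)
  show "subgroup (range (lin_prod n y)) G"
  proof (rule subgroupI)
    show "range (lin_prod n y) \<subseteq> carrier G" using lin_prod_closed[OF y] by auto
    fix a assume "a \<in> range (lin_prod n y)"
    then obtain c where c: "a = lin_prod n y c" by auto
    have "lin_prod n y (\<lambda>i. - c i) \<otimes> a = lin_prod n y (\<lambda>_. 0)"
      unfolding c by (subst lin_prod_add[OF y, symmetric]) simp
    then have "inv a = lin_prod n y (\<lambda>i. - c i)"
      using lin_prod_zero[OF y] lin_prod_closed[OF y] c by (intro inv_equality) auto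
    then show "inv a \<in> range (lin_prod n y)" by auto
    fix b assume "b \<in> range (lin_prod n y)"
    then obtain d where d: "b = lin_prod n y d" by auto
    show "a \<otimes> b \<in> range (lin_prod n y)" unfolding c d lin_prod_add[OF y, symmetric] by (rule rangeI)
  qed auto
qed

lemma int_pow_mod_exponent:
  assumes "x \<in> carrier G" "x [^] (p::nat) = \<one>"
  shows "x [^] (m::int) = x [^] (m mod int p)"
proof -
  have "x [^] m = x [^] (int p * (m div int p) + m mod int p)" by simp
  also have "\<dots> = (x [^] int p) [^] (m div int p) \<otimes> x [^] (m mod int p)"
    using assms(1) by (simp only: int_pow_mult int_pow_pow)
  also have "x [^] int p = \<one>" using assms(2) by (simp add: int_pow_int)
  finally show ?thesis using assms(1) by simp
qed

lemma lin_prod_mod_exponent: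
  assumes y: "y \<in> {1..n} \<rightarrow> carrier G" and "\<And>i. i \<in> {1..n} \<Longrightarrow> y i [^] (p::nat) = \<one>"
  shows "lin_prod n y c = lin_prod n y (restrict (\<lambda>i. c i mod int p) {1..n})"
proof (rule lin_prod_cong[OF y])
  fix i assume i: "i \<in> {1..n}"
  then have "y i \<in> carrier G" using y by blast
  from int_pow_mod_exponent[OF this assms(2)[OF i]]
  show "y i [^] c i = y i [^] restrict (\<lambda>i. c i mod int p) {1..n} i" using i by simp
qed

text \<open>Reducing exponents modulo p shows that the map is onto. Source and target both have p^n
  elements, so it is injective: the independence of the generators is obtained by counting.\<close>

lemma lin_prod_bij:
  assumes y: "y \<in> {1..n} \<rightarrow> carrier G" and gen: "generate G (y ` {1..n}) = B"
    and ex: "\<And>x. x \<in> B \<Longrightarrow> x [^] (p::nat) = \<one>" and card: "card B = p ^ n" and p: "p > 0"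
  shows "bij_betw (lin_prod n y) ({1..n} \<rightarrow>\<^sub>E {0..<int p}) B"
proof -
  let ?D = "{1..n} \<rightarrow>\<^sub>E {0..<int p}"
  have yB: "y i \<in> B" if "i \<in> {1..n}" for i using that gen generate.incl[of "y i" "y ` {1..n}"] by auto
  have cD: "card ?D = p ^ n" by (simp add: card_PiE)
  have "y ` {1..n} \<subseteq> carrier G" using y by auto
  then have B: "subgroup B G" using generate_is_subgroup gen by blast
  have sub: "lin_prod n y c \<in> B" for c
  proof -
    have "finprod G (\<lambda>i. y i [^] c i) J \<in> B" if "finite J" "J \<subseteq> {1..n}" for J using that
    proof (induction J)
      case empty then show ?case using subgroup.one_closed[OF B] by simp
    next
      case (insert j J)
      then have "y j [^] c j \<in> B" using yB subgroup_int_pow_closed[OF B] by auto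
      moreover have "finprod G (\<lambda>i. y i [^] c i) (insert j J) = y j [^] c j \<otimes> finprod G (\<lambda>i. y i [^] c i) J"
        using insert y by (intro finprod_insert) auto
      ultimately show ?case using insert subgroup.m_closed[OF B] by auto
    qed
    then show ?thesis by (simp add: lin_prod_def)
  qed
  have "B \<subseteq> lin_prod n y ` ?D"
  proof
    fix b assume "b \<in> B"
    then obtain c where c: "b = lin_prod n y c" using generate_subset_lin_prod[OF y] gen by auto
    have "b = lin_prod n y (restrict (\<lambda>i. c i mod int p) {1..n})"
      unfolding c using yB ex by (intro lin_prod_mod_exponent[OF y]) blast
    moreover have "restrict (\<lambda>i. c i mod int p) {1..n} \<in> ?D" using p by auto
    ultimately show "b \<in> lin_prod n y ` ?D" by blast
  qed
  then have im: "lin_prod n y ` ?D = B" using sub by auto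
  have "finite ?D" by (intro finite_PiE) auto
  then have "inj_on (lin_prod n y) ?D" using im cD card by (intro eq_card_imp_inj_on) auto
  then show ?thesis using im by (simp add: bij_betw_def)
qed

text \<open>Each family is written in the other with reduced exponents. The two matrices obtained in
  this way are inverse to each other because reduced exponents are unique.\<close>

lemma change_of_basis:
  assumes y: "y \<in> {1..n} \<rightarrow> carrier G" and gen: "generate G (y ` {1..n}) = B"
    and y': "y' \<in> {1..n} \<rightarrow> carrier G" and gen': "generate G (y' ` {1..n}) = B"
    and ex: "\<And>x. x \<in> B \<Longrightarrow> x [^] (p::nat) = \<one>" and card: "card B = p ^ n" and p: "prime p"
  obtains c where "invertible_matrix (residue_ring (int p)) n c"
    "\<And>j. j \<in> {1..n} \<Longrightarrow> y' j = lin_prod n y (\<lambda>i. c i j)"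
proof -
  have p0: "p > 0" "p > 1" using p prime_gt_0_nat prime_gt_1_nat by auto
  interpret R: residues "int p" "residue_ring (int p)" using p0 by unfold_locales auto
  let ?D = "{1..n} \<rightarrow>\<^sub>E {0..<int p}"
  have main: "\<exists>c. (\<forall>j\<in>{1..n}. (\<lambda>i. c i j) \<in> ?D \<and> z' j = lin_prod n z (\<lambda>i. c i j))"
    if z: "z \<in> {1..n} \<rightarrow> carrier G" "generate G (z ` {1..n}) = B"
      and z': "z' \<in> {1..n} \<rightarrow> carrier G" "generate G (z' ` {1..n}) = B" for z z'
  proof -
    have "z' j \<in> lin_prod n z ` ?D" if "j \<in> {1..n}" for j
      using lin_prod_bij[OF z ex card p0(1)] that z'(2) generate.incl[of "z' j" "z' ` {1..n}"]
      by (auto simp: bij_betw_def)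
    then have "\<forall>j\<in>{1..n}. \<exists>f. f \<in> ?D \<and> z' j = lin_prod n z f" by blast
    then obtain f where "\<forall>j\<in>{1..n}. f j \<in> ?D \<and> z' j = lin_prod n z (f j)" by metis
    then show ?thesis by (intro exI[of _ "\<lambda>i j. f j i"]) auto
  qed
  \<comment> \<open>Substituting one expansion into the other writes \<open>z j\<close> with the
    exponents of the matrix product; the unit vector also represents \<open>z j\<close>. After
    reduction modulo p both lie in \<open>?D\<close>, where \<open>lin_prod\<close> is injective.
    The families are kept general so that both orders of the product are covered.\<close>
  have inverse: "(\<Sum>k=1..n. c i k * d k j) mod int p = (if i = j then 1 else 0)"
    if z: "z \<in> {1..n} \<rightarrow> carrier G" "generate G (z ` {1..n}) = B"
      and c: "\<forall>j\<in>{1..n}. (\<lambda>i. c i j) \<in> ?D \<and> z' j = lin_prod n z (\<lambda>i. c i j)"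
      and d: "\<forall>j\<in>{1..n}. (\<lambda>i. d i j) \<in> ?D \<and> z j = lin_prod n z' (\<lambda>i. d i j)"
      and ij: "i \<in> {1..n}" "j \<in> {1..n}" for z z' c d i j
  proof -
    let ?s = "\<lambda>i. \<Sum>k=1..n. c i k * d k j"
    have zB: "z i \<in> B" if "i \<in> {1..n}" for i using that z(2) generate.incl[of "z i" "z ` {1..n}"] by auto
    have "z j = lin_prod n z' (\<lambda>k. d k j)" using d ij by auto
    also have "\<dots> = lin_prod n (\<lambda>k. lin_prod n z (\<lambda>i. c i k)) (\<lambda>k. d k j)"
      unfolding lin_prod_def[of n z'] lin_prod_def[of n "\<lambda>k. lin_prod n z (\<lambda>i. c i k)"]
      using c lin_prod_closed[OF z(1)] by (intro finprod_cong) (auto simp: simp_implies_def)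
    also have "\<dots> = lin_prod n z ?s" using d ij by (intro lin_prod_compose[OF z(1)]) (auto simp: PiE_def Pi_def)
    also have "\<dots> = lin_prod n z (restrict (\<lambda>i. ?s i mod int p) {1..n})"
      using zB ex by (intro lin_prod_mod_exponent[OF z(1)]) blast
    finally have 1: "z j = lin_prod n z (restrict (\<lambda>i. ?s i mod int p) {1..n})" .
    have 2: "z j = lin_prod n z (restrict (\<lambda>i. if i = j then 1 else 0) {1..n})"
      using lin_prod_single[OF z(1) ij(2)] lin_prod_cong[OF z(1), of "\<lambda>i. if i = j then 1 else 0" "restrict (\<lambda>i. if i = j then 1 else 0) {1..n}"]
      by simp
    have "restrict (\<lambda>i. ?s i mod int p) {1..n} = restrict (\<lambda>i. if i = j then 1 else 0) {1..n}"
      using lin_prod_bij[OF z ex card p0(1)] 1 2 p0 unfolding bij_betw_def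
      by (intro inj_onD[of "lin_prod n z" ?D]) auto
    from fun_cong[OF this, of i] show ?thesis using ij by simp
  qed
  obtain c where c: "\<forall>j\<in>{1..n}. (\<lambda>i. c i j) \<in> ?D \<and> y' j = lin_prod n y (\<lambda>i. c i j)"
    using main[OF y gen y' gen'] by blast
  obtain d where d: "\<forall>j\<in>{1..n}. (\<lambda>i. d i j) \<in> ?D \<and> y j = lin_prod n y' (\<lambda>i. d i j)"
    using main[OF y' gen' y gen] by blast
  have fs: "(\<Oplus>\<^bsub>residue_ring (int p)\<^esub>k\<in>{1..n}. c i k \<otimes>\<^bsub>residue_ring (int p)\<^esub> d k j)
      = (\<Sum>k=1..n. c i k * d k j) mod int p" for c d :: "nat \<Rightarrow> nat \<Rightarrow> int" and i j
    using R.sum_cong[of "{1..n}" "\<lambda>k. c i k * d k j"] by (simp add: R.res_mult_eq)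
  have "inverse_matrices (residue_ring (int p)) n c d"
    unfolding inverse_matrices_def fs R.res_one_eq R.res_zero_eq
    using inverse[OF y gen c d] inverse[OF y' gen' d c] by blast
  moreover have "matrix_over (residue_ring (int p)) n c" "matrix_over (residue_ring (int p)) n d"
    using c d unfolding matrix_over_def by (auto simp: R.res_carrier_eq PiE_def Pi_def)
  ultimately show thesis using c by (intro that[of c]) (auto simp: invertible_matrix_def)
qed

end

section \<open>Commuting subgroups of a central extension with a spread\<close>

lemma mult_eq_maximal_nat:
  fixes u w a b :: nat
  assumes "u \<le> a" "w \<le> b" "a * b \<le> u * w" "a > 0" "b > 0"
  shows "u = a \<and> w = b"
proof -
  have "a * b \<le> u * b" "a * b \<le> a * w"
    using assms mult_le_mono2[of w b u] mult_le_mono1[of u a w] by linarith+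
  then show ?thesis using assms by auto
qed

lemma card_le_fibers:
  assumes "finite T" "\<phi> ` W \<subseteq> T" "\<And>w. w \<in> W \<Longrightarrow> finite {v\<in>W. \<phi> v = \<phi> w} \<and> card {v\<in>W. \<phi> v = \<phi> w} \<le> m"
  shows "card W \<le> card T * m"
proof -
  have fT: "finite (\<phi> ` W)" using assms finite_subset by blast
  have "W = (\<Union>t\<in>\<phi> ` W. {v\<in>W. \<phi> v = t})" by auto
  then have "card W \<le> (\<Sum>t\<in>\<phi> ` W. card {v\<in>W. \<phi> v = t})"
    using card_UN_le[OF fT, of "\<lambda>t. {v\<in>W. \<phi> v = t}"] by simp
  also have "\<dots> \<le> (\<Sum>t\<in>\<phi> ` W. m)" by (rule sum_mono) (use assms(3) in auto)
  also have "\<dots> = card (\<phi> ` W) * m" by simp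
  also have "\<dots> \<le> card T * m" using assms(1,2) card_mono by (intro mult_right_mono) auto
  finally show ?thesis .
qed

text \<open>Right translation by \<open>inv w\<close> embeds the fibre through \<open>w\<close> into
  \<open>N\<close>. The map \<open>\<phi>\<close> is arbitrary, so it can be a triple of form values
  whose first entry lies in a mere set such as \<open>K\<close>.\<close>

lemma (in group) card_le_index:
  assumes "finite (carrier G)" "subgroup W G" "N \<subseteq> carrier G" "finite T" "\<phi> ` W \<subseteq> T"
    and "\<And>v w. v \<in> W \<Longrightarrow> w \<in> W \<Longrightarrow> \<phi> v = \<phi> w \<Longrightarrow> v \<otimes> inv w \<in> N"
  shows "card W \<le> card T * card N"
proof (rule card_le_fibers[OF assms(4,5)])
  fix w assume w: "w \<in> W"
  note sub = subgroup.mem_carrier[OF assms(2)]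
  have fN: "finite N" using assms finite_subset by blast
  have "inj_on (\<lambda>v. v \<otimes> inv w) {v\<in>W. \<phi> v = \<phi> w}"
    using w sub by (intro inj_onI) auto
  moreover have "(\<lambda>v. v \<otimes> inv w) ` {v\<in>W. \<phi> v = \<phi> w} \<subseteq> N" using assms(6) w by auto
  ultimately show "finite {v\<in>W. \<phi> v = \<phi> w} \<and> card {v\<in>W. \<phi> v = \<phi> w} \<le> card N"
    using fN by (meson card_inj_on_le inj_on_finite)
qed

text \<open>Abstracts from the field: \<open>e i\<close> is the \<open>i\<close>-th coordinate map \<open>G \<rightarrow> E\<close>, the family \<open>line\<close> is a spread
  of \<open>E\<close> indexed by \<open>L\<close>, \<open>sg\<close> is the conjugation of lines, and \<open>K\<close> plays the role of the skew
  elements of \<open>F\<close>. Both additive groups \<open>E\<close> and \<open>F\<close> are written multiplicatively.\<close>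

locale spread_group = G?: group G + E: comm_group E + F: group F
  for G :: "'g monoid" (structure) and E :: "'e monoid" and F :: "'f monoid" +
  fixes r k :: nat and e :: "nat \<Rightarrow> 'g \<Rightarrow> 'e" and h :: "'e \<Rightarrow> 'e \<Rightarrow> 'f"
    and K :: "'f set" and L :: "'l set" and line :: "'l \<Rightarrow> 'e set" and sg :: "'l \<Rightarrow> 'l"
  assumes r3: "r \<ge> 3" and k2: "k \<ge> 2" and fin: "finite (carrier G)"
    and cardE: "card (carrier E) = k\<^sup>2" and cardF: "card (carrier F) = k"
    and e_hom: "\<And>i. i < r \<Longrightarrow> e i \<in> hom G E"
    and e_surj: "\<And>f. f \<in> {..<r} \<rightarrow> carrier E \<Longrightarrow> \<exists>g\<in>carrier G. \<forall>i<r. e i g = f i"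
    and h_closed: "\<And>s t. s \<in> carrier E \<Longrightarrow> t \<in> carrier E \<Longrightarrow> h s t \<in> carrier F"
    and h_right: "\<And>s t u. s \<in> carrier E \<Longrightarrow> t \<in> carrier E \<Longrightarrow> u \<in> carrier E \<Longrightarrow>
           h s (t \<otimes>\<^bsub>E\<^esub> u) = h s t \<otimes>\<^bsub>F\<^esub> h s u"
    and h_left: "\<And>s t u. s \<in> carrier E \<Longrightarrow> t \<in> carrier E \<Longrightarrow> u \<in> carrier E \<Longrightarrow>
           h (s \<otimes>\<^bsub>E\<^esub> t) u = h s u \<otimes>\<^bsub>F\<^esub> h t u"
    and h_refl: "\<And>s t. s \<in> carrier E \<Longrightarrow> t \<in> carrier E \<Longrightarrow> h s t = \<one>\<^bsub>F\<^esub> \<Longrightarrow> h t s = \<one>\<^bsub>F\<^esub>"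
    and comm_iff: "\<And>x y. x \<in> carrier G \<Longrightarrow> y \<in> carrier G \<Longrightarrow>
           x \<otimes> y = y \<otimes> x \<longleftrightarrow> (\<forall>i<r. \<forall>j<r. h (e i x) (e j y) = h (e i y) (e j x))"
    and selfK: "\<And>s t. s \<in> carrier E \<Longrightarrow> t \<in> carrier E \<Longrightarrow> h s t = h t s \<Longrightarrow> h s t \<in> K"
    and K_proper: "K \<subset> carrier F"
    and line_subgroup: "\<And>l. l \<in> L \<Longrightarrow> subgroup (line l) E"
    and line_card: "\<And>l. l \<in> L \<Longrightarrow> card (line l) = k"
    and line_inter: "\<And>l m. l \<in> L \<Longrightarrow> m \<in> L \<Longrightarrow> l \<noteq> m \<Longrightarrow> line l \<inter> line m = {\<one>\<^bsub>E\<^esub>}"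
    and line_cover: "carrier E \<subseteq> (\<Union>l\<in>L. line l)"
    and sg_closed: "\<And>l. l \<in> L \<Longrightarrow> sg l \<in> L" and sg_inj: "inj_on sg L"
    and perp: "\<And>l s t. l \<in> L \<Longrightarrow> s \<in> line l \<Longrightarrow> s \<noteq> \<one>\<^bsub>E\<^esub> \<Longrightarrow> t \<in> carrier E \<Longrightarrow>
           h s t = \<one>\<^bsub>F\<^esub> \<longleftrightarrow> t \<in> line (sg l)"
    and cardL: "card L = k + 1"
begin

section \<open>Coordinates, lines and the orders of the subgroups\<close>

text \<open>The common kernel of the coordinates. It is visibly central, but that it is the whole
  centre is a consequence of the bound on commuting subgroups, see \<open>center_eq\<close>.\<close>

definition Z where "Z = {g \<in> carrier G. \<forall>i<r. e i g = \<one>\<^bsub>E\<^esub>}"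
definition M where "M l = {g \<in> carrier G. \<forall>i<r. e i g \<in> line l}"

lemma e_closed: "i < r \<Longrightarrow> g \<in> carrier G \<Longrightarrow> e i g \<in> carrier E"
  using e_hom by (auto simp: hom_def)

lemma e_mult: "i < r \<Longrightarrow> g \<in> carrier G \<Longrightarrow> g' \<in> carrier G \<Longrightarrow> e i (g \<otimes> g') = e i g \<otimes>\<^bsub>E\<^esub> e i g'"
  using e_hom by (auto simp: hom_def)

lemma e_group_hom: "i < r \<Longrightarrow> group_hom G E (e i)"
  by (simp add: e_hom group_hom_axioms_def group_hom_def G.is_group E.is_group)

lemma e_inv: "i < r \<Longrightarrow> g \<in> carrier G \<Longrightarrow> e i (inv g) = inv\<^bsub>E\<^esub> (e i g)"
  using group_hom.hom_inv[OF e_group_hom] .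

lemma e_one: "i < r \<Longrightarrow> e i \<one> = \<one>\<^bsub>E\<^esub>"
  using group_hom.hom_one[OF e_group_hom] .

lemma e_div_eq_one_iff: "i < r \<Longrightarrow> g \<in> carrier G \<Longrightarrow> g' \<in> carrier G \<Longrightarrow>
   e i (g \<otimes> inv g') = \<one>\<^bsub>E\<^esub> \<longleftrightarrow> e i g = e i g'"
  by (metis E.inv_closed E.inv_equality E.inv_inv E.r_inv e_closed e_inv e_mult inv_closed)

lemma h_one_right: "s \<in> carrier E \<Longrightarrow> h s \<one>\<^bsub>E\<^esub> = \<one>\<^bsub>F\<^esub>"
  by (metis E.l_one E.one_closed F.l_cancel_one' h_closed h_right)

lemma h_one_left: "s \<in> carrier E \<Longrightarrow> h \<one>\<^bsub>E\<^esub> s = \<one>\<^bsub>F\<^esub>"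
  by (simp add: h_one_right h_refl)

lemma h_div_right: "s \<in> carrier E \<Longrightarrow> t \<in> carrier E \<Longrightarrow> u \<in> carrier E \<Longrightarrow> h s t = h s u \<Longrightarrow>
   h s (t \<otimes>\<^bsub>E\<^esub> inv\<^bsub>E\<^esub> u) = \<one>\<^bsub>F\<^esub>"
  by (metis E.inv_closed E.r_inv h_one_right h_right)

lemma finE: "finite (carrier E)" using cardE k2 card.infinite by fastforce
lemma finF: "finite (carrier F)" using cardF k2 card.infinite by fastforce

lemma line_sub: "l \<in> L \<Longrightarrow> s \<in> line l \<Longrightarrow> s \<in> carrier E"
  using line_subgroup subgroup.mem_carrier by metis

lemma line_one: "l \<in> L \<Longrightarrow> \<one>\<^bsub>E\<^esub> \<in> line l"
  using line_subgroup subgroup.one_closed by metis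

lemma line_perp: "l \<in> L \<Longrightarrow> s \<in> line l \<Longrightarrow> t \<in> line (sg l) \<Longrightarrow> h s t = \<one>\<^bsub>F\<^esub>"
  by (metis h_one_left line_sub perp sg_closed)

text \<open>The elements orthogonal to \<open>s\<close> and to \<open>t\<close> form the two
  conjugate lines. These are different because \<open>sg\<close> is injective, so they meet
  trivially.\<close>

lemma perp_two:
  assumes "l \<in> L" "m \<in> L" "l \<noteq> m" "s \<in> line l" "s \<noteq> \<one>\<^bsub>E\<^esub>" "t \<in> line m" "t \<noteq> \<one>\<^bsub>E\<^esub>" "u \<in> carrier E"
    "h s u = \<one>\<^bsub>F\<^esub>" "h t u = \<one>\<^bsub>F\<^esub>"
  shows "u = \<one>\<^bsub>E\<^esub>"
proof -
  have "sg l \<noteq> sg m" using sg_inj assms by (meson inj_onD)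
  moreover have "u \<in> line (sg l)" "u \<in> line (sg m)" using assms perp by auto
  ultimately show ?thesis using line_inter sg_closed assms by blast
qed

lemma Z_sub: "Z \<subseteq> carrier G" by (auto simp: Z_def)
lemma M_sub: "M l \<subseteq> carrier G" by (auto simp: M_def)

lemma Z_subgroup: "subgroup Z G"
  by (rule subgroupI) (auto simp: Z_def e_one e_inv e_mult intro: exI[of _ \<one>])

lemma M_subgroup: "l \<in> L \<Longrightarrow> subgroup (M l) G"
  using line_subgroup[of l]
  by (intro subgroupI)
    (auto simp: M_def e_one e_inv e_mult line_one subgroup.m_closed subgroup.m_inv_closed intro: exI[of _ \<one>])

text \<open>The coordinate vectors fill S^r by \<open>e_surj\<close>, and the elements with a given
  vector form a coset of \<open>Z\<close>. Used with a line for \<open>card_M\<close> and with all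
  of \<open>E\<close> for \<open>card_G\<close>.\<close>

lemma card_preimage:
  assumes S: "S \<subseteq> carrier E"
  shows "card {g \<in> carrier G. \<forall>i<r. e i g \<in> S} = card S ^ r * card Z"
proof -
  define A where "A = {g \<in> carrier G. \<forall>i<r. e i g \<in> S}"
  define vec where "vec = (\<lambda>g. restrict (\<lambda>i. e i g) {..<r})"
  let ?T = "{..<r} \<rightarrow>\<^sub>E S"
  have fT: "finite ?T" using S finE finite_subset by (intro finite_PiE) auto
  have im: "vec ` A \<subseteq> ?T" by (auto simp: vec_def A_def split: if_splits)
  have fib: "finite {g\<in>A. vec g = t} \<and> card {g\<in>A. vec g = t} = card Z" if t: "t \<in> ?T" for t
  proof -
    obtain g0 where g0: "g0 \<in> carrier G" "\<forall>i<r. e i g0 = t i" using e_surj[of t] t S by (auto simp: PiE_def Pi_def)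
    have "{g\<in>A. vec g = t} = (\<lambda>z. z \<otimes> g0) ` Z"
    proof (intro equalityI subsetI)
      fix g assume g: "g \<in> {g\<in>A. vec g = t}"
      then have gc: "g \<in> carrier G" and "\<forall>i<r. e i g = t i" by (auto simp: A_def vec_def)
      then have "g \<otimes> inv g0 \<in> Z" using g0 by (auto simp: Z_def e_div_eq_one_iff)
      moreover have "g = g \<otimes> inv g0 \<otimes> g0" using gc g0 by (simp add: m_assoc)
      ultimately show "g \<in> (\<lambda>z. z \<otimes> g0) ` Z" by blast
    next
      fix g assume "g \<in> (\<lambda>z. z \<otimes> g0) ` Z"
      then obtain z where z: "z \<in> Z" "g = z \<otimes> g0" by auto
      have "e i g = t i" if "i < r" for i
        using z g0 that by (auto simp: Z_def e_mult e_closed) (metis E.l_one e_closed)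
      moreover have "vec g = t" using calculation t
        by (intro ext) (auto simp: vec_def PiE_def extensional_def)
      ultimately show "g \<in> {g\<in>A. vec g = t}" using z g0 t by (auto simp: A_def Z_def)
    qed
    moreover have "inj_on (\<lambda>z. z \<otimes> g0) Z" using g0(1) Z_sub by (intro inj_onI) (metis subsetD right_cancel)
    ultimately show ?thesis using fin Z_sub finite_subset[OF Z_sub fin] by (simp add: card_image)
  qed
  have "A = (\<Union>t\<in>?T. {g\<in>A. vec g = t})" using im by auto
  then have "card A = (\<Sum>t\<in>?T. card {g\<in>A. vec g = t})"
    using card_UN_disjoint[OF fT, of "\<lambda>t. {g\<in>A. vec g = t}"] fib by auto
  also have "\<dots> = card ?T * card Z" using fib by simp
  also have "card ?T = card S ^ r" by (simp add: card_PiE)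
  finally show ?thesis by (simp add: A_def)
qed

lemma card_M: "l \<in> L \<Longrightarrow> card (M l) = k ^ r * card Z"
  using card_preimage[of "line l"] line_sub line_card by (auto simp: M_def subset_iff)

lemma card_G: "card (carrier G) = k ^ (2 * r) * card Z"
proof -
  have "carrier G = {g \<in> carrier G. \<forall>i<r. e i g \<in> carrier E}" using e_closed by auto
  then show ?thesis using card_preimage[of "carrier E"] cardE by (simp flip: power_mult)
qed

lemma Z_pos: "card Z > 0"
  using Z_subgroup fin finite_subset[OF Z_sub fin] subgroup.one_closed[OF Z_subgroup] card_gt_0_iff by blast

lemma comm_h: "x \<in> carrier G \<Longrightarrow> y \<in> carrier G \<Longrightarrow> x \<otimes> y = y \<otimes> x \<Longrightarrow> i < r \<Longrightarrow> j < r \<Longrightarrow>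
   h (e i x) (e j y) = h (e i y) (e j x)"
  using comm_iff by blast

section \<open>Bounds for commuting subgroups\<close>

definition commuting where "commuting U W \<longleftrightarrow> (\<forall>x\<in>U. \<forall>y\<in>W. x \<otimes> y = y \<otimes> x)"

lemma commuting_h:
  assumes "subgroup U G" "subgroup W G" "commuting U W" "x \<in> U" "y \<in> W" "i < r" "j < r"
  shows "h (e i x) (e j y) = h (e i y) (e j x)"
  using assms(3-5) by (intro comm_h assms(6,7) assms(1,2)[THEN subgroup.mem_carrier]) (auto simp only: commuting_def)

lemma commuting_sym: "commuting U W \<Longrightarrow> commuting W U"
  unfolding commuting_def by metis

text \<open>Linear independence of two vectors, expressed through the spread because
  \<open>E\<close> carries no scalar multiplication here.\<close>

definition indep where "indep s t \<longleftrightarrow> (\<exists>l\<in>L. \<exists>m\<in>L. l \<noteq> m \<and> s \<in> line l \<and> t \<in> line m \<and> s \<noteq> \<one>\<^bsub>E\<^esub> \<and> t \<noteq> \<one>\<^bsub>E\<^esub>)"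

lemma perp_indep: "indep s t \<Longrightarrow> u \<in> carrier E \<Longrightarrow> h s u = \<one>\<^bsub>F\<^esub> \<Longrightarrow> h t u = \<one>\<^bsub>F\<^esub> \<Longrightarrow> u = \<one>\<^bsub>E\<^esub>"
  unfolding indep_def by (elim bexE conjE) (rule perp_two)

lemma indepI: "l \<in> L \<Longrightarrow> s \<in> line l \<Longrightarrow> s \<noteq> \<one>\<^bsub>E\<^esub> \<Longrightarrow> t \<in> carrier E \<Longrightarrow> t \<notin> line l \<Longrightarrow> indep s t"
proof -
  assume a: "l \<in> L" "s \<in> line l" "s \<noteq> \<one>\<^bsub>E\<^esub>" "t \<in> carrier E" "t \<notin> line l"
  obtain m where m: "m \<in> L" "t \<in> line m" using a line_cover by blast
  then have "m \<noteq> l" "t \<noteq> \<one>\<^bsub>E\<^esub>" using a line_one by auto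
  then show ?thesis unfolding indep_def
    by (intro bexI[OF _ a(1)] bexI[OF _ m(1)] conjI) (use a(2,3) m(2) in auto)
qed

text \<open>An element of \<open>W\<close> is determined modulo \<open>Z\<close> by its
  \<open>i\<close>-th coordinate alone: if that is trivial for \<open>y\<close>, commuting with
  \<open>x\<close> and \<open>x'\<close> makes every \<open>e j y\<close> orthogonal to two
  independent vectors.\<close>

lemma bound_same_index:
  assumes U: "subgroup U G" and W: "subgroup W G" and c: "commuting U W"
    and x: "x \<in> U" "x' \<in> U" "i < r" "indep (e i x) (e i x')"
  shows "card W \<le> k\<^sup>2 * card Z"
proof -
  have "card W \<le> card (carrier E) * card Z"
  proof (rule card_le_index[OF fin W Z_sub finE, where \<phi> = "e i"])
    show "e i ` W \<subseteq> carrier E" using x e_closed W by (auto dest: subgroup.mem_carrier)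
    fix v w assume vw: "v \<in> W" "w \<in> W" "e i v = e i w"
    note sub = subgroup.mem_carrier[OF W] subgroup.mem_carrier[OF U]
    define y where "y = v \<otimes> inv w"
    have y: "y \<in> W" "y \<in> carrier G" "e i y = \<one>\<^bsub>E\<^esub>"
      using vw sub x W by (auto simp: y_def e_div_eq_one_iff subgroup.m_closed subgroup.m_inv_closed)
    have "h (e i z) (e j y) = \<one>\<^bsub>F\<^esub>" if "z \<in> U" "j < r" for z j
      using commuting_h[OF U W c that(1) y(1) x(3) that(2)] y sub that h_one_left e_closed by simp
    then have "e j y = \<one>\<^bsub>E\<^esub>" if "j < r" for j
      using perp_indep[OF x(4) e_closed[OF that y(2)]] x(1,2) that by simp
    then show "v \<otimes> inv w \<in> Z" using y(2) unfolding Z_def y_def[symmetric] by simp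
  qed
  then show ?thesis using cardE by simp
qed

text \<open>Let the three form values of \<open>y\<close> be trivial. Commuting turns
  \<open>h (e j x) (e i y)\<close> into \<open>h (e j y) (e i x)\<close>, which is trivial by
  \<open>h_refl\<close> along with the second value. So \<open>e i y\<close> and
  \<open>e j y\<close> are orthogonal to two independent vectors and vanish; commuting then makes
  every other coordinate of \<open>y\<close> orthogonal to the same two vectors. The first value
  equals its own transpose and hence lies in \<open>K\<close>, which makes the bound strict.\<close>

lemma bound_diff_index:
  assumes U: "subgroup U G" and W: "subgroup W G" and c: "commuting U W"
    and x: "x \<in> U" "i < r" "j < r" "indep (e i x) (e j x)"
  shows "card W < k ^ 3 * card Z"
proof -
  note sub = subgroup.mem_carrier[OF W] subgroup.mem_carrier[OF U]
  let ?T = "K \<times> carrier F \<times> carrier F"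
  have fK: "finite K" using K_proper finF by (auto intro: finite_subset)
  have "card W \<le> card ?T * card Z"
  proof (rule card_le_index[OF fin W Z_sub, where \<phi> = "\<lambda>y. (h (e i x) (e i y), h (e i x) (e j y), h (e j x) (e j y))"])
    show "finite ?T" using fK finF by auto
    show "(\<lambda>y. (h (e i x) (e i y), h (e i x) (e j y), h (e j x) (e j y))) ` W \<subseteq> ?T"
    proof (rule image_subsetI)
      fix y assume y: "y \<in> W"
      have ec: "e i x \<in> carrier E" "e j x \<in> carrier E" "e i y \<in> carrier E" "e j y \<in> carrier E"
        using x y sub e_closed by auto
      have "h (e i x) (e i y) = h (e i y) (e i x)" using commuting_h[OF U W c x(1) y x(2) x(2)] .
      then show "(h (e i x) (e i y), h (e i x) (e j y), h (e j x) (e j y)) \<in> ?T"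
        using selfK h_closed ec by simp
    qed
    fix v w assume vw: "v \<in> W" "w \<in> W"
      "(h (e i x) (e i v), h (e i x) (e j v), h (e j x) (e j v)) = (h (e i x) (e i w), h (e i x) (e j w), h (e j x) (e j w))"
    define y where "y = v \<otimes> inv w"
    have y: "y \<in> W" "y \<in> carrier G"
      using vw sub x W by (auto simp: y_def subgroup.m_closed subgroup.m_inv_closed)
    have "h (e i x) (e i y) = \<one>\<^bsub>F\<^esub>" "h (e i x) (e j y) = \<one>\<^bsub>F\<^esub>" "h (e j x) (e j y) = \<one>\<^bsub>F\<^esub>"
      using vw x sub by (auto simp: y_def e_mult e_inv e_closed h_div_right)
    moreover have "h (e j x) (e i y) = \<one>\<^bsub>F\<^esub>"
      using calculation(2) commuting_h[OF U W c x(1) y(1) x(3) x(2)] x y sub h_refl e_closed by metis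
    ultimately have "e i y = \<one>\<^bsub>E\<^esub>" "e j y = \<one>\<^bsub>E\<^esub>" using perp_indep[OF x(4)] x y e_closed by auto
    then have "h (e i x) (e m y) = \<one>\<^bsub>F\<^esub>" "h (e j x) (e m y) = \<one>\<^bsub>F\<^esub>" if "m < r" for m
      using commuting_h[OF U W c x(1) y(1) x(2) that] commuting_h[OF U W c x(1) y(1) x(3) that]
        \<open>e i y = _\<close> \<open>e j y = _\<close> that y sub x h_one_left e_closed by simp_all
    then have "e m y = \<one>\<^bsub>E\<^esub>" if "m < r" for m
      using perp_indep[OF x(4) e_closed[OF that y(2)]] that by simp
    then show "v \<otimes> inv w \<in> Z" using y(2) unfolding Z_def y_def[symmetric] by simp
  qed
  also have "card ?T = card K * k\<^sup>2" by (simp add: card_cartesian_product cardF power2_eq_square)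
  also have "card K < k" using K_proper finF cardF psubset_card_mono by metis
  then have "card K * k\<^sup>2 * card Z < k * k\<^sup>2 * card Z" using Z_pos k2 by simp
  finally show ?thesis by (simp add: power_def numeral_3_eq_3 mult_ac)
qed

text \<open>Take \<open>x\<close> with \<open>e i x\<close> nontrivial on \<open>l\<close>, and
  \<open>x'\<close> with \<open>e j x'\<close> off \<open>l\<close>. If the two elements are
  independent in coordinate \<open>i\<close> or \<open>j\<close>, \<open>bound_same_index\<close>
  applies; if one of them has independent coordinates, \<open>bound_diff_index\<close> does.
  Otherwise \<open>e j x\<close> lies on two different lines and vanishes, and \<open>e i x'\<close>
  vanishes too, so the product \<open>x \<otimes> x'\<close> has the independent coordinates
  \<open>e i x\<close> and \<open>e j x'\<close>.\<close>

lemma not_in_line_bound: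
  assumes U: "subgroup U G" and W: "subgroup W G" and c: "commuting U W"
    and nl: "\<And>l. l \<in> L \<Longrightarrow> \<not> U \<subseteq> M l" and nZ: "\<not> U \<subseteq> Z"
  shows "card W < k ^ 3 * card Z"
proof -
  note sub = subgroup.mem_carrier[OF U]
  have k23: "k\<^sup>2 * card Z < k ^ 3 * card Z" using k2 Z_pos by (simp add: power_strict_increasing)
  obtain x i where x: "x \<in> U" "i < r" "e i x \<noteq> \<one>\<^bsub>E\<^esub>" using nZ sub by (auto simp: Z_def)
  obtain l where l: "l \<in> L" "e i x \<in> line l" using line_cover e_closed x sub by blast
  obtain x' j where x': "x' \<in> U" "j < r" "e j x' \<notin> line l" using nl[OF l(1)] sub by (auto simp: M_def)
  have ec: "e i x \<in> carrier E" "e i x' \<in> carrier E" "e j x \<in> carrier E" "e j x' \<in> carrier E"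
    using x x' sub e_closed by auto
  show ?thesis
  proof (cases "indep (e i x) (e i x') \<or> indep (e j x') (e j x)")
    case True
    then have "card W \<le> k\<^sup>2 * card Z" using bound_same_index[OF U W c] x x' by blast
    then show ?thesis using k23 by linarith
  next
    case False
    then have a: "e i x' \<in> line l" using indepI[OF l x(3) ec(2)] by auto
    obtain m where m: "m \<in> L" "e j x' \<in> line m" using line_cover ec by blast
    have x'1: "e j x' \<noteq> \<one>\<^bsub>E\<^esub>" using x' line_one l by auto
    have b: "e j x \<in> line m" using indepI[OF m x'1 ec(3)] False by auto
    have ml: "m \<noteq> l" using m x' by auto
    show ?thesis
    proof (cases "indep (e i x) (e j x) \<or> indep (e i x') (e j x')")
      case True
      then show ?thesis using bound_diff_index[OF U W c] x x' by blast
    next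
      case False
      have "e j x \<in> line l" using indepI[OF l x(3) ec(3)] False by auto
      then have jx: "e j x = \<one>\<^bsub>E\<^esub>" using b line_inter[OF m(1) l(1) ml] by auto
      have "e i x' = \<one>\<^bsub>E\<^esub>"
        using False indepI[OF l(1) a _ ec(4) x'(3)] by auto
      then have "e i (x \<otimes> x') = e i x" "e j (x \<otimes> x') = e j x'"
        using jx x(2) x'(2) sub[OF x(1)] sub[OF x'(1)] ec by (simp_all add: e_mult)
      moreover have "indep (e i x) (e j x')" using indepI[OF l x(3) ec(4) x'(3)] .
      ultimately show ?thesis using bound_diff_index[OF U W c, of "x \<otimes> x'" i j] x x' U
        by (simp add: subgroup.m_closed)
    qed
  qed
qed

text \<open>Let \<open>e m y\<close> be off the conjugate line for some \<open>y\<close> in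
  \<open>W\<close>. If \<open>e m x\<close> is trivial, then each \<open>e i x\<close> is orthogonal
  to \<open>e m y\<close> and must vanish, so \<open>e m\<close> embeds \<open>U\<close> modulo
  \<open>Z\<close> into the line. For \<open>W\<close> fix a nontrivial \<open>e i x\<close>: if
  \<open>h (e i x) (e i y)\<close> is trivial, then \<open>e i y\<close> is on the conjugate line,
  hence orthogonal to every \<open>e m x\<close>, and commuting carries this over to every
  \<open>e m y\<close>. So one form value determines \<open>y\<close> modulo
  \<open>M (sg l)\<close>.\<close>

lemma line_commuting_bound:
  assumes U: "subgroup U G" and W: "subgroup W G" and c: "commuting U W"
    and l: "l \<in> L" "U \<subseteq> M l" and nZ: "\<not> U \<subseteq> Z" and nW: "\<not> W \<subseteq> M (sg l)"
  shows "card U * card W \<le> k ^ (r + 2) * (card Z)\<^sup>2"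
proof -
  note sub = subgroup.mem_carrier[OF W] subgroup.mem_carrier[OF U]
  have ul: "e i x \<in> line l" if "x \<in> U" "i < r" for x i using l that by (auto simp: M_def)
  have "card U \<le> card (line l) * card Z"
  proof -
    obtain y m where y: "y \<in> W" "m < r" "e m y \<notin> line (sg l)" using nW sub by (auto simp: M_def)
    show ?thesis
    proof (rule card_le_index[OF fin U Z_sub, where \<phi> = "e m"])
      show "finite (line l)" using finE line_subgroup[OF l(1)] finite_subset subgroup.subset by metis
      show "e m ` U \<subseteq> line l" using ul y by auto
      fix v w assume vw: "v \<in> U" "w \<in> U" "e m v = e m w"
      define x where "x = v \<otimes> inv w"
      have x: "x \<in> U" "x \<in> carrier G" "e m x = \<one>\<^bsub>E\<^esub>"
        using vw sub y U by (auto simp: x_def e_div_eq_one_iff subgroup.m_closed subgroup.m_inv_closed)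
      have "e i x = \<one>\<^bsub>E\<^esub>" if i: "i < r" for i
      proof (rule ccontr)
        assume n: "e i x \<noteq> \<one>\<^bsub>E\<^esub>"
        have "h (e m y) (e i x) = \<one>\<^bsub>F\<^esub>"
          using commuting_h[OF U W c x(1) y(1,2) i] x y sub i h_one_left e_closed by simp
        then have "h (e i x) (e m y) = \<one>\<^bsub>F\<^esub>" using h_refl e_closed x y sub i by blast
        then show False using perp[OF l(1) ul[OF x(1) i] n] e_closed y sub by auto
      qed
      then show "v \<otimes> inv w \<in> Z" using x(2) unfolding Z_def x_def[symmetric] by simp
    qed
  qed
  moreover have "card W \<le> card (carrier F) * card (M (sg l))"
  proof -
    obtain x i where x: "x \<in> U" "i < r" "e i x \<noteq> \<one>\<^bsub>E\<^esub>" using nZ sub by (auto simp: Z_def)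
    note pl = perp[OF l(1) ul[OF x(1,2)] x(3)]
    show ?thesis
    proof (rule card_le_index[OF fin W M_sub finF, where \<phi> = "\<lambda>y. h (e i x) (e i y)"])
      show "(\<lambda>y. h (e i x) (e i y)) ` W \<subseteq> carrier F" using x sub e_closed h_closed by auto
      fix v w assume vw: "v \<in> W" "w \<in> W" "h (e i x) (e i v) = h (e i x) (e i w)"
      define y where "y = v \<otimes> inv w"
      have y: "y \<in> W" "y \<in> carrier G"
        using vw sub x W by (auto simp: y_def subgroup.m_closed subgroup.m_inv_closed)
      have "h (e i x) (e i y) = \<one>\<^bsub>F\<^esub>"
        using vw x sub by (auto simp: y_def e_mult e_inv e_closed h_div_right)
      then have yi: "e i y \<in> line (sg l)" using pl e_closed x y by auto
      have "e m y \<in> line (sg l)" if m: "m < r" for m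
      proof -
        have "h (e m x) (e i y) = \<one>\<^bsub>F\<^esub>" using line_perp[OF l(1) ul[OF x(1) m] yi] .
        then have "h (e i x) (e m y) = \<one>\<^bsub>F\<^esub>"
          using commuting_h[OF U W c x(1) y(1) m x(2)] x y sub m h_refl e_closed by metis
        then show ?thesis using pl e_closed m y by auto
      qed
      then show "v \<otimes> inv w \<in> M (sg l)" using y(2) unfolding M_def y_def[symmetric] by simp
    qed
  qed
  ultimately have "card U * card W \<le> (k * card Z) * (k * (k ^ r * card Z))"
    using line_card[OF l(1)] card_M[OF sg_closed[OF l(1)]] cardF by (auto intro: mult_mono)
  then show ?thesis by (simp add: power_add power2_eq_square mult_ac)
qed

lemma large_commuting_line:
  assumes U: "subgroup U G" and W: "subgroup W G" and c: "commuting U W"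
    and ge: "card U * card W \<ge> k ^ (2 * r) * (card Z)\<^sup>2"
    and l: "l \<in> L" "U \<subseteq> M l" "\<not> U \<subseteq> Z"
  shows "U = M l \<and> W = M (sg l)"
proof -
  \<comment> \<open>Here r + 2 < 2r is used, a second place that depends on r being at least
    3.\<close>
  have "k ^ (r + 2) * (card Z)\<^sup>2 < k ^ (2 * r) * (card Z)\<^sup>2"
    using r3 k2 Z_pos power_strict_increasing[of "r + 2" "2 * r" k] by (simp del: power_add)
  then have W': "W \<subseteq> M (sg l)" using line_commuting_bound[OF U W c l] ge by linarith
  have fM: "finite (M l)" "finite (M (sg l))" using M_sub fin finite_subset by metis+
  have le: "card U \<le> k ^ r * card Z" "card W \<le> k ^ r * card Z"
    using card_mono[OF fM(1) l(2)] card_mono[OF fM(2) W'] card_M l sg_closed by auto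
  have pos: "k ^ r * card Z > 0" using Z_pos k2 by simp
  have ge': "card U * card W \<ge> (k ^ r * card Z) * (k ^ r * card Z)"
    using ge unfolding mult_2 power_add power2_eq_square by (simp only: mult_ac)
  have "card U = k ^ r * card Z \<and> card W = k ^ r * card Z"
    using mult_eq_maximal_nat[OF le ge' pos pos] .
  then show ?thesis
    using card_subset_eq[OF fM(1) l(2)] card_subset_eq[OF fM(2) W'] card_M l sg_closed by auto
qed

lemma large_commuting_Z:
  assumes U: "subgroup U G" and W: "subgroup W G"
    and ge: "card U * card W \<ge> k ^ (2 * r) * (card Z)\<^sup>2" and "U \<subseteq> Z"
  shows "U = Z \<and> W = carrier G"
proof -
  have W': "W \<subseteq> carrier G" using W subgroup.subset by auto
  have fZ: "finite Z" using Z_sub fin finite_subset by metis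
  have le: "card U \<le> card Z" "card W \<le> k ^ (2 * r) * card Z"
    using card_mono[OF fZ assms(4)] card_mono[OF fin W'] card_G by auto
  have pos: "k ^ (2 * r) * card Z > 0" using Z_pos k2 by simp
  have ge': "card U * card W \<ge> card Z * (k ^ (2 * r) * card Z)"
    using ge by (simp add: power2_eq_square mult_ac)
  have "card U = card Z \<and> card W = k ^ (2 * r) * card Z"
    using mult_eq_maximal_nat[OF le ge' Z_pos pos] .
  then show ?thesis
    using card_subset_eq[OF fZ assms(4)] card_subset_eq[OF fin W'] card_G by auto
qed

text \<open>The last two alternatives exchange the roles of \<open>U\<close> and \<open>W\<close>.
  Both are listed because the locale assumes of \<open>sg\<close> only that it is injective on
  \<open>L\<close>, not that it is an involution.\<close>

theorem large_commuting:
  assumes U: "subgroup U G" and W: "subgroup W G" and c: "commuting U W"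
    and ge: "card U * card W \<ge> k ^ (2 * r) * (card Z)\<^sup>2"
  shows "U = Z \<and> W = carrier G \<or> U = carrier G \<and> W = Z \<or> (\<exists>l\<in>L. U = M l \<and> W = M (sg l)) \<or> (\<exists>l\<in>L. W = M l \<and> U = M (sg l))"
proof -
  have c': "commuting W U" using c commuting_sym by auto
  have ge': "card W * card U \<ge> k ^ (2 * r) * (card Z)\<^sup>2" using ge by (simp add: mult.commute)
  consider "U \<subseteq> Z" | "W \<subseteq> Z" | l where "l \<in> L" "U \<subseteq> M l" "\<not> U \<subseteq> Z" | l where "l \<in> L" "W \<subseteq> M l" "\<not> W \<subseteq> Z"
    | "\<not> U \<subseteq> Z" "\<not> W \<subseteq> Z" "\<And>l. l \<in> L \<Longrightarrow> \<not> U \<subseteq> M l" "\<And>l. l \<in> L \<Longrightarrow> \<not> W \<subseteq> M l" by blast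
  then show ?thesis
  proof cases
    case 1 then show ?thesis using large_commuting_Z[OF U W ge] by blast
  next
    case 2 then show ?thesis using large_commuting_Z[OF W U ge'] by blast
  next
    case 3 then show ?thesis using large_commuting_line[OF U W c ge] by blast
  next
    case 4 then show ?thesis using large_commuting_line[OF W U c' ge'] by blast
  next
    case 5
    have "card W < k ^ 3 * card Z" "card U < k ^ 3 * card Z"
      using not_in_line_bound[OF U W c] not_in_line_bound[OF W U c'] 5 by blast+
    then have "card U * card W < (k ^ 3 * card Z) * (k ^ 3 * card Z)"
      using k2 Z_pos by (intro mult_strict_mono) auto
    also have "\<dots> = k ^ 6 * (card Z)\<^sup>2" by (simp add: power2_eq_square mult_ac flip: power_add)
    also have "\<dots> \<le> k ^ (2 * r) * (card Z)\<^sup>2" using k2 r3 by (intro mult_right_mono power_increasing) auto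
    finally show ?thesis using ge by linarith
  qed
qed

end

section \<open>The Chermak-Delgado lattice\<close>

context spread_group begin

lemma Z_commutes: "z \<in> Z \<Longrightarrow> g \<in> carrier G \<Longrightarrow> z \<otimes> g = g \<otimes> z"
  using comm_iff[of z g] Z_sub e_closed h_one_left h_one_right by (auto simp: Z_def)

lemma lines_nonempty: "\<exists>l. l \<in> L" using cardL by (metis card.empty equals0I add_is_0 one_neq_zero)

lemma finL: "finite L" using cardL card.infinite by fastforce

lemma Z_le_M: "l \<in> L \<Longrightarrow> Z \<subseteq> M l"
  by (auto simp: Z_def M_def line_one)

lemma card_strict: "card Z < k ^ r * card Z" "k ^ r * card Z < k ^ (2 * r) * card Z"
proof -
  have "1 < k ^ r" "k ^ r < k ^ (2 * r)" using k2 r3 power_strict_increasing[of r "2 * r" k] one_less_power[of k r] by auto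
  then show "card Z < k ^ r * card Z" "k ^ r * card Z < k ^ (2 * r) * card Z" using Z_pos by auto
qed

lemma Z_M_G: "l \<in> L \<Longrightarrow> Z \<subset> M l \<and> M l \<subset> carrier G"
  using Z_le_M[of l] M_sub[of l] card_M[of l] card_G card_strict by auto

lemma line_nontrivial: assumes "l \<in> L" obtains s where "s \<in> line l" "s \<noteq> \<one>\<^bsub>E\<^esub>"
proof -
  have "\<not> line l \<subseteq> {\<one>\<^bsub>E\<^esub>}"
    using line_card[OF assms] k2 card_mono[of "{\<one>\<^bsub>E\<^esub>}" "line l"] by auto
  then show thesis using that by auto
qed

lemma M_subset_imp_eq: assumes lm: "l \<in> L" "m \<in> L" "M l \<subseteq> M m" shows "l = m"
proof (rule ccontr)
  assume n: "l \<noteq> m"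
  obtain s where s: "s \<in> line l" "s \<noteq> \<one>\<^bsub>E\<^esub>" using line_nontrivial lm by blast
  obtain g where g: "g \<in> carrier G" "\<forall>i<r. e i g = s"
    using e_surj[of "\<lambda>_. s"] line_sub lm s by auto
  then have "g \<in> M m" using s lm by (auto simp: M_def)
  then have "e 0 g \<in> line m" using r3 by (auto simp: M_def)
  then have "s \<in> line m" using g(2) r3 by simp
  then show False using line_inter[OF lm(1,2) n] s by auto
qed

lemma M_commuting: "l \<in> L \<Longrightarrow> commuting (M l) (M (sg l))"
  unfolding commuting_def
proof (intro ballI)
  fix x y assume l: "l \<in> L" and x: "x \<in> M l" and y: "y \<in> M (sg l)"
  have "h (e i x) (e j y) = \<one>\<^bsub>F\<^esub>" "h (e i y) (e j x) = \<one>\<^bsub>F\<^esub>" if "i < r" "j < r" for i j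
  proof -
    show "h (e i x) (e j y) = \<one>\<^bsub>F\<^esub>" using line_perp[OF l] x y that by (auto simp: M_def)
    have "h (e j x) (e i y) = \<one>\<^bsub>F\<^esub>" using line_perp[OF l] x y that by (auto simp: M_def)
    then show "h (e i y) (e j x) = \<one>\<^bsub>F\<^esub>" using h_refl e_closed x y that M_sub by blast
  qed
  moreover have "x \<in> carrier G" "y \<in> carrier G" using x y M_sub by auto
  ultimately show "x \<otimes> y = y \<otimes> x" using comm_iff[of x y] by simp
qed

lemma centralizer_subgroup: "H \<subseteq> carrier G \<Longrightarrow> subgroup (centralizer G H) G"
proof (rule subgroupI)
  assume H: "H \<subseteq> carrier G"
  show "centralizer G H \<subseteq> carrier G" by (auto simp: centralizer_def)
  show "centralizer G H \<noteq> {}" using H by (auto simp: centralizer_def intro!: exI[of _ \<one>])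
  fix a assume a: "a \<in> centralizer G H"
  show "inv a \<in> centralizer G H"
  proof -
    have "inv a \<otimes> x = x \<otimes> inv a" if x: "x \<in> H" for x
    proof -
      have c: "a \<in> carrier G" "x \<in> carrier G" "a \<otimes> x = x \<otimes> a" using a x H by (auto simp: centralizer_def)
      have "inv a \<otimes> x = inv a \<otimes> (x \<otimes> a) \<otimes> inv a" using c(1,2) by (simp add: m_assoc)
      also have "\<dots> = inv a \<otimes> a \<otimes> x \<otimes> inv a" unfolding c(3)[symmetric] using c(1,2) by (simp only: m_assoc m_closed inv_closed)
      finally show ?thesis using c(1,2) by simp
    qed
    then show ?thesis using a by (auto simp: centralizer_def)
  qed
  fix b assume b: "b \<in> centralizer G H"
  have "(a \<otimes> b) \<otimes> x = x \<otimes> (a \<otimes> b)" if x: "x \<in> H" for x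
  proof -
    have c: "a \<in> carrier G" "b \<in> carrier G" "x \<in> carrier G" "a \<otimes> x = x \<otimes> a" "b \<otimes> x = x \<otimes> b"
      using a b x H by (auto simp: centralizer_def)
    have "(a \<otimes> b) \<otimes> x = a \<otimes> (b \<otimes> x)" using c(1-3) by (rule m_assoc)
    also have "\<dots> = (a \<otimes> x) \<otimes> b" unfolding c(5) using c(1-3) by (simp add: m_assoc)
    also have "\<dots> = x \<otimes> (a \<otimes> b)" unfolding c(4) using c(1-3) by (simp add: m_assoc)
    finally show ?thesis .
  qed
  then show "a \<otimes> b \<in> centralizer G H" using a b by (auto simp: centralizer_def)
qed

lemma commuting_centralizer: "commuting H (centralizer G H)"
  by (simp add: commuting_def centralizer_def)

lemma commuting_subset_centralizer: "commuting H W \<Longrightarrow> W \<subseteq> carrier G \<Longrightarrow> W \<subseteq> centralizer G H"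
  unfolding commuting_def centralizer_def by (intro subsetI CollectI conjI ballI) (auto dest: sym)

definition max_measure where "max_measure = k ^ (2 * r) * (card Z)\<^sup>2"

text \<open>A subgroup commutes with its centralizer, so \<open>large_commuting\<close> applies to
  this pair. Assuming only a lower bound lets the same lemma serve for the value of the maximum and
  for the list of subgroups attaining it.\<close>

lemma measure_cases:
  assumes H: "subgroup H G" and ge: "cd_measure G H \<ge> max_measure"
  shows "cd_measure G H = max_measure \<and> (H \<in> {Z, carrier G} \<union> M ` L)"
proof -
  note HC = centralizer_subgroup[OF subgroup.subset[OF H]]
  have ge': "card H * card (centralizer G H) \<ge> k ^ (2 * r) * (card Z)\<^sup>2"
    using ge by (simp add: cd_measure_def max_measure_def)
  have sq: "(k ^ r * card Z) * (k ^ r * card Z) = max_measure"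
    unfolding max_measure_def mult_2 power_add power2_eq_square by (simp only: mult_ac)
  consider "H = Z" "centralizer G H = carrier G" | "H = carrier G" "centralizer G H = Z" |
    l where "l \<in> L" "H = M l" "centralizer G H = M (sg l)" | l where "l \<in> L" "H = M (sg l)" "centralizer G H = M l"
    using large_commuting[OF H HC commuting_centralizer ge'] by blast
  then show ?thesis
  proof cases
    case 1 then show ?thesis by (simp add: cd_measure_def max_measure_def card_G power2_eq_square)
  next
    case 2 then show ?thesis by (simp add: cd_measure_def max_measure_def card_G power2_eq_square)
  next
    case 3
    have "cd_measure G H = (k ^ r * card Z) * (k ^ r * card Z)"
      unfolding cd_measure_def 3(2) card_M[OF 3(1)] 3(3)[unfolded 3(2)] card_M[OF sg_closed[OF 3(1)]] ..
    then show ?thesis using 3 sq by auto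
  next
    case 4
    have "cd_measure G H = (k ^ r * card Z) * (k ^ r * card Z)"
      unfolding cd_measure_def 4(2) card_M[OF sg_closed[OF 4(1)]] 4(3)[unfolded 4(2)] card_M[OF 4(1)] ..
    then show ?thesis using 4 sq sg_closed by auto
  qed
qed

text \<open>Since \<open>Z\<close> is central, the whole group and its centre form a commuting pair
  that reaches the bound. The group itself is neither \<open>Z\<close> nor any \<open>M l\<close>,
  so in the classification its partner can only be \<open>Z\<close>.\<close>

lemma center_eq: "group_center G = Z"
proof -
  have sub: "Z \<subseteq> group_center G" using Z_commutes Z_sub by (auto simp: group_center_def centralizer_def)
  have "max_measure \<le> card (carrier G) * card (group_center G)"
    using card_mono[OF _ sub] fin finite_subset[of "group_center G" "carrier G"]
    by (auto simp: max_measure_def card_G power2_eq_square group_center_def centralizer_def)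
  then have "k ^ (2 * r) * (card Z)\<^sup>2 \<le> card (carrier G) * card (group_center G)" by (simp add: max_measure_def)
  from large_commuting[OF subgroup_self centralizer_subgroup[OF subset_refl, folded group_center_def] _ this]
  show ?thesis using commuting_centralizer[of "carrier G"] Z_M_G lines_nonempty sg_closed
    unfolding group_center_def[symmetric] by blast
qed

text \<open>A commuting partner of the right order bounds the centralizer from below; the upper
  bound comes from \<open>measure_cases\<close>. Thus no centralizer has to be computed
  directly.\<close>

lemma measure_ge:
  assumes "commuting H W" "W \<subseteq> carrier G" "card H * card W = max_measure"
  shows "cd_measure G H \<ge> max_measure"
proof -
  have "finite (centralizer G H)" using fin by (simp add: centralizer_def)
  then have "card W \<le> card (centralizer G H)" using commuting_subset_centralizer[OF assms(1,2)] card_mono by blast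
  then show ?thesis using assms(3) unfolding cd_measure_def by (metis mult_le_mono2)
qed

lemma measure_members: "H \<in> {Z, carrier G} \<union> M ` L \<Longrightarrow> cd_measure G H = max_measure \<and> subgroup H G"
proof -
  assume H: "H \<in> {Z, carrier G} \<union> M ` L"
  then have sg: "subgroup H G" using Z_subgroup subgroup_self M_subgroup by auto
  have sq: "(k ^ r * card Z) * (k ^ r * card Z) = max_measure"
    unfolding max_measure_def mult_2 power_add power2_eq_square by (simp only: mult_ac)
  have ZG: "commuting Z (carrier G)" unfolding commuting_def using Z_commutes by blast
  consider "H = Z" | "H = carrier G" | l where "l \<in> L" "H = M l" using H by auto
  then have "cd_measure G H \<ge> max_measure"
  proof cases
    case 1 show ?thesis unfolding 1
      by (rule measure_ge[OF ZG]) (simp_all add: max_measure_def card_G power2_eq_square)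
  next
    case 2 show ?thesis unfolding 2
      by (rule measure_ge[OF commuting_sym[OF ZG] Z_sub]) (simp add: max_measure_def card_G power2_eq_square)
  next
    case 3 show ?thesis unfolding 3
      by (rule measure_ge[OF M_commuting[OF 3(1)] M_sub]) (simp only: card_M[OF 3(1)] card_M[OF sg_closed[OF 3(1)]] sq)
  qed
  then show ?thesis using measure_cases[OF sg] sg by auto
qed

lemma cd_max_eq: "cd_max G = max_measure"
  unfolding cd_max_def
proof (rule Max_eqI)
  have "{cd_measure G H |H. subgroup H G} \<subseteq> cd_measure G ` Pow (carrier G)"
    using subgroup.subset by blast
  then show "finite {cd_measure G H |H. subgroup H G}" using fin finite_subset by blast
  show "y \<le> max_measure" if y: "y \<in> {cd_measure G H |H. subgroup H G}" for y
  proof -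
    obtain H where H: "y = cd_measure G H" "subgroup H G" using y by auto
    show ?thesis using measure_cases[OF H(2)] H(1) by (cases "max_measure \<le> y") auto
  qed
  show "max_measure \<in> {cd_measure G H |H. subgroup H G}"
    using measure_members[of Z] by (intro CollectI exI[of _ Z]) simp
qed

lemma CD_eq: "CD G = \<lparr>carrier = {Z, carrier G} \<union> M ` L, eq = (=), le = (\<subseteq>)\<rparr>"
proof -
  have "{H. subgroup H G \<and> cd_measure G H = cd_max G} = {Z, carrier G} \<union> M ` L"
    unfolding cd_max_eq
  proof (intro equalityI subsetI)
    fix H assume "H \<in> {H. subgroup H G \<and> cd_measure G H = max_measure}"
    then show "H \<in> {Z, carrier G} \<union> M ` L" using measure_cases[of H] by simp
  next
    fix H assume "H \<in> {Z, carrier G} \<union> M ` L"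
    then show "H \<in> {H. subgroup H G \<and> cd_measure G H = max_measure}" using measure_members[of H] by simp
  qed
  then show ?thesis by (simp add: CD_def)
qed

lemma M_inj: "inj_on M L" using M_subset_imp_eq by (intro inj_onI) auto

lemma quasi_antichain_CD: "quasi_antichain (k + 1) (CD G)" and atoms_CD: "atoms (CD G) = M ` L"
proof -
  have c: "card (M ` L) = k + 1" using card_image[OF M_inj] cardL by simp
  have a: "m = m'" if "m \<in> M ` L" "m' \<in> M ` L" "m \<subseteq> m'" for m m' using that M_subset_imp_eq by auto
  have b: "Z \<subset> m \<and> m \<subset> carrier G" if "m \<in> M ` L" for m using that Z_M_G by auto
  show "quasi_antichain (k + 1) (CD G)" unfolding CD_eq
    by (rule quasi_antichain_subsets(1)) (use finL c k2 b a in auto)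
  show "atoms (CD G) = M ` L" unfolding CD_eq
    by (rule quasi_antichain_subsets(2)[OF _ c]) (use finL k2 b a in auto)
qed

lemma M_abelian_iff: assumes l: "l \<in> L" shows "comm_group (G\<lparr>carrier := M l\<rparr>) \<longleftrightarrow> sg l = l"
proof
  assume "comm_group (G\<lparr>carrier := M l\<rparr>)"
  then have "x \<otimes> y = y \<otimes> x" if "x \<in> M l" "y \<in> M l" for x y
    using comm_monoid.m_comm[of "G\<lparr>carrier := M l\<rparr>" x y] that by (simp add: comm_group_def)
  then have c: "commuting (M l) (M l)" unfolding commuting_def by blast
  obtain s where s: "s \<in> line l" "s \<noteq> \<one>\<^bsub>E\<^esub>" using line_nontrivial l by blast
  \<comment> \<open>The same vector is put into two different coordinates: with both copies in one
    coordinate the condition would read \<open>h s s = h s s\<close>, whereas here it forces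
    \<open>h s s\<close> to be trivial.\<close>
  obtain g where g: "g \<in> carrier G" "\<forall>i<r. e i g = (if i = 0 then s else \<one>\<^bsub>E\<^esub>)"
    using e_surj[of "\<lambda>i. if i = 0 then s else \<one>\<^bsub>E\<^esub>"] line_sub l s by auto
  obtain g' where g': "g' \<in> carrier G" "\<forall>i<r. e i g' = (if i = 1 then s else \<one>\<^bsub>E\<^esub>)"
    using e_surj[of "\<lambda>i. if i = 1 then s else \<one>\<^bsub>E\<^esub>"] line_sub l s by auto
  have sc: "s \<in> carrier E" using line_sub l s by auto
  have gM: "g \<in> M l" "g' \<in> M l" using g g' s l line_one by (auto simp: M_def)
  have "h (e 0 g) (e 1 g') = h (e 0 g') (e 1 g)"
    using commuting_h[OF M_subgroup[OF l] M_subgroup[OF l] c gM] r3 by auto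
  then have "h s s = \<one>\<^bsub>F\<^esub>" using g g' r3 sc h_one_left[OF E.one_closed] by simp
  then have "s \<in> line (sg l)" using perp[OF l s sc] by simp
  then show "sg l = l" using line_inter[OF sg_closed[OF l] l] s by auto
next
  assume a: "sg l = l"
  have "commuting (M l) (M l)" using M_commuting[OF l] by (simp add: a)
  then show "comm_group (G\<lparr>carrier := M l\<rparr>)"
    using subgroup.subgroup_is_group[OF M_subgroup[OF l] is_group]
    by (intro group.group_comm_groupI) (simp_all add: commuting_def)
qed

lemma card_abelian_atoms: "card (abelian_atoms G) = card {l\<in>L. sg l = l}"
proof -
  have "abelian_atoms G = M ` {l\<in>L. sg l = l}"
    unfolding abelian_atoms_def atoms_CD using M_abelian_iff by auto
  then show ?thesis using card_image[OF inj_on_subset[OF M_inj], of "{l\<in>L. sg l = l}"] by auto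
qed

end

section \<open>The quotient by the center\<close>

text \<open>Exponent p is asked of \<open>E\<close> and of \<open>Z\<close> separately: the quotient
  by \<open>Z\<close> embeds in a power of \<open>E\<close>, and commutators lie in \<open>Z\<close>
  because \<open>E\<close> is commutative. The group itself may have elements of larger order; for p
  = 2 the one built below has elements of order 4.\<close>

locale p_spread_group = spread_group +
  fixes p n a :: nat
  assumes prime_p: "prime p" and k_eq: "k = p ^ a" and n_eq: "n = a * r"
    and expE: "\<And>x. x \<in> carrier E \<Longrightarrow> x [^]\<^bsub>E\<^esub> p = \<one>\<^bsub>E\<^esub>"
    and expZ: "\<And>z. z \<in> Z \<Longrightarrow> z [^] p = \<one>"
    and order_power: "\<exists>m. order G = p ^ m"
begin

abbreviation Q where "Q \<equiv> G Mod Z"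
abbreviation pr where "pr g \<equiv> Z #> g"

lemma k_powers: "k ^ r = p ^ n" "k ^ (2 * r) = p ^ (2 * n)"
  by (simp_all add: k_eq n_eq mult.assoc mult.left_commute flip: power_mult)

lemma finite_p_group_G: "finite_p_group p G"
  using fin order_power is_group by (simp add: finite_p_group_def)

lemma Z_normal: "Z \<lhd> G"
  unfolding normal_inv_iff
proof (intro conjI Z_subgroup ballI)
  fix x z assume x: "x \<in> carrier G" and z: "z \<in> Z"
  have zc: "z \<in> carrier G" using z Z_sub by auto
  have "x \<otimes> z \<otimes> inv x = z \<otimes> x \<otimes> inv x" using Z_commutes[OF z x] by simp
  also have "\<dots> = z" using x zc by (simp add: m_assoc)
  finally show "x \<otimes> z \<otimes> inv x \<in> Z" using z by simp
qed

lemma pr_hom: "group_hom G Q (\<lambda>g. pr g)"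
  using normal.r_coset_hom_Mod[OF Z_normal] normal.factorgroup_is_group[OF Z_normal] is_group
  by (simp add: group_hom_def group_hom_axioms_def)

lemma carrier_Q: "carrier Q = (\<lambda>g. pr g) ` carrier G"
  by (rule carrier_FactGroup)

text \<open>This identifies cosets with coordinate vectors, so that computations in the quotient
  become computations in \<open>E\<close>.\<close>

lemma pr_eq_iff:
  assumes "x \<in> carrier G" "y \<in> carrier G"
  shows "pr x = pr y \<longleftrightarrow> (\<forall>i<r. e i x = e i y)"
proof
  assume "pr x = pr y"
  then have "x \<in> pr y" using rcos_self[OF assms(1) Z_subgroup] by simp
  then obtain z where z: "z \<in> Z" "x = z \<otimes> y" by (auto simp: r_coset_def)
  show "\<forall>i<r. e i x = e i y"
  proof (intro allI impI)
    fix i assume i: "i < r"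
    have "e i x = e i z \<otimes>\<^bsub>E\<^esub> e i y" using z i assms Z_sub e_mult by auto
    then show "e i x = e i y" using z i e_closed[OF i assms(2)] by (simp add: Z_def)
  qed
next
  assume a: "\<forall>i<r. e i x = e i y"
  then have "x \<otimes> inv y \<in> Z" using assms e_div_eq_one_iff by (simp add: Z_def)
  moreover have "x = (x \<otimes> inv y) \<otimes> y" using assms by (simp add: m_assoc)
  ultimately have "x \<in> pr y" unfolding r_coset_def by blast
  then show "pr x = pr y" using repr_independence[OF _ assms(2) Z_subgroup] by simp
qed

lemma comm_group_Q: "comm_group Q"
proof (rule group.group_comm_groupI[OF normal.factorgroup_is_group[OF Z_normal]])
  fix X Y assume "X \<in> carrier Q" "Y \<in> carrier Q"
  then obtain x y where xy: "x \<in> carrier G" "y \<in> carrier G" "X = pr x" "Y = pr y" using carrier_Q by auto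
  have "pr (x \<otimes> y) = pr (y \<otimes> x)"
    using xy e_closed by (simp add: pr_eq_iff e_mult E.m_comm)
  then show "X \<otimes>\<^bsub>Q\<^esub> Y = Y \<otimes>\<^bsub>Q\<^esub> X" using xy group_hom.hom_mult[OF pr_hom] by simp
qed

lemma pow_Q: "X \<in> carrier Q \<Longrightarrow> X [^]\<^bsub>Q\<^esub> p = \<one>\<^bsub>Q\<^esub>"
proof -
  assume "X \<in> carrier Q"
  then obtain x where x: "x \<in> carrier G" "X = pr x" using carrier_Q by auto
  have "X [^]\<^bsub>Q\<^esub> p = pr (x [^] p)" using group_hom.hom_nat_pow[OF pr_hom x(1)] x(2) by simp
  also have "\<dots> = pr \<one>"
    using x(1) expE e_closed group_hom.hom_nat_pow[OF e_group_hom x(1)] by (simp add: pr_eq_iff e_one)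
  also have "\<dots> = \<one>\<^bsub>Q\<^esub>" using group_hom.hom_one[OF pr_hom] .
  finally show ?thesis .
qed

lemma P1_G: "P1 p G"
proof -
  have "elementary_abelian p Q" using comm_group_Q pow_Q by (simp add: elementary_abelian_def)
  moreover have "elementary_abelian p (G\<lparr>carrier := derived G (carrier G)\<rparr>)"
  proof -
    have ds: "derived_set G (carrier G) \<subseteq> Z"
    proof
      fix c assume "c \<in> derived_set G (carrier G)"
      then obtain x y where xy: "x \<in> carrier G" "y \<in> carrier G" "c = x \<otimes> y \<otimes> inv x \<otimes> inv y" by auto
      have "e i c = \<one>\<^bsub>E\<^esub>" if i: "i < r" for i
      proof -
        have ec: "e i x \<in> carrier E" "e i y \<in> carrier E" using i xy e_closed by auto
        have "e i c = e i x \<otimes>\<^bsub>E\<^esub> e i y \<otimes>\<^bsub>E\<^esub> inv\<^bsub>E\<^esub> e i x \<otimes>\<^bsub>E\<^esub> inv\<^bsub>E\<^esub> e i y"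
          using xy i by (simp add: e_mult e_inv)
        also have "\<dots> = e i y \<otimes>\<^bsub>E\<^esub> (e i x \<otimes>\<^bsub>E\<^esub> inv\<^bsub>E\<^esub> e i x) \<otimes>\<^bsub>E\<^esub> inv\<^bsub>E\<^esub> e i y"
          using ec E.m_comm[OF ec] by (simp add: E.m_assoc)
        also have "\<dots> = \<one>\<^bsub>E\<^esub>" using ec by simp
        finally show ?thesis .
      qed
      then show "c \<in> Z" using xy by (simp add: Z_def)
    qed
    have sub: "derived G (carrier G) \<subseteq> Z"
      unfolding derived_def using generate_subgroup_incl[OF ds Z_subgroup] .
    have sg: "subgroup (derived G (carrier G)) G" using derived_is_subgroup by auto
    have "comm_group (G\<lparr>carrier := derived G (carrier G)\<rparr>)"
    proof (rule group.group_comm_groupI[OF subgroup.subgroup_is_group[OF sg is_group]])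
      fix x y assume "x \<in> carrier (G\<lparr>carrier := derived G (carrier G)\<rparr>)" "y \<in> carrier (G\<lparr>carrier := derived G (carrier G)\<rparr>)"
      then have "x \<in> Z" "y \<in> carrier G" using sub Z_sub by auto
      then show "x \<otimes>\<^bsub>G\<lparr>carrier := derived G (carrier G)\<rparr>\<^esub> y = y \<otimes>\<^bsub>G\<lparr>carrier := derived G (carrier G)\<rparr>\<^esub> x"
        using Z_commutes by simp
    qed
    then show ?thesis unfolding elementary_abelian_def
      using sub expZ by (auto simp: nat_pow_consistent[symmetric])
  qed
  ultimately show ?thesis by (simp add: P1_def center_eq)
qed

definition Mq where "Mq l = (\<lambda>g. pr g) ` M l"

lemma mod_center_M: "l \<in> L \<Longrightarrow> mod_center G (M l) = Q\<lparr>carrier := Mq l\<rparr>"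
  unfolding mod_center_def center_eq FactGroup_def Mq_def RCOSETS_def
  by (auto simp: r_coset_def set_mult_def fun_eq_iff)

lemma Mq_subgroup: "l \<in> L \<Longrightarrow> subgroup (Mq l) Q"
  unfolding Mq_def using group_hom.subgroup_img_is_subgroup[OF pr_hom M_subgroup] .

lemma pr_in_Mq_iff: "l \<in> L \<Longrightarrow> g \<in> carrier G \<Longrightarrow> pr g \<in> Mq l \<longleftrightarrow> g \<in> M l"
proof
  assume l: "l \<in> L" "g \<in> carrier G" "pr g \<in> Mq l"
  then obtain x where x: "x \<in> M l" "pr g = pr x" by (auto simp: Mq_def)
  then have "\<forall>i<r. e i g = e i x" using pr_eq_iff l M_sub by blast
  then show "g \<in> M l" using x l by (auto simp: M_def)
qed (auto simp: Mq_def)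

lemma card_Mq: assumes l: "l \<in> L" shows "card (Mq l) = p ^ n"
proof -
  interpret Ml: group "G\<lparr>carrier := M l\<rparr>" using subgroup.subgroup_is_group[OF M_subgroup[OF l] is_group] .
  have "subgroup Z (G\<lparr>carrier := M l\<rparr>)"
    using subgroup_incl[OF Z_subgroup M_subgroup[OF l] Z_le_M[OF l]] .
  from Ml.lagrange[OF this] have "card (rcosets\<^bsub>G\<lparr>carrier := M l\<rparr>\<^esub> Z) * card Z = card (M l)"
    by (simp add: order_def)
  moreover have "rcosets\<^bsub>G\<lparr>carrier := M l\<rparr>\<^esub> Z = Mq l"
    by (auto simp: RCOSETS_def r_coset_def Mq_def)
  ultimately have "card (Mq l) * card Z = p ^ n * card Z" using card_M[OF l] k_powers by simp
  then show ?thesis using Z_pos by simp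
qed

lemma order_Q: "order Q = p ^ (2 * n)"
proof -
  have "order Q * card Z = p ^ (2 * n) * card Z"
    using lagrange[OF Z_subgroup] card_G k_powers by (simp add: order_def FactGroup_def)
  then show ?thesis using Z_pos by simp
qed

lemma Mq_inter: assumes "l \<in> L" "m \<in> L" "l \<noteq> m" shows "Mq l \<inter> Mq m = {\<one>\<^bsub>Q\<^esub>}"
proof -
  have "X = \<one>\<^bsub>Q\<^esub>" if X: "X \<in> Mq l" "X \<in> Mq m" for X
  proof -
    obtain x where x: "x \<in> M l" "X = pr x" using X by (auto simp: Mq_def)
    have xc: "x \<in> carrier G" using x M_sub by auto
    then have "x \<in> M m" using X x pr_in_Mq_iff assms by auto
    then have "\<forall>i<r. e i x = e i \<one>" using x line_inter[OF assms] by (auto simp: M_def e_one)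
    then have "pr x = pr \<one>" using pr_eq_iff xc by simp
    then show ?thesis using x group_hom.hom_one[OF pr_hom] by simp
  qed
  moreover have "\<one>\<^bsub>Q\<^esub> \<in> Mq l" "\<one>\<^bsub>Q\<^esub> \<in> Mq m"
    using subgroup.one_closed[OF Mq_subgroup] assms by auto
  ultimately show ?thesis by blast
qed

text \<open>Two lines meet trivially, so multiplication is injective on their product; this has k^2
  elements, as many as \<open>E\<close>.\<close>

lemma line_prod: assumes "l \<in> L" "m \<in> L" "l \<noteq> m" "s \<in> carrier E"
  shows "\<exists>u\<in>line l. \<exists>v\<in>line m. s = u \<otimes>\<^bsub>E\<^esub> v"
proof -
  let ?f = "\<lambda>(u, v). u \<otimes>\<^bsub>E\<^esub> v"
  have "inj_on ?f (line l \<times> line m)"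
  proof (rule inj_onI, clarify)
    fix u v u' v' assume uv: "u \<in> line l" "v \<in> line m" "u' \<in> line l" "v' \<in> line m" and eq: "u \<otimes>\<^bsub>E\<^esub> v = u' \<otimes>\<^bsub>E\<^esub> v'"
    have c: "u \<in> carrier E" "v \<in> carrier E" "u' \<in> carrier E" "v' \<in> carrier E" using uv assms line_sub by auto
    have eq': "inv\<^bsub>E\<^esub> u' \<otimes>\<^bsub>E\<^esub> u = v' \<otimes>\<^bsub>E\<^esub> inv\<^bsub>E\<^esub> v"
    proof -
      have "inv\<^bsub>E\<^esub> u' \<otimes>\<^bsub>E\<^esub> u = inv\<^bsub>E\<^esub> u' \<otimes>\<^bsub>E\<^esub> (u \<otimes>\<^bsub>E\<^esub> v) \<otimes>\<^bsub>E\<^esub> inv\<^bsub>E\<^esub> v"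
        using c by (simp add: E.m_assoc)
      also have "\<dots> = inv\<^bsub>E\<^esub> u' \<otimes>\<^bsub>E\<^esub> u' \<otimes>\<^bsub>E\<^esub> v' \<otimes>\<^bsub>E\<^esub> inv\<^bsub>E\<^esub> v"
        unfolding eq using c by (simp only: E.m_assoc E.m_closed E.inv_closed)
      finally show ?thesis using c by simp
    qed
    have ul: "inv\<^bsub>E\<^esub> u' \<otimes>\<^bsub>E\<^esub> u \<in> line l" and vl: "v' \<otimes>\<^bsub>E\<^esub> inv\<^bsub>E\<^esub> v \<in> line m"
      using uv line_subgroup assms by (simp_all add: subgroup.m_closed subgroup.m_inv_closed)
    have "inv\<^bsub>E\<^esub> u' \<otimes>\<^bsub>E\<^esub> u \<in> {\<one>\<^bsub>E\<^esub>}"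
      unfolding line_inter[OF assms(1-3), symmetric] using ul vl unfolding eq'[symmetric] by (rule IntI)
    then have "u' = u" using E.inv_mult_eq_one_imp_eq[OF c(3,1)] by simp
    then show "u = u' \<and> v = v'" using eq c by simp
  qed
  then have "card (?f ` (line l \<times> line m)) = card (carrier E)"
    using assms by (simp add: card_image card_cartesian_product line_card cardE power2_eq_square)
  moreover have "?f ` (line l \<times> line m) \<subseteq> carrier E" using assms line_sub by auto
  ultimately have "?f ` (line l \<times> line m) = carrier E" using card_subset_eq finE by blast
  then have "s \<in> ?f ` (line l \<times> line m)" using assms by simp
  then show ?thesis by auto
qed

lemma Mq_prod: assumes lm: "l \<in> L" "m \<in> L" "l \<noteq> m" shows "Mq l <#>\<^bsub>Q\<^esub> Mq m = carrier Q"
proof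
  show "Mq l <#>\<^bsub>Q\<^esub> Mq m \<subseteq> carrier Q"
    using monoid.set_mult_closed[OF group.is_monoid[OF comm_group.axioms(2)[OF comm_group_Q]]
      subgroup.subset[OF Mq_subgroup[OF lm(1)]] subgroup.subset[OF Mq_subgroup[OF lm(2)]]] .
  show "carrier Q \<subseteq> Mq l <#>\<^bsub>Q\<^esub> Mq m"
  proof
    fix X assume "X \<in> carrier Q"
    then obtain g where g: "g \<in> carrier G" "X = pr g" using carrier_Q by auto
    have "\<forall>i\<in>{..<r}. \<exists>u. u \<in> line l \<and> (\<exists>v\<in>line m. e i g = u \<otimes>\<^bsub>E\<^esub> v)"
      using line_prod[OF lm] e_closed g by blast
    then obtain u where u: "\<forall>i\<in>{..<r}. u i \<in> line l \<and> (\<exists>v\<in>line m. e i g = u i \<otimes>\<^bsub>E\<^esub> v)" by metis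
    then obtain v where v: "\<forall>i\<in>{..<r}. v i \<in> line m \<and> e i g = u i \<otimes>\<^bsub>E\<^esub> v i" by metis
    obtain x where x: "x \<in> carrier G" "\<forall>i<r. e i x = u i" using e_surj[of u] u line_sub lm by auto
    obtain y where y: "y \<in> carrier G" "\<forall>i<r. e i y = v i" using e_surj[of v] v line_sub lm by auto
    have "pr g = pr (x \<otimes> y)" using x y v g by (simp add: pr_eq_iff e_mult)
    then have "X = pr x \<otimes>\<^bsub>Q\<^esub> pr y" using g group_hom.hom_mult[OF pr_hom x(1) y(1)] by simp
    moreover have "pr x \<in> Mq l" "pr y \<in> Mq m" using x y u v by (auto simp: Mq_def M_def)
    ultimately show "X \<in> Mq l <#>\<^bsub>Q\<^esub> Mq m" unfolding set_mult_def by blast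
  qed
qed

lemma Mq_graph:
  assumes "l \<in> L" "m \<in> L" "l' \<in> L" "l \<noteq> m" "l' \<noteq> l" "l' \<noteq> m"
  obtains \<phi> where "\<phi> \<in> iso (Q\<lparr>carrier := Mq l\<rparr>) (Q\<lparr>carrier := Mq m\<rparr>)"
    "(\<lambda>x. x \<otimes>\<^bsub>Q\<^esub> \<phi> x) \<in> hom (Q\<lparr>carrier := Mq l\<rparr>) Q" "(\<lambda>x. x \<otimes>\<^bsub>Q\<^esub> \<phi> x) ` Mq l = Mq l'"
  by (rule comm_group.complement_graph[OF comm_group_Q
        Mq_subgroup[OF assms(1)] Mq_subgroup[OF assms(2)] Mq_subgroup[OF assms(3)]
        Mq_inter[OF assms(1,3) assms(5)[symmetric]] Mq_inter[OF assms(3,2,6)]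
        Mq_prod[OF assms(1,2,4)] Mq_prod[OF assms(1,3) assms(5)[symmetric]] Mq_prod[OF assms(3,2,6)]])
    (rule that)

text \<open>In (P2) the isomorphism between two atoms modulo the centre is the one whose graph is a
  third atom. There are k + 1 lines, hence at least three.\<close>

lemma third_line: assumes "l \<in> L" "m \<in> L" obtains l' where "l' \<in> L" "l' \<noteq> l" "l' \<noteq> m"
proof -
  have "\<not> L \<subseteq> {l, m}" using cardL k2 card_mono[of "{l, m}" L] card_insert_le_m1[of 2 "{m}" l] by auto
  then show thesis using that by auto
qed

lemma P2_G: "P2 G"
  unfolding P2_def atoms_CD center_eq
proof (intro ballI impI)
  fix A B assume "A \<in> M ` L" "B \<in> M ` L" "A \<noteq> B"
  then obtain l m where lm: "l \<in> L" "m \<in> L" "l \<noteq> m" "A = M l" "B = M m" by auto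
  obtain l' where l': "l' \<in> L" "l' \<noteq> l" "l' \<noteq> m" using third_line lm by blast
  obtain \<phi> where "\<phi> \<in> iso (Q\<lparr>carrier := Mq l\<rparr>) (Q\<lparr>carrier := Mq m\<rparr>)"
    using Mq_graph[OF lm(1,2) l'(1) lm(3) l'(2,3)] by blast
  then have "mod_center G A \<cong> mod_center G B" using lm mod_center_M by (auto simp: is_iso_def)
  moreover have "internal_direct_product Q (carrier (mod_center G A)) (carrier (mod_center G B))"
    unfolding internal_direct_product_def
    using lm mod_center_M Mq_prod Mq_inter comm_group.subgroup_imp_normal[OF comm_group_Q Mq_subgroup] by simp
  ultimately show "mod_center G A \<cong> mod_center G B \<and>
     internal_direct_product Q (carrier (mod_center G A)) (carrier (mod_center G B))" ..
qed

section \<open>Generators modulo the centre\<close>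

lemma pr_closed: "g \<in> carrier G \<Longrightarrow> pr g \<in> carrier Q" using carrier_Q by auto

text \<open>The factor \<open>group_center G\<close> makes the subgroup the full preimage of its
  image. The conditions of (P3) on generators thereby turn into statements about generation in the
  commutative group \<open>Q\<close>.\<close>

lemma gen_center_eq:
  assumes x: "x \<in> {1..n} \<rightarrow> carrier G"
  shows "gen_center G n x = {g \<in> carrier G. pr g \<in> generate Q ((\<lambda>i. pr (x i)) ` {1..n})}"
proof -
  have xs: "x ` {1..n} \<subseteq> carrier G" using x by auto
  have gi: "generate Q ((\<lambda>i. pr (x i)) ` {1..n}) = (\<lambda>g. pr g) ` generate G (x ` {1..n})"
    using group_hom.generate_img[OF pr_hom xs] by (simp add: image_image)
  have gc: "generate G (x ` {1..n}) \<subseteq> carrier G" using generate_incl[OF xs] .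
  show ?thesis
  proof (intro equalityI subsetI)
    fix g assume "g \<in> gen_center G n x"
    then obtain u z where uz: "u \<in> generate G (x ` {1..n})" "z \<in> Z" "g = u \<otimes> z"
      by (auto simp: gen_center_def set_mult_def center_eq)
    have c: "u \<in> carrier G" "z \<in> carrier G" using uz gc Z_sub by auto
    have "\<forall>i<r. e i z = \<one>\<^bsub>E\<^esub>" using uz by (simp add: Z_def)
    then have "pr g = pr u"
      unfolding uz(3) using c e_closed by (simp add: pr_eq_iff e_mult)
    then show "g \<in> {g \<in> carrier G. pr g \<in> generate Q ((\<lambda>i. pr (x i)) ` {1..n})}"
      using uz c gi by auto
  next
    fix g assume "g \<in> {g \<in> carrier G. pr g \<in> generate Q ((\<lambda>i. pr (x i)) ` {1..n})}"
    then obtain u where u: "g \<in> carrier G" "u \<in> generate G (x ` {1..n})" "pr g = pr u" using gi by auto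
    have uc: "u \<in> carrier G" using u gc by auto
    have eq: "\<forall>i<r. e i g = e i u" using u uc pr_eq_iff by blast
    have "inv u \<otimes> g \<in> Z" using eq u(1) uc e_closed by (simp add: Z_def e_mult e_inv)
    moreover have "g = u \<otimes> (inv u \<otimes> g)" using u(1) uc by (simp add: m_assoc[symmetric])
    ultimately show "g \<in> gen_center G n x"
      unfolding gen_center_def set_mult_def center_eq using u by blast
  qed
qed

lemma gen_center_eq_M_iff:
  assumes x: "x \<in> {1..n} \<rightarrow> carrier G" and l: "l \<in> L"
  shows "gen_center G n x = M l \<longleftrightarrow> generate Q ((\<lambda>i. pr (x i)) ` {1..n}) = Mq l"
proof -
  interpret Q: comm_group Q by (rule comm_group_Q)
  have gQ: "generate Q ((\<lambda>i. pr (x i)) ` {1..n}) \<subseteq> carrier Q"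
    using x pr_closed by (intro Q.generate_incl) auto
  show ?thesis
  proof
    assume "gen_center G n x = M l"
    then have *: "{g \<in> carrier G. pr g \<in> generate Q ((\<lambda>i. pr (x i)) ` {1..n})} = M l"
      using gen_center_eq[OF x] by simp
    have "generate Q ((\<lambda>i. pr (x i)) ` {1..n}) = (\<lambda>g. pr g) ` {g \<in> carrier G. pr g \<in> generate Q ((\<lambda>i. pr (x i)) ` {1..n})}"
      using gQ carrier_Q by auto
    then show "generate Q ((\<lambda>i. pr (x i)) ` {1..n}) = Mq l" unfolding * Mq_def .
  next
    assume "generate Q ((\<lambda>i. pr (x i)) ` {1..n}) = Mq l"
    then have "gen_center G n x = {g \<in> carrier G. pr g \<in> Mq l}" using gen_center_eq[OF x] by simp
    then show "gen_center G n x = M l" using pr_in_Mq_iff[OF l] M_sub by auto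
  qed
qed

lemma pr_ordered_prod:
  assumes f: "f \<in> {1..n} \<rightarrow> carrier G"
  shows "pr (ordered_prod G n f) = finprod Q (\<lambda>i. pr (f i)) {1..n}"
proof -
  interpret Q: comm_group Q by (rule comm_group_Q)
  have "foldr (\<otimes>) (map f xs) \<one> \<in> carrier G \<and> pr (foldr (\<otimes>) (map f xs) \<one>) = finprod Q (\<lambda>i. pr (f i)) (set xs)"
    if "distinct xs" "set xs \<subseteq> {1..n}" for xs using that
  proof (induction xs)
    case Nil then show ?case using group_hom.hom_one[OF pr_hom] by simp
  next
    case (Cons x xs)
    then have c: "f x \<in> carrier G" using f by auto
    have "finprod Q (\<lambda>i. pr (f i)) (insert x (set xs)) = pr (f x) \<otimes>\<^bsub>Q\<^esub> finprod Q (\<lambda>i. pr (f i)) (set xs)"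
      using Cons.prems pr_closed[OF c] f by (intro Q.finprod_insert) (auto intro!: pr_closed)
    then show ?case using Cons c group_hom.hom_mult[OF pr_hom] by simp
  qed
  from this[of "[1..<Suc n]"] show ?thesis unfolding ordered_prod_def
    by (simp only: distinct_upt set_upt atLeastLessThanSuc_atLeastAtMost subset_refl simp_thms)
qed

lemma elementary_mod_center: assumes "l \<in> L"
  shows "elementary_abelian p (mod_center G (M l))" "order (mod_center G (M l)) = p ^ n"
proof -
  interpret Q: comm_group Q by (rule comm_group_Q)
  have s: "subgroup (Mq l) Q" using Mq_subgroup assms by auto
  have "comm_group (Q\<lparr>carrier := Mq l\<rparr>)"
    using subgroup.subset[OF s] Q.m_comm
    by (intro group.group_comm_groupI[OF subgroup.subgroup_is_group[OF s Q.is_group]]) auto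
  then show "elementary_abelian p (mod_center G (M l))"
    unfolding elementary_abelian_def mod_center_M[OF assms]
    using subgroup.subset[OF s] pow_Q by (auto simp: Q.nat_pow_consistent[symmetric])
  show "order (mod_center G (M l)) = p ^ n"
    using card_Mq assms by (simp add: mod_center_M order_def)
qed

text \<open>The third atom is modulo the centre the graph of an isomorphism \<open>\<phi>\<close>
  from the first to the second. Let \<open>y' i\<close> lift the image of \<open>x i\<close> under
  \<open>\<phi>\<close>: the \<open>y' i\<close> generate the second atom since
  \<open>\<phi>\<close> is onto, and the products \<open>x i \<otimes> y' i\<close> lift the images
  of generators under the graph map. The matrix is the change of basis from \<open>y\<close> to
  \<open>y'\<close>.\<close>

lemma P3_generators:
  assumes L: "l \<in> L" "m \<in> L" "l' \<in> L" "l \<noteq> m" "l' \<noteq> l" "l' \<noteq> m"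
    and x: "x \<in> {1..n} \<rightarrow> carrier G" and y: "y \<in> {1..n} \<rightarrow> carrier G"
    and gx: "M l = gen_center G n x" and gy: "M m = gen_center G n y"
  shows "\<exists>y'\<in>{1..n} \<rightarrow> carrier G.
                M l' = gen_center G n (\<lambda>i. x i \<otimes> y' i) \<and>
                M m = gen_center G n y' \<and>
                (\<exists>c. invertible_matrix (residue_ring (int p)) n c \<and>
                   (\<forall>j\<in>{1..n}. pr (y' j) = pr (ordered_prod G n (\<lambda>i. y i [^] c i j))))"
proof -
  interpret Q: comm_group Q by (rule comm_group_Q)
  obtain \<phi> where \<phi>: "\<phi> \<in> iso (Q\<lparr>carrier := Mq l\<rparr>) (Q\<lparr>carrier := Mq m\<rparr>)"
    "(\<lambda>x. x \<otimes>\<^bsub>Q\<^esub> \<phi> x) \<in> hom (Q\<lparr>carrier := Mq l\<rparr>) Q" "(\<lambda>x. x \<otimes>\<^bsub>Q\<^esub> \<phi> x) ` Mq l = Mq l'"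
    using Mq_graph[OF L] by blast
  have \<phi>': "\<phi> ` Mq l = Mq m" using \<phi>(1) by (auto simp: iso_def bij_betw_def)
  have \<phi>h: "\<phi> \<in> hom (Q\<lparr>carrier := Mq l\<rparr>) Q"
    using \<phi>(1) subgroup.subset[OF Mq_subgroup[OF L(2)]] by (auto simp: iso_def hom_def)
  let ?X = "(\<lambda>i. pr (x i)) ` {1..n}"
  have gX: "generate Q ?X = Mq l" using gen_center_eq_M_iff[OF x L(1)] gx by simp
  have gY: "generate Q ((\<lambda>i. pr (y i)) ` {1..n}) = Mq m" using gen_center_eq_M_iff[OF y L(2)] gy by simp
  have XM: "?X \<subseteq> Mq l" using gX generate.incl[of _ ?X Q] by blast
  have "\<exists>g. g \<in> carrier G \<and> pr g = \<phi> (pr (x i))" if "i \<in> {1..n}" for i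
  proof -
    have "\<phi> (pr (x i)) \<in> Mq m" using XM \<phi>' that by blast
    then show ?thesis using M_sub by (auto simp: Mq_def)
  qed
  then obtain y' where y': "\<And>i. i \<in> {1..n} \<Longrightarrow> y' i \<in> carrier G \<and> pr (y' i) = \<phi> (pr (x i))" by metis
  have y'c: "y' \<in> {1..n} \<rightarrow> carrier G" using y' by auto
  have xy'c: "(\<lambda>i. x i \<otimes> y' i) \<in> {1..n} \<rightarrow> carrier G" using y' x by auto
  have "(\<lambda>i. pr (y' i)) ` {1..n} = \<phi> ` ?X" using y' by force
  then have gY': "generate Q ((\<lambda>i. pr (y' i)) ` {1..n}) = Mq m"
    using Q.generate_hom_image[OF Mq_subgroup[OF L(1)] \<phi>h XM gX] \<phi>' by simp
  have "(\<lambda>i. pr (x i \<otimes> y' i)) ` {1..n} = (\<lambda>x. x \<otimes>\<^bsub>Q\<^esub> \<phi> x) ` ?X"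
    unfolding image_image
  proof (rule image_cong)
    fix i assume i: "i \<in> {1..n}"
    then have "x i \<in> carrier G" using x by blast
    then show "pr (x i \<otimes> y' i) = pr (x i) \<otimes>\<^bsub>Q\<^esub> \<phi> (pr (x i))"
      using group_hom.hom_mult[OF pr_hom, of "x i" "y' i"] y'[OF i] by simp
  qed simp
  then have gXY: "generate Q ((\<lambda>i. pr (x i \<otimes> y' i)) ` {1..n}) = Mq l'"
    using Q.generate_hom_image[OF Mq_subgroup[OF L(1)] \<phi>(2) XM gX] \<phi>(3) by simp
  have 1: "M l' = gen_center G n (\<lambda>i. x i \<otimes> y' i)" using gen_center_eq_M_iff[OF xy'c L(3)] gXY by simp
  have 2: "M m = gen_center G n y'" using gen_center_eq_M_iff[OF y'c L(2)] gY' by simp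
  have pyc: "(\<lambda>i. pr (y i)) \<in> {1..n} \<rightarrow> carrier Q" "(\<lambda>i. pr (y' i)) \<in> {1..n} \<rightarrow> carrier Q"
    using y y'c pr_closed by auto
  have exM: "X [^]\<^bsub>Q\<^esub> p = \<one>\<^bsub>Q\<^esub>" if "X \<in> Mq m" for X
    using that subgroup.subset[OF Mq_subgroup[OF L(2)]] pow_Q by auto
  obtain c where c: "invertible_matrix (residue_ring (int p)) n c"
    "\<And>j. j \<in> {1..n} \<Longrightarrow> pr (y' j) = Q.lin_prod n (\<lambda>i. pr (y i)) (\<lambda>i. c i j)"
    using Q.change_of_basis[OF pyc(1) gY pyc(2) gY' exM card_Mq[OF L(2)] prime_p] by blast
  have "pr (y' j) = pr (ordered_prod G n (\<lambda>i. y i [^] c i j))" if "j \<in> {1..n}" for j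
  proof -
    have f: "(\<lambda>i. y i [^] c i j) \<in> {1..n} \<rightarrow> carrier G" using y by auto
    have "pr (y' j) = finprod Q (\<lambda>i. pr (y i) [^]\<^bsub>Q\<^esub> c i j) {1..n}" using c(2)[OF that] by (simp add: Q.lin_prod_def)
    also have "\<dots> = finprod Q (\<lambda>i. pr (y i [^] c i j)) {1..n}"
    proof (rule Q.finprod_cong')
      show "{1..n} = {1..n}" ..
      show "(\<lambda>i. pr (y i [^] c i j)) \<in> {1..n} \<rightarrow> carrier Q" using f pr_closed by auto
      fix i assume "i \<in> {1..n}"
      then have "y i \<in> carrier G" using y by blast
      then show "pr (y i) [^]\<^bsub>Q\<^esub> c i j = pr (y i [^] c i j)"
        using group_hom.hom_int_pow[OF pr_hom] by simp
    qed
    also have "\<dots> = pr (ordered_prod G n (\<lambda>i. y i [^] c i j))" using pr_ordered_prod[OF f] by simp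
    finally show ?thesis .
  qed
  then show ?thesis using 1 2 c(1) y'c by blast
qed

lemma P3_G: "P3 p n G"
  unfolding P3_def atoms_CD center_eq
proof (intro ballI impI conjI)
  fix A B assume "A \<in> M ` L" "B \<in> M ` L" and AB: "A \<noteq> B"
  then obtain l m where lm: "l \<in> L" "m \<in> L" "A = M l" "B = M m" by auto
  show "elementary_abelian p (mod_center G A)" "order (mod_center G A) = p ^ n"
    "elementary_abelian p (mod_center G B)" "order (mod_center G B) = p ^ n"
    using elementary_mod_center lm by auto
  fix x y C
  assume x: "x \<in> {1..n} \<rightarrow> carrier G" and y: "y \<in> {1..n} \<rightarrow> carrier G"
    and g: "A = gen_center G n x \<and> B = gen_center G n y" and "C \<in> M ` L - {A, B}"
  then obtain l' where l': "l' \<in> L" "C = M l'" "C \<noteq> A" "C \<noteq> B" by auto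
  have ne: "l \<noteq> m" "l' \<noteq> l" "l' \<noteq> m" using lm l' AB by auto
  show "\<exists>y'\<in>{1..n} \<rightarrow> carrier G.
            C = gen_center G n (\<lambda>i. x i \<otimes> y' i) \<and>
            B = gen_center G n y' \<and>
            (\<exists>c. invertible_matrix (residue_ring (int p)) n c \<and>
               (\<forall>j\<in>{1..n}. pr (y' j) = pr (ordered_prod G n (\<lambda>i. y i [^] c i j))))"
    unfolding l'(2) lm(4)
    by (rule P3_generators[OF lm(1,2) l'(1) ne x y]) (use g lm in auto)
qed

end

section \<open>Finite fields\<close>

text \<open>Stated for a type class, so that calculations with integer polynomials use their own
  arithmetic. The translation to a ring with explicit carrier happens once, when the quotient is
  formed in \<open>finite_field_exists\<close>.\<close>

definition is_ideal :: "'a::comm_ring_1 set \<Rightarrow> bool" where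
  "is_ideal I \<longleftrightarrow> 0 \<in> I \<and> (\<forall>x\<in>I. \<forall>y\<in>I. x + y \<in> I) \<and> (\<forall>x\<in>I. \<forall>c. c * x \<in> I)"

lemma is_ideal_zero: "is_ideal I \<Longrightarrow> 0 \<in> I"
  and is_ideal_add: "is_ideal I \<Longrightarrow> x \<in> I \<Longrightarrow> y \<in> I \<Longrightarrow> x + y \<in> I"
  and is_ideal_mult: "is_ideal I \<Longrightarrow> x \<in> I \<Longrightarrow> c * x \<in> I"
  by (auto simp: is_ideal_def)

lemma is_ideal_mult_right: "is_ideal I \<Longrightarrow> x \<in> I \<Longrightarrow> x * c \<in> I"
  using is_ideal_mult[of I x c] by (simp add: mult.commute)

lemma is_ideal_minus: "is_ideal I \<Longrightarrow> x \<in> I \<Longrightarrow> - x \<in> I"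
  using is_ideal_mult[of I x "-1"] by simp

lemma is_ideal_diff: "is_ideal I \<Longrightarrow> x \<in> I \<Longrightarrow> y \<in> I \<Longrightarrow> x - y \<in> I"
  using is_ideal_add[of I x "- y"] is_ideal_minus[of I y] by simp

text \<open>By Zorn's lemma, since the union of a chain of ideals avoiding \<open>e\<close> avoids
  \<open>e\<close>. The result is maximal only among the ideals that avoid \<open>e\<close>, so that
  primality takes a further argument.\<close>

lemma maximal_ideal_avoiding:
  fixes e :: "'a::comm_ring_1"
  assumes I0: "is_ideal I0" "e \<notin> I0"
  obtains P where "is_ideal P" "I0 \<subseteq> P" "e \<notin> P"
    "\<And>J. is_ideal J \<Longrightarrow> P \<subseteq> J \<Longrightarrow> e \<notin> J \<Longrightarrow> J = P"
proof -
  let ?A = "{I. is_ideal I \<and> I0 \<subseteq> I \<and> e \<notin> I}"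
  have "\<exists>M\<in>?A. \<forall>X\<in>?A. M \<subseteq> X \<longrightarrow> X = M"
  proof (rule subset_Zorn_nonempty)
    show "?A \<noteq> {}" using I0 by blast
    fix C assume C: "C \<noteq> {}" "subset.chain ?A C"
    then have CA: "\<And>I. I \<in> C \<Longrightarrow> is_ideal I \<and> I0 \<subseteq> I \<and> e \<notin> I"
      and ch: "\<And>I J. I \<in> C \<Longrightarrow> J \<in> C \<Longrightarrow> I \<subseteq> J \<or> J \<subseteq> I"
      unfolding subset.chain_def by blast+
    obtain I where I: "I \<in> C" using C by auto
    have "is_ideal (\<Union>C)" unfolding is_ideal_def
    proof (intro conjI ballI allI)
      show "0 \<in> \<Union>C" using I CA is_ideal_zero by blast
      fix x assume "x \<in> \<Union>C"
      then obtain J where J: "J \<in> C" "x \<in> J" by auto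
      show "c * x \<in> \<Union>C" for c using J CA is_ideal_mult by blast
      fix y assume "y \<in> \<Union>C"
      then obtain J' where J': "J' \<in> C" "y \<in> J'" by auto
      have "\<exists>K\<in>C. x \<in> K \<and> y \<in> K" using J J' ch[OF J(1) J'(1)] by blast
      then show "x + y \<in> \<Union>C" using CA is_ideal_add by blast
    qed
    moreover have "I0 \<subseteq> \<Union>C" "e \<notin> \<Union>C" using I CA by blast+
    ultimately show "\<Union>C \<in> ?A" by blast
  qed
  then obtain P where P: "P \<in> ?A" "\<forall>X\<in>?A. P \<subseteq> X \<longrightarrow> X = P" by (rule bexE)
  show thesis
  proof (rule that)
    show "is_ideal P" "I0 \<subseteq> P" "e \<notin> P" using P(1) by auto
    fix J assume J: "is_ideal J" "P \<subseteq> J" "e \<notin> J"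
    then have "J \<in> ?A" using P(1) by auto
    then show "J = P" using P(2) J(2) by simp
  qed
qed

text \<open>If neither factor is in \<open>P\<close>, maximality puts \<open>e\<close> into both
  \<open>P + (a)\<close> and \<open>P + (b)\<close>, hence \<open>e * e\<close> into
  \<open>P + (a * b) = P\<close>. The congruence between \<open>e ^ k\<close> and \<open>e\<close>
  brings this back to \<open>e\<close> itself.\<close>

lemma maximal_ideal_avoiding_prime:
  fixes e :: "'a::comm_ring_1"
  assumes P: "is_ideal P" "e \<notin> P" and max: "\<And>J. is_ideal J \<Longrightarrow> P \<subseteq> J \<Longrightarrow> e \<notin> J \<Longrightarrow> J = P"
    and pot: "e ^ k - e \<in> P" "k \<ge> 2"
    and ab: "a * b \<in> P"
  shows "a \<in> P \<or> b \<in> P"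
proof (rule ccontr)
  assume n: "\<not> (a \<in> P \<or> b \<in> P)"
  have ex: "\<exists>x\<in>P. \<exists>c. e = x + c * a" if a: "a \<notin> P" for a
  proof (rule ccontr)
    assume nx: "\<not> (\<exists>x\<in>P. \<exists>c. e = x + c * a)"
    let ?J = "{x + c * a | x c. x \<in> P}"
    have "is_ideal ?J" unfolding is_ideal_def
    proof (intro conjI ballI allI)
      show "0 \<in> ?J" using is_ideal_zero[OF P(1)] by (intro CollectI exI[of _ 0]) auto
      fix u assume "u \<in> ?J"
      then obtain x c where u: "u = x + c * a" "x \<in> P" by auto
      show "d * u \<in> ?J" for d
        using u is_ideal_mult[OF P(1) u(2)] by (intro CollectI exI[of _ "d * x"] exI[of _ "d * c"]) (auto simp: algebra_simps)
      fix v assume "v \<in> ?J"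
      then obtain y d where v: "v = y + d * a" "y \<in> P" by auto
      show "u + v \<in> ?J"
        using u v is_ideal_add[OF P(1) u(2) v(2)] by (intro CollectI exI[of _ "x + y"] exI[of _ "c + d"]) (auto simp: algebra_simps)
    qed
    moreover have "P \<subseteq> ?J" by (intro subsetI CollectI, rule_tac x = x in exI, rule exI[of _ 0]) auto
    moreover have "e \<notin> ?J" using nx by blast
    ultimately have "?J = P" by (rule max)
    moreover have "a \<in> ?J" using is_ideal_zero[OF P(1)] by (intro CollectI exI[of _ 0] exI[of _ 1]) auto
    ultimately show False using a by simp
  qed
  obtain x c where x: "x \<in> P" "e = x + c * a" using ex n by blast
  obtain y d where y: "y \<in> P" "e = y + d * b" using ex n by blast
  have "e * e = (x + c * a) * (y + d * b)" using x(2) y(2) by metis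
  also have "\<dots> = x * (y + d * b) + (c * a) * y + (c * d) * (a * b)" by (simp add: algebra_simps)
  also have "\<dots> \<in> P" by (intro is_ideal_add is_ideal_mult[OF P(1) ab] is_ideal_mult[OF P(1) y(1)] is_ideal_mult_right[OF P(1) x(1)] P(1))
  finally have "e * e \<in> P" .
  moreover have "e ^ k = e ^ (k - 2) * (e * e)"
    using pot(2) by (metis le_add_diff_inverse2 power2_eq_square power_add)
  ultimately have "e ^ k \<in> P" using is_ideal_mult[OF P(1)] by auto
  then have "e ^ k - (e ^ k - e) \<in> P" using is_ideal_diff[OF P(1)] pot(1) by blast
  then show False using P(2) by simp
qed

section \<open>The Frobenius map modulo an ideal containing p\<close>

lemma freshmans_dream_mod:
  fixes x y :: "'a::comm_ring_1"
  assumes "prime p"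
  shows "\<exists>z. (x + y) ^ p = x ^ p + y ^ p + of_nat p * z"
proof -
  have p: "p > 0" using assms prime_gt_0_nat by auto
  let ?f = "\<lambda>i. of_nat (p choose i) * x ^ i * y ^ (p - i)"
  have "(x + y) ^ p = (\<Sum>i\<le>p. ?f i)" by (rule binomial_ring)
  also have "{..p} = insert 0 (insert p {1..<p})" using p by auto
  also have "sum ?f \<dots> = y ^ p + (x ^ p + (\<Sum>i\<in>{1..<p}. ?f i))" using p by simp
  also have "(\<Sum>i\<in>{1..<p}. ?f i) = (\<Sum>i\<in>{1..<p}. of_nat p * (of_nat ((p choose i) div p) * x ^ i * y ^ (p - i)))"
  proof (rule sum.cong)
    fix i assume "i \<in> {1..<p}"
    then have "p dvd p choose i" using assms by (intro dvd_choose_prime) auto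
    then have "(of_nat (p choose i) :: 'a) = of_nat p * of_nat ((p choose i) div p)"
      by (metis dvd_mult_div_cancel of_nat_mult)
    then show "?f i = of_nat p * (of_nat ((p choose i) div p) * x ^ i * y ^ (p - i))" by (simp add: mult.assoc)
  qed simp
  finally show ?thesis by (intro exI[of _ "\<Sum>i\<in>{1..<p}. of_nat ((p choose i) div p) * x ^ i * y ^ (p - i)"])
      (simp add: sum_distrib_left algebra_simps)
qed

text \<open>The ring may have characteristic 0, so additivity holds only modulo \<open>P\<close>.
  The induction carries the error term \<open>w\<close>, whose p-th power stays in
  \<open>P\<close>.\<close>

lemma frobenius_add:
  fixes x y :: "'a::comm_ring_1"
  assumes p: "prime p" and P: "is_ideal P" "of_nat p \<in> P"
  shows "(x + y) ^ (p ^ m) - (x ^ (p ^ m) + y ^ (p ^ m)) \<in> P"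
proof (induction m)
  case 0 then show ?case using is_ideal_zero[OF P(1)] by simp
next
  case (Suc m)
  let ?u = "x ^ (p ^ m)" and ?v = "y ^ (p ^ m)"
  define w where "w = (x + y) ^ (p ^ m) - (?u + ?v)"
  obtain z1 where z1: "(?u + ?v + w) ^ p = (?u + ?v) ^ p + w ^ p + of_nat p * z1"
    using freshmans_dream_mod[OF p] by blast
  obtain z2 where z2: "(?u + ?v) ^ p = ?u ^ p + ?v ^ p + of_nat p * z2"
    using freshmans_dream_mod[OF p] by blast
  have "(x + y) ^ (p ^ Suc m) = (?u + ?v + w) ^ p" by (simp add: w_def power_mult[symmetric] mult.commute)
  then have "(x + y) ^ (p ^ Suc m) - (?u ^ p + ?v ^ p) = w ^ p + of_nat p * (z1 + z2)"
    using z1 z2 by (simp add: algebra_simps)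
  moreover have "w ^ p \<in> P" using Suc is_ideal_mult_right[OF P(1), of w "w ^ (p - 1)"] p
    unfolding w_def[symmetric] by (metis power_minus_mult prime_gt_0_nat mult.commute)
  moreover have "of_nat p * (z1 + z2) \<in> P" using is_ideal_mult_right[OF P(1,2)] .
  ultimately show ?case using is_ideal_add[OF P(1)] by (simp add: power_mult[symmetric] mult.commute)
qed

text \<open>By the Frobenius congruence the polynomials with this property are closed under sums and
  negatives. They include the constants, and they are closed under multiplication by X because
  X^(p^a) is congruent to X.\<close>

lemma int_poly_power_eq_self:
  fixes P :: "int poly set"
  assumes p: "prime p" and P: "is_ideal P" "of_nat p \<in> P" "monom 1 (p ^ a - 1) - 1 \<in> P"
  shows "f ^ (p ^ a) - f \<in> P"
proof -
  let ?k = "p ^ a"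
  have k: "?k > 0" using p prime_gt_0_nat by auto
  have k0: "(0 :: int poly) ^ ?k = 0" using k by (rule zero_power)
  have add: "(x + y) ^ ?k - (x + y) \<in> P" if "x ^ ?k - x \<in> P" "y ^ ?k - y \<in> P" for x y :: "int poly"
  proof -
    have "(x + y) ^ ?k - (x ^ ?k + y ^ ?k) + ((x ^ ?k - x) + (y ^ ?k - y)) \<in> P"
      using frobenius_add[OF p P(1,2)] that is_ideal_add[OF P(1)] by blast
    then show ?thesis by (simp add: algebra_simps)
  qed
  \<comment> \<open>Additivity applied to \<open>x + (- x)\<close> yields the sign without
    separating p = 2 from odd p.\<close>
  have neg: "(- x) ^ ?k - (- x) \<in> P" if "x ^ ?k - x \<in> P" for x :: "int poly"
  proof -
    have "(x + (- x)) ^ ?k - (x ^ ?k + (- x) ^ ?k) + (x ^ ?k - x) \<in> P"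
      using frobenius_add[OF p P(1,2)] that is_ideal_add[OF P(1)] by blast
    then have "- ((x + (- x)) ^ ?k - (x ^ ?k + (- x) ^ ?k) + (x ^ ?k - x)) \<in> P"
      by (rule is_ideal_minus[OF P(1)])
    moreover have z: "(x + (- x)) ^ ?k = 0" using k by simp
    moreover have "- (0 - (u + v) + (u - x)) = v - (- x)" for u v :: "int poly" by simp
    ultimately show ?thesis by metis
  qed
  have nat: "of_nat m ^ ?k - of_nat m \<in> P" for m
  proof (induction m)
    case 0 show ?case using is_ideal_zero[OF P(1)] by (simp only: of_nat_0 k0 diff_self)
  next
    case (Suc m) then show ?case using add[of 1 "of_nat m"] is_ideal_zero[OF P(1)] by simp
  qed
  have const: "[:c:] ^ ?k - [:c:] \<in> P" for c
  proof (cases "c \<ge> 0")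
    case True
    then have "[:c:] = of_nat (nat c)" by (simp add: of_nat_poly)
    then show ?thesis using nat by simp
  next
    case False
    then have "[:c:] = - of_nat (nat (- c))" by (simp add: of_nat_poly)
    then show ?thesis using neg nat by simp
  qed
  show ?thesis
  proof (induction f)
    case 0 show ?case using is_ideal_zero[OF P(1)] by (simp only: of_nat_0 k0 diff_self)
  next
    case (pCons c f)
    have X: "monom 1 1 ^ ?k = monom (1::int) 1 * monom 1 (?k - 1)"
      using k by (simp add: monom_power mult_monom)
    have "(monom 1 1 * f) ^ ?k - monom 1 1 * f =
       monom 1 1 * f ^ ?k * (monom 1 (?k - 1) - 1) + monom 1 1 * (f ^ ?k - f)"
      unfolding power_mult_distrib X by (simp add: algebra_simps)
    also have "\<dots> \<in> P" using P pCons by (intro is_ideal_add is_ideal_mult) auto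
    finally have "(monom 1 1 * f) ^ ?k - monom 1 1 * f \<in> P" .
    moreover have "pCons c f = [:c:] + monom 1 1 * f" by (simp add: monom_altdef)
    ultimately show ?case using add[OF const[of c]] by simp
  qed
qed

text \<open>The coefficient of the identity in the image of \<open>f\<close> in the group ring of the cyclic group of
  order \<open>N\<close>. It detects that the product of all \<open>X ^ (N div l) - 1\<close>, where \<open>l\<close> runs through the prime divisors
  of \<open>N\<close>, is nonzero modulo \<open>p\<close> and \<open>X ^ N - 1\<close>; a prime ideal avoiding this product makes \<open>X\<close> an
  element of order exactly \<open>N\<close> in the residue field.\<close>

definition per_coeff :: "nat \<Rightarrow> int poly \<Rightarrow> int" where
  "per_coeff N f = (\<Sum>i\<le>degree f. if N dvd i then coeff f i else 0)"

lemma per_coeff_eq: "degree f \<le> B \<Longrightarrow> per_coeff N f = (\<Sum>i\<le>B. if N dvd i then coeff f i else 0)"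
  unfolding per_coeff_def
  by (rule sum.mono_neutral_left) (auto simp: coeff_eq_0)

lemma per_coeff_add: "per_coeff N (f + g) = per_coeff N f + per_coeff N g"
proof -
  let ?B = "max (degree f) (degree g)"
  have "degree (f + g) \<le> ?B" by (rule degree_add_le_max)
  then show ?thesis
    by (simp add: per_coeff_eq[of _ ?B] flip: sum.distrib) (intro sum.cong, auto)
qed

lemma per_coeff_minus: "per_coeff N (- f) = - per_coeff N f"
  using per_coeff_add[of N f "- f"] by (simp add: per_coeff_def)

lemma per_coeff_diff: "per_coeff N (f - g) = per_coeff N f - per_coeff N g"
  using per_coeff_add[of N f "- g"] per_coeff_minus by simp

lemma per_coeff_monom: "per_coeff N (monom c m) = (if N dvd m then c else 0)"
proof -
  have "per_coeff N (monom c m) = (\<Sum>i\<le>m. if N dvd i then coeff (monom c m) i else 0)"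
    by (rule per_coeff_eq) (rule degree_monom_le)
  also have "\<dots> = (\<Sum>i\<le>m. if i = m then (if N dvd m then c else 0) else 0)"
    by (intro sum.cong) (auto simp: coeff_monom)
  finally show ?thesis by simp
qed

lemma per_coeff_of_nat_mult: "per_coeff N (of_nat p * f) = int p * per_coeff N f"
proof (induction p)
  case 0 then show ?case by (simp add: per_coeff_def)
next
  case (Suc p)
  have "of_nat (Suc p) * f = f + of_nat p * f" by (simp add: algebra_simps)
  then show ?case using Suc by (simp add: per_coeff_add algebra_simps del: of_nat_poly)
qed

text \<open>X^N is the identity of the cyclic group ring. Consequently \<open>per_coeff\<close>
  vanishes on all multiples of X^N - 1.\<close>

lemma per_coeff_shift: "per_coeff N (monom 1 (m + N) * f) = per_coeff N (monom 1 m * f)"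
proof (induction f arbitrary: m)
  case (pCons c f)
  have eq: "monom 1 m * pCons c f = monom c m + monom 1 (Suc m) * f" for m
  proof -
    have "pCons c f = monom c 0 + monom 1 1 * f" by (simp add: monom_altdef)
    then show ?thesis by (simp add: distrib_left mult_monom mult.assoc[symmetric])
  qed
  show ?case unfolding eq per_coeff_add per_coeff_monom using pCons.IH[of "Suc m"] by simp
qed simp

text \<open>Expanding the product, a subset T of \<open>S\<close> contributes, up to sign, the
  exponent \<open>m\<close> plus the sum of \<open>N div l\<close> over T. If \<open>N\<close>
  divides \<open>m\<close>, only the empty T gives a multiple of \<open>N\<close>, since a nonempty
  sum of reciprocals of distinct primes is not an integer. The second clause is what the induction
  needs: multiplied by \<open>\<Prod>S\<close> the added terms become multiples of \<open>N\<close>,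
  so an exponent divisible by \<open>N\<close> would force
  \<open>N dvd m * \<Prod>S\<close>.\<close>

lemma per_coeff_prod:
  assumes "finite S" "\<And>l. l \<in> S \<Longrightarrow> prime l \<and> l dvd N" "N > 0"
  shows "(N dvd m \<longrightarrow> per_coeff N (monom 1 m * (\<Prod>l\<in>S. monom 1 (N div l) - 1)) = (-1) ^ card S) \<and>
    (\<not> N dvd m * \<Prod>S \<longrightarrow> per_coeff N (monom 1 m * (\<Prod>l\<in>S. monom 1 (N div l) - 1)) = 0)"
  using assms(1,2)
proof (induction S arbitrary: m)
  case empty then show ?case by (simp add: per_coeff_monom)
next
  case (insert l S)
  let ?g = "\<Prod>l\<in>S. monom 1 (N div l) - (1::int poly)"
  have l: "prime l" "l dvd N" using insert by auto
  then have Nl: "N = l * (N div l)" by simp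
  have IH: "N dvd m \<Longrightarrow> per_coeff N (monom 1 m * ?g) = (-1) ^ card S"
    "\<not> N dvd m * \<Prod>S \<Longrightarrow> per_coeff N (monom 1 m * ?g) = 0" for m using insert by auto
  have eq: "monom 1 m * (\<Prod>l\<in>insert l S. monom 1 (N div l) - 1) =
      monom 1 (m + N div l) * ?g - monom 1 m * ?g"
    using insert by (simp add: mult_monom algebra_simps)
  have nl: "\<not> l dvd \<Prod>S"
  proof
    assume "l dvd \<Prod>S"
    then obtain l' where "l' \<in> S" "l dvd l'" using l(1) insert.hyps(1) prime_dvd_prod_iff[of S l "\<lambda>x. x"] by auto
    then show False using insert l primes_dvd_imp_eq by blast
  qed
  have 1: "N dvd (m + N div l) * \<Prod>S \<Longrightarrow> N dvd m * l * \<Prod>S"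
  proof -
    assume "N dvd (m + N div l) * \<Prod>S"
    then have "N dvd l * ((m + N div l) * \<Prod>S)" by (rule dvd_mult)
    also have "\<dots> = m * l * \<Prod>S + N * \<Prod>S" using Nl by (simp add: algebra_simps)
    finally show ?thesis by (simp add: dvd_add_left_iff)
  qed
  have 2: "\<not> N dvd (m + N div l) * \<Prod>S" if "N dvd m"
  proof
    assume "N dvd (m + N div l) * \<Prod>S"
    then have "N dvd (N div l) * \<Prod>S" using that by (simp add: add_mult_distrib dvd_add_right_iff)
    then have "(N div l) * l dvd (N div l) * \<Prod>S" using Nl by (simp add: mult.commute)
    moreover have "N div l > 0" using Nl assms(3) by (metis gr0I mult_0_right less_irrefl)
    ultimately show False using nl by simp
  qed
  show ?case unfolding eq per_coeff_diff
  proof (intro conjI impI)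
    assume "N dvd m"
    then show "per_coeff N (monom 1 (m + N div l) * ?g) - per_coeff N (monom 1 m * ?g) = (- 1) ^ card (insert l S)"
      using IH 2 insert by simp
  next
    assume "\<not> N dvd m * \<Prod>(insert l S)"
    then have "\<not> N dvd m * l * \<Prod>S" using insert by (simp add: mult.assoc)
    then have "\<not> N dvd (m + N div l) * \<Prod>S" "\<not> N dvd m * \<Prod>S"
      using 1 by (auto simp: mult.assoc mult.left_commute[of m])
    then show "per_coeff N (monom 1 (m + N div l) * ?g) - per_coeff N (monom 1 m * ?g) = 0" using IH by simp
  qed
qed

lemma int_poly_prime_ideal_exists:
  assumes p: "prime p" and a: "a > 0" and N: "N = p ^ a - 1" "N > 0"
  obtains P :: "int poly set" where "is_ideal P" "of_nat p \<in> P" "monom 1 N - 1 \<in> P" "1 \<notin> P"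
    "\<And>f g. f * g \<in> P \<Longrightarrow> f \<in> P \<or> g \<in> P"
    "\<And>l. prime l \<Longrightarrow> l dvd N \<Longrightarrow> monom 1 (N div l) - 1 \<notin> P"
    "\<And>f. f ^ (p ^ a) - f \<in> P"
proof -
  define e :: "int poly" where "e = (\<Prod>l\<in>prime_factors N. monom 1 (N div l) - 1)"
  \<comment> \<open>The largest ideal on which \<open>per_coeff\<close> vanishes modulo p. It is the
    ideal generated by p and X^N - 1, because the coefficient of the identity gives a nondegenerate
    pairing on the group ring; this description turns non-membership of \<open>e\<close> into the
    computation of one coefficient.\<close>
  define I0 where "I0 = {f. \<forall>g. int p dvd per_coeff N (g * f)}"
  have I0: "is_ideal I0" unfolding is_ideal_def I0_def
    by (auto simp: per_coeff_def[of N 0] distrib_left per_coeff_add mult.assoc[symmetric])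
  have pI0: "of_nat p \<in> I0" unfolding I0_def
    using per_coeff_of_nat_mult[of N p] by (simp add: mult.commute)
  have XI0: "monom 1 N - 1 \<in> I0"
  proof -
    have "per_coeff N (g * (monom 1 N - 1)) = 0" for g
      using per_coeff_shift[of N 0 g] by (simp add: right_diff_distrib per_coeff_diff mult.commute one_poly_eq_simps)
    then show ?thesis by (simp add: I0_def)
  qed
  have "prime l \<and> l dvd N" if "l \<in> prime_factors N" for l using that by auto
  then have "per_coeff N (monom 1 0 * e) = (-1) ^ card (prime_factors N)"
    unfolding e_def using per_coeff_prod[of "prime_factors N" N 0] N(2) by blast
  then have "per_coeff N (1 * e) = (-1) ^ card (prime_factors N)" by (simp only: monom_eq_1)
  moreover have "\<not> int p dvd (-1) ^ card (prime_factors N)"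
    using prime_gt_1_nat[OF p] by (cases "even (card (prime_factors N))") auto
  ultimately have "\<not> int p dvd per_coeff N (1 * e)" by (simp only: not_False_eq_True)
  then have eI0: "e \<notin> I0" unfolding I0_def by blast
  obtain P where P: "is_ideal P" "I0 \<subseteq> P" "e \<notin> P"
    "\<And>J. is_ideal J \<Longrightarrow> P \<subseteq> J \<Longrightarrow> e \<notin> J \<Longrightarrow> J = P"
    using maximal_ideal_avoiding[OF I0 eI0] by metis
  have pow: "f ^ (p ^ a) - f \<in> P" for f
    using int_poly_power_eq_self[OF p P(1)] pI0 XI0 P(2) N by auto
  have k2: "p ^ a \<ge> 2" using N by linarith
  show thesis
  proof (rule that[OF P(1) _ _ _ _ _ pow])
    show "of_nat p \<in> P" "monom 1 N - 1 \<in> P" using pI0 XI0 P by auto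
    show "1 \<notin> P" using P(3) is_ideal_mult[OF P(1), of 1 e] by auto
    show "f \<in> P \<or> g \<in> P" if "f * g \<in> P" for f g
      using maximal_ideal_avoiding_prime[OF P(1,3,4) pow k2 that] .
    show "monom 1 (N div l) - 1 \<notin> P" if l: "prime l" "l dvd N" for l
    proof
      assume *: "monom 1 (N div l) - 1 \<in> P"
      have "l \<in> prime_factors N" using l N by (auto simp: prime_factors_dvd)
      then have "e = (monom 1 (N div l) - 1) * (\<Prod>l\<in>prime_factors N - {l}. monom 1 (N div l) - 1)"
        unfolding e_def by (simp add: prod.remove)
      then show False using P(3) is_ideal_mult_right[OF P(1) *] by metis
    qed
  qed
qed

section \<open>From the prime ideal to the finite field\<close>

text \<open>Reducing exponents modulo \<open>N\<close> and coefficients modulo p leaves finitely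
  many polynomials. This serves only to show that the residue ring is finite; its order comes from
  the order of X.\<close>

lemma int_poly_mod_reduce:
  fixes P :: "int poly set"
  assumes P: "is_ideal P" "of_nat p \<in> P" "monom 1 N - 1 \<in> P" and N: "N > 0" and p: "p > 0"
  shows "\<exists>u\<in>{..<N} \<rightarrow>\<^sub>E {0..<int p}. f - (\<Sum>i<N. monom (u i) i) \<in> P"
proof -
  obtain M where M: "N = Suc M" using N gr0_conv_Suc by auto
  have "\<exists>u. f - (\<Sum>i<N. monom (u i) i) \<in> P"
  proof (induction f)
    case 0 then show ?case using is_ideal_zero[OF P(1)] by (intro exI[of _ "\<lambda>_. 0"]) simp
  next
    case (pCons c f)
    then obtain u where u: "f - (\<Sum>i<N. monom (u i) i) \<in> P" by blast
    \<comment> \<open>Multiplication by X shifts the coefficients cyclically: as X^N is congruent to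
      1, the top coefficient \<open>u M\<close> joins the new constant term.\<close>
    define v where "v i = (if i = 0 then c + u M else u (i - 1))" for i
    have "(\<Sum>i<N. monom (v i) i) = monom (c + u M) 0 + (\<Sum>i<M. monom (u i) (Suc i))"
      unfolding M sum.lessThan_Suc_shift by (simp add: v_def)
    moreover have "monom 1 1 * (\<Sum>i<N. monom (u i) i) = (\<Sum>i<M. monom (u i) (Suc i)) + monom (u M) N"
      unfolding M by (simp add: sum_distrib_left mult_monom distrib_left)
    moreover have "monom (u M) N = [:u M:] * (monom 1 N - 1) + monom (u M) 0"
      by (simp add: right_diff_distrib smult_monom monom_0)
    moreover have "pCons c f = monom c 0 + monom 1 1 * f" by (simp add: monom_altdef)
    ultimately have "pCons c f - (\<Sum>i<N. monom (v i) i) =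
        monom 1 1 * (f - (\<Sum>i<N. monom (u i) i)) + [:u M:] * (monom 1 N - 1)"
      by (simp add: algebra_simps add_monom[symmetric])
    also have "\<dots> \<in> P" using P u by (intro is_ideal_add is_ideal_mult)
    finally show ?case by blast
  qed
  then obtain u where u: "f - (\<Sum>i<N. monom (u i) i) \<in> P" by blast
  define v where "v = restrict (\<lambda>i. u i mod int p) {..<N}"
  have "monom (u i) i - monom (u i mod int p) i = monom (u i div int p) i * of_nat p" for i
    by (simp add: diff_monom of_nat_poly minus_mod_eq_mult_div smult_monom mult.commute)
  then have m: "monom (u i) i - monom (u i mod int p) i \<in> P" for i using is_ideal_mult[OF P(1,2)] by simp
  have "(\<Sum>i\<in>J. monom (u i) i - monom (u i mod int p) i) \<in> P" if "finite J" for J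
    using that
  proof induction
    case empty then show ?case using is_ideal_zero[OF P(1)] by simp
  next
    case (insert j J)
    show ?case unfolding sum.insert[OF insert.hyps] using is_ideal_add[OF P(1) m[of j] insert.IH] .
  qed
  then have "(\<Sum>i<N. monom (u i) i - monom (u i mod int p) i) \<in> P" by simp
  moreover have "(\<Sum>i<N. monom (v i) i) = (\<Sum>i<N. monom (u i mod int p) i)" by (simp add: v_def)
  ultimately have "(f - (\<Sum>i<N. monom (u i) i)) + ((\<Sum>i<N. monom (u i) i) - (\<Sum>i<N. monom (v i) i)) \<in> P"
    using is_ideal_add[OF P(1) u] by (simp only: sum_subtractf)
  then have "f - (\<Sum>i<N. monom (v i) i) \<in> P" by simp
  moreover have "v \<in> {..<N} \<rightarrow>\<^sub>E {0..<int p}" using p by (auto simp: v_def)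
  ultimately show ?thesis by blast
qed

text \<open>Cancelling one factor from x^k = x shows that x^(k-2) is an inverse of a nonzero
  x.\<close>

lemma (in domain) field_of_power_eq_self:
  assumes "\<And>x. x \<in> carrier R \<Longrightarrow> x [^] (k::nat) = x" "k \<ge> 2"
  shows "field R"
proof (rule cring_fieldI)
  show "Units R = carrier R - {\<zero>}"
  proof
    show "Units R \<subseteq> carrier R - {\<zero>}" using one_not_zero by (auto simp: Units_def)
    show "carrier R - {\<zero>} \<subseteq> Units R"
    proof
      fix x assume "x \<in> carrier R - {\<zero>}"
      then have x: "x \<in> carrier R" "x \<noteq> \<zero>" by auto
      obtain m where m: "k = Suc (Suc m)" using assms(2) by (metis add_2_eq_Suc le_Suc_ex)
      have "x \<otimes> (x [^] m \<otimes> x) = x \<otimes> \<one>"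
        using assms(1)[OF x(1)] x(1) unfolding m by (simp add: m_ac)
      then have e: "x [^] m \<otimes> x = \<one>" using m_lcancel[OF x(2) x(1), of "x [^] m \<otimes> x" \<one>] x(1) by blast
      then show "x \<in> Units R" using x(1) m_comm[of x "x [^] m"] unfolding Units_def
        by (intro CollectI conjI bexI[of _ "x [^] m"]) auto
    qed
  qed
qed

text \<open>An order of \<open>g\<close> properly dividing \<open>N\<close> would divide
  \<open>N div l\<close> for some prime \<open>l\<close>; so the order is \<open>N\<close>, which
  bounds the number of units from below. The bound from above is the number of roots of x^N -
  1.\<close>

lemma (in field) card_eq_of_ord:
  assumes fin: "finite (carrier R)" and N: "N > 0"
    and pow: "\<And>x. x \<in> carrier R \<Longrightarrow> x \<noteq> \<zero> \<Longrightarrow> x [^] N = \<one>"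
    and g: "g \<in> carrier R" "g \<noteq> \<zero>" "\<And>l. prime l \<Longrightarrow> l dvd N \<Longrightarrow> g [^] (N div l) \<noteq> \<one>"
  shows "card (carrier R) = Suc N"
proof -
  interpret M: group "mult_of R" by (rule field_mult_group)
  have gM: "g \<in> carrier (mult_of R)" using g by simp
  have powM: "x [^]\<^bsub>mult_of R\<^esub> (m::nat) = x [^] m" for x m by (simp add: nat_pow_mult_of)
  have d: "M.ord g dvd N" using M.pow_eq_id[OF gM, of N] pow[OF g(1,2)] by (simp add: powM)
  have "M.ord g = N"
  proof (rule ccontr)
    assume n: "M.ord g \<noteq> N"
    obtain t where t: "N = M.ord g * t" using d by auto
    then have "t \<noteq> 1" using n by auto
    then obtain l where l: "prime l" "l dvd t" using prime_factor_nat by blast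
    then obtain s where s: "t = l * s" by auto
    have "N div l = M.ord g * s" using t s l N by (auto simp: mult.left_commute)
    then have "g [^] (N div l) = \<one>" using M.pow_eq_id[OF gM, of "N div l"] by (simp add: powM)
    moreover have "l dvd N" using l t by simp
    ultimately show False using g(3) l by blast
  qed
  moreover have "M.ord g \<le> order (mult_of R)" using M.ord_le_group_order gM fin by auto
  ultimately have ge: "N \<le> card (carrier R) - 1" using order_mult_of[OF fin] by (simp add: order_def)
  have "card (carrier R - {\<zero>}) \<le> card {x \<in> carrier R. x [^] N = \<one>}"
    using fin pow by (intro card_mono) auto
  also have "\<dots> \<le> N" using num_roots_le_deg[OF fin] N by simp
  finally have "card (carrier R) - 1 \<le> N" using fin by simp
  moreover have "card (carrier R) > 0" using fin card_gt_0_iff by blast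
  ultimately show ?thesis using ge by linarith
qed

text \<open>The nonzero fixed elements are the roots of x^(q-1) = 1, of which there are at most q -
  1. As q^2 - 1 = (q + 1)(q - 1), the powers of a generator with exponent (q + 1)j for j < q - 1 are
  that many different roots.\<close>

lemma (in field) card_fixed_points_of_power:
  assumes fin: "finite (carrier R)" and card: "card (carrier R) = q\<^sup>2" and q: "q \<ge> 2"
  shows "card {x \<in> carrier R. x [^] q = x} = q"
proof -
  interpret M: group "mult_of R" by (rule field_mult_group)
  have powM: "x [^]\<^bsub>mult_of R\<^esub> (m::nat) = x [^] m" for x m by (simp add: nat_pow_mult_of)
  obtain g where g: "g \<in> carrier (mult_of R)" "carrier (mult_of R) = {g [^] i | i::nat. i \<in> UNIV}"
    using finite_field_mult_group_has_gen[OF fin] by (auto simp: nat_pow_mult_of)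
  have gR: "g \<in> carrier R" using g by simp
  have fM: "finite (carrier (mult_of R))" using fin by simp
  have ord: "M.ord g = q\<^sup>2 - 1"
  proof -
    have "carrier (mult_of R) \<subseteq> generate (mult_of R) {g}"
    proof
      fix x assume "x \<in> carrier (mult_of R)"
      then obtain i :: nat where "x = g [^] i" using g(2) by blast
      then have "x = g [^]\<^bsub>mult_of R\<^esub> int i" by (simp add: int_pow_int powM)
      then show "x \<in> generate (mult_of R) {g}" unfolding M.generate_pow[OF g(1)] by blast
    qed
    then have "carrier (mult_of R) = generate (mult_of R) {g}"
      using M.generate_incl[of "{g}"] g(1) by blast
    then show ?thesis using M.generate_pow_card[OF g(1)] order_mult_of[OF fin] card by (simp add: order_def)
  qed
  let ?S = "{x \<in> carrier R. x [^] (q - 1) = \<one>}"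
  have qq: "q\<^sup>2 - 1 = (q + 1) * (q - 1)" using q by (simp add: power2_eq_square algebra_simps)
  have "inj_on (\<lambda>j. g [^] ((q + 1) * j)) {..<q - 1}"
  proof (rule inj_onI)
    fix i j assume ij: "i \<in> {..<q - 1}" "j \<in> {..<q - 1}" "g [^] ((q + 1) * i) = g [^] ((q + 1) * j)"
    have lt: "(q + 1) * m \<in> {0..M.ord g - 1}" if "m \<in> {..<q - 1}" for m
    proof -
      have "(q + 1) * m < (q + 1) * (q - 1)" using that by (simp only: mult_less_cancel1) auto
      then show ?thesis using ord qq by auto
    qed
    have "(q + 1) * i = (q + 1) * j"
      using inj_onD[OF M.ord_inj[OF g(1)], of "(q + 1) * i" "(q + 1) * j"] lt[OF ij(1)] lt[OF ij(2)] ij(3)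
      unfolding powM by blast
    then show "i = j" by (metis mult_left_cancel add_is_0 one_neq_zero)
  qed
  moreover have "(\<lambda>j. g [^] ((q + 1) * j)) ` {..<q - 1} \<subseteq> ?S"
  proof (rule image_subsetI)
    fix j
    have "g [^] (q\<^sup>2 - 1) = \<one>" using M.pow_eq_id[OF g(1), of "q\<^sup>2 - 1"] ord by (simp add: powM)
    moreover have "(q + 1) * j * (q - 1) = (q\<^sup>2 - 1) * j" by (simp only: qq mult_ac)
    ultimately have "(g [^] ((q + 1) * j)) [^] (q - 1) = \<one>"
      using nat_pow_pow[OF gR, of "(q + 1) * j" "q - 1"] nat_pow_pow[OF gR, of "q\<^sup>2 - 1" j] by (metis nat_pow_one)
    then show "g [^] ((q + 1) * j) \<in> ?S" using gR by simp
  qed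
  moreover have fS: "finite ?S" using fin by simp
  ultimately have "q - 1 \<le> card ?S" using card_inj_on_le[of "\<lambda>j. g [^] ((q + 1) * j)" "{..<q - 1}" ?S] by simp
  moreover have "card ?S \<le> q - 1" using num_roots_le_deg[OF fin, of "q - 1"] q by simp
  ultimately have cS: "card ?S = q - 1" by simp
  obtain m where m: "q = Suc m" "m > 0" using q by (cases q) auto
  have "{x \<in> carrier R. x [^] q = x} = insert \<zero> ?S"
  proof (intro equalityI subsetI)
    fix x assume "x \<in> {x \<in> carrier R. x [^] q = x}"
    then have x: "x \<in> carrier R" "x [^] m \<otimes> x = \<one> \<otimes> x" using m by auto
    then show "x \<in> insert \<zero> ?S" using m_rcancel[of x "x [^] m" \<one>] m by auto
  next
    fix x assume "x \<in> insert \<zero> ?S"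
    then show "x \<in> {x \<in> carrier R. x [^] q = x}" using m by auto
  qed
  moreover have "\<zero> \<notin> ?S" using m by (simp add: nat_pow_zero)
  ultimately show ?thesis using cS fS q by simp
qed

text \<open>The field is Z[X] modulo the prime ideal, so no irreducible polynomial has to be chosen.
  The congruence of f^(p^a) with f makes this domain a field, and X has order exactly p^a - 1 in it.
  Characteristic p and the additivity of p-power maps are recorded because they are simplest to read
  off from polynomials.\<close>

lemma finite_field_exists:
  fixes p a :: nat
  assumes p: "prime p" and a: "p ^ a \<ge> 2"
  obtains F :: "int poly set ring" where "field F" "finite (carrier F)" "card (carrier F) = p ^ a"
    "\<And>x. x \<in> carrier F \<Longrightarrow> x [^]\<^bsub>F\<^esub> (p ^ a) = x"
    "\<And>x. x \<in> carrier F \<Longrightarrow> [p] \<cdot>\<^bsub>F\<^esub> x = \<zero>\<^bsub>F\<^esub>"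
    "\<And>x y m. x \<in> carrier F \<Longrightarrow> y \<in> carrier F \<Longrightarrow>
       (x \<oplus>\<^bsub>F\<^esub> y) [^]\<^bsub>F\<^esub> (p ^ m) = x [^]\<^bsub>F\<^esub> (p ^ m) \<oplus>\<^bsub>F\<^esub> y [^]\<^bsub>F\<^esub> (p ^ m)"
proof -
  define N where "N = p ^ a - 1"
  have N: "N > 0" and k: "p ^ a = Suc N" using a by (auto simp: N_def)
  have a0: "a > 0" using a by (cases a) auto
  obtain P :: "int poly set" where P: "is_ideal P" "of_nat p \<in> P" "monom 1 N - 1 \<in> P" "1 \<notin> P"
    "\<And>f g. f * g \<in> P \<Longrightarrow> f \<in> P \<or> g \<in> P"
    "\<And>l. prime l \<Longrightarrow> l dvd N \<Longrightarrow> monom 1 (N div l) - 1 \<notin> P"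
    "\<And>f. f ^ (p ^ a) - f \<in> P"
    using int_poly_prime_ideal_exists[OF p a0 N_def N] by metis
  define R :: "int poly ring" where "R = \<lparr>carrier = UNIV, monoid.mult = (*), one = 1, zero = 0, add = (+)\<rparr>"
  interpret R: cring R
  proof (rule cringI)
    show "abelian_group R"
      by (rule abelian_groupI) (auto simp: R_def intro: exI[of _ "- x" for x] add.left_inverse)
    show "comm_monoid R" by (rule comm_monoidI) (auto simp: R_def)
  qed (auto simp: R_def algebra_simps)
  have Rs: "carrier R = UNIV" "monoid.mult R = (*)" "add R = (+)" "one R = 1" "zero R = 0"
    by (auto simp: R_def)
  have Rinv: "\<ominus>\<^bsub>R\<^esub> y = - y" for y using R.minus_equality[of "- y" y] by (simp add: Rs)
  have Rdiff: "x \<ominus>\<^bsub>R\<^esub> y = x - y" for x y by (simp add: a_minus_def Rinv Rs)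
  have Rpow: "x [^]\<^bsub>R\<^esub> m = x ^ m" for x and m :: nat by (induction m) (auto simp: Rs)
  have idl: "ideal P R"
  proof (rule idealI)
    have Rinv': "inv\<^bsub>add_monoid R\<^esub> y = - y" for y using Rinv by (simp only: a_inv_def)
    show "subgroup P (add_monoid R)"
    proof (rule group.subgroupI[OF R.a_group])
      show "P \<noteq> {}" using is_ideal_zero[OF P(1)] by auto
      show "inv\<^bsub>add_monoid R\<^esub> x \<in> P" if "x \<in> P" for x
        unfolding Rinv' using is_ideal_minus[OF P(1) that] .
    qed (use is_ideal_add[OF P(1)] in \<open>auto simp: Rs\<close>)
  qed (use P(1) is_ideal_mult is_ideal_mult_right in \<open>auto simp: Rs R.ring_axioms\<close>)
  then interpret P: primeideal P R
    by (rule primeidealI) (use P in \<open>auto simp: Rs R.cring_axioms\<close>)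
  define F where "F = R Quot P"
  define c where "c f = P +>\<^bsub>R\<^esub> f" for f
  interpret F: domain F unfolding F_def by (rule P.quotient_is_domain)
  have ceq: "c f = c g \<longleftrightarrow> f - g \<in> P" for f g
    using R.quotient_eq_iff_same_a_r_cos[OF idl, of f g] by (simp add: c_def Rdiff Rs)
  have chom: "c \<in> ring_hom R F" using P.rcos_ring_hom unfolding c_def[abs_def] F_def .
  interpret c: ring_hom_ring R F c
    by (rule ring_hom_ringI2) (use chom R.ring_axioms F.ring_axioms in auto)
  have carr: "carrier F = range c" unfolding F_def FactRing_def A_RCOSETS_def' c_def by (auto simp: Rs)
  have cadd: "c (f + g) = c f \<oplus>\<^bsub>F\<^esub> c g" and cmult: "c (f * g) = c f \<otimes>\<^bsub>F\<^esub> c g" and c0: "c 0 = \<zero>\<^bsub>F\<^esub>" and c1: "c 1 = \<one>\<^bsub>F\<^esub>"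
    and cc: "c f \<in> carrier F" for f g
    using c.hom_add[of f g] c.hom_mult[of f g] c.hom_zero c.hom_one c.hom_closed[of f] by (simp_all add: Rs)
  have cpow: "c (f ^ m) = c f [^]\<^bsub>F\<^esub> m" for f m
    by (induction m) (auto simp: c1 cmult mult.commute[of f] F.m_comm cc)
  have pow: "x [^]\<^bsub>F\<^esub> (p ^ a) = x" if x: "x \<in> carrier F" for x
  proof -
    obtain f where f: "x = c f" using x carr by auto
    show ?thesis unfolding f cpow[symmetric] ceq by (rule P(7))
  qed
  interpret F: field F using F.field_of_power_eq_self[OF pow a] .
  have fin: "finite (carrier F)"
  proof -
    let ?D = "{..<N} \<rightarrow>\<^sub>E {0..<int p}"
    have "carrier F \<subseteq> (\<lambda>u. c (\<Sum>i<N. monom (u i) i)) ` ?D"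
    proof
      fix x assume "x \<in> carrier F"
      then obtain f where f: "x = c f" using carr by auto
      obtain u where "u \<in> ?D" "f - (\<Sum>i<N. monom (u i) i) \<in> P"
        using int_poly_mod_reduce[OF P(1-3) N prime_gt_0_nat[OF p]] by blast
      then show "x \<in> (\<lambda>u. c (\<Sum>i<N. monom (u i) i)) ` ?D" using f ceq by auto
    qed
    moreover have "finite ?D" by (intro finite_PiE) auto
    ultimately show ?thesis using finite_subset by blast
  qed
  have powN: "x [^]\<^bsub>F\<^esub> N = \<one>\<^bsub>F\<^esub>" if x: "x \<in> carrier F" "x \<noteq> \<zero>\<^bsub>F\<^esub>" for x
  proof -
    have "x [^]\<^bsub>F\<^esub> N \<otimes>\<^bsub>F\<^esub> x = \<one>\<^bsub>F\<^esub> \<otimes>\<^bsub>F\<^esub> x" using pow[OF x(1)] x(1) unfolding k by simp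
    then show ?thesis using F.m_rcancel[OF x(2,1) F.nat_pow_closed[OF x(1)] F.one_closed] by blast
  qed
  define g where "g = c (monom 1 1)"
  have gp: "g [^]\<^bsub>F\<^esub> m = c (monom 1 m)" for m
    by (simp add: g_def cpow[symmetric] monom_power)
  have gN: "g [^]\<^bsub>F\<^esub> N = \<one>\<^bsub>F\<^esub>" unfolding gp c1[symmetric] ceq by (rule P(3))
  have g0: "g \<noteq> \<zero>\<^bsub>F\<^esub>" using gN N F.nat_pow_zero[of N] by auto
  have card: "card (carrier F) = Suc N"
  proof (rule F.card_eq_of_ord[OF fin N powN])
    show "g \<in> carrier F" by (simp add: g_def cc)
    show "g [^]\<^bsub>F\<^esub> (N div l) \<noteq> \<one>\<^bsub>F\<^esub>" if "prime l" "l dvd N" for l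
      unfolding gp c1[symmetric] ceq using P(6)[OF that] .
  qed (use g0 in auto)
  have addp: "[p] \<cdot>\<^bsub>F\<^esub> x = \<zero>\<^bsub>F\<^esub>" if x: "x \<in> carrier F" for x
  proof -
    obtain f where f: "x = c f" using x carr by auto
    have "[m] \<cdot>\<^bsub>F\<^esub> x = c (of_nat m * f)" for m :: nat
      by (induction m) (auto simp: f c0 cadd algebra_simps F.a_comm cc)
    then have "[p] \<cdot>\<^bsub>F\<^esub> x = c (of_nat p * f)" .
    also have "\<dots> = c 0" unfolding ceq using is_ideal_mult_right[OF P(1,2)] by simp
    finally show ?thesis by (simp add: c0)
  qed
  have frob: "(x \<oplus>\<^bsub>F\<^esub> y) [^]\<^bsub>F\<^esub> (p ^ m) = x [^]\<^bsub>F\<^esub> (p ^ m) \<oplus>\<^bsub>F\<^esub> y [^]\<^bsub>F\<^esub> (p ^ m)"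
    if xy: "x \<in> carrier F" "y \<in> carrier F" for x y m
  proof -
    obtain f g where fg: "x = c f" "y = c g" using xy carr by auto
    have "c ((f + g) ^ (p ^ m)) = c (f ^ (p ^ m) + g ^ (p ^ m))"
      unfolding ceq by (rule frobenius_add[OF p P(1,2)])
    then show ?thesis unfolding fg by (simp only: cpow cadd)
  qed
  show thesis by (rule that[OF F.field_axioms fin _ pow addp frob]) (simp_all add: card k)
qed

section \<open>The central extension\<close>

locale bihom = E: comm_group E + F: comm_group F
  for E :: "'e monoid" and F :: "'f monoid" +
  fixes h :: "'e \<Rightarrow> 'e \<Rightarrow> 'f" and r :: nat
  assumes h_closed: "\<And>s t. s \<in> carrier E \<Longrightarrow> t \<in> carrier E \<Longrightarrow> h s t \<in> carrier F"
    and h_right: "\<And>s t u. s \<in> carrier E \<Longrightarrow> t \<in> carrier E \<Longrightarrow> u \<in> carrier E \<Longrightarrow>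
           h s (t \<otimes>\<^bsub>E\<^esub> u) = h s t \<otimes>\<^bsub>F\<^esub> h s u"
    and h_left: "\<And>s t u. s \<in> carrier E \<Longrightarrow> t \<in> carrier E \<Longrightarrow> u \<in> carrier E \<Longrightarrow>
           h (s \<otimes>\<^bsub>E\<^esub> t) u = h s u \<otimes>\<^bsub>F\<^esub> h t u"
begin

abbreviation D where "D \<equiv> {..<r} \<times> {..<r}"

text \<open>The function \<open>h\<close> on coordinates is bimultiplicative, hence a cocycle with values in the
  functions on index pairs. The commutator of two elements is the antisymmetrized cocycle.\<close>

definition central_ext :: "((nat \<Rightarrow> 'e) \<times> (nat \<times> nat \<Rightarrow> 'f)) monoid" where
  "central_ext = \<lparr>carrier = ({..<r} \<rightarrow>\<^sub>E carrier E) \<times> (D \<rightarrow>\<^sub>E carrier F),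
     monoid.mult = (\<lambda>(x, u) (y, v). (\<lambda>i\<in>{..<r}. x i \<otimes>\<^bsub>E\<^esub> y i,
        \<lambda>d\<in>D. u d \<otimes>\<^bsub>F\<^esub> v d \<otimes>\<^bsub>F\<^esub> h (x (fst d)) (y (snd d)))),
     one = (\<lambda>i\<in>{..<r}. \<one>\<^bsub>E\<^esub>, \<lambda>d\<in>D. \<one>\<^bsub>F\<^esub>)\<rparr>"

lemma h_one_right: "s \<in> carrier E \<Longrightarrow> h s \<one>\<^bsub>E\<^esub> = \<one>\<^bsub>F\<^esub>"
  by (metis E.l_one E.one_closed F.l_cancel_one' h_closed h_right)

lemma h_one_left: "s \<in> carrier E \<Longrightarrow> h \<one>\<^bsub>E\<^esub> s = \<one>\<^bsub>F\<^esub>"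
  by (metis E.l_one E.one_closed F.l_cancel_one' h_closed h_left)

lemma central_ext_carrier: "(x, u) \<in> carrier central_ext \<longleftrightarrow> x \<in> {..<r} \<rightarrow>\<^sub>E carrier E \<and> u \<in> D \<rightarrow>\<^sub>E carrier F"
  by (simp add: central_ext_def)

lemma central_ext_mult: "(x, u) \<otimes>\<^bsub>central_ext\<^esub> (y, v) = (\<lambda>i\<in>{..<r}. x i \<otimes>\<^bsub>E\<^esub> y i,
        \<lambda>d\<in>D. u d \<otimes>\<^bsub>F\<^esub> v d \<otimes>\<^bsub>F\<^esub> h (x (fst d)) (y (snd d)))"
  by (simp add: central_ext_def)

lemma central_ext_one: "\<one>\<^bsub>central_ext\<^esub> = (\<lambda>i\<in>{..<r}. \<one>\<^bsub>E\<^esub>, \<lambda>d\<in>D. \<one>\<^bsub>F\<^esub>)"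
  by (simp add: central_ext_def)

lemma central_ext_group: "group central_ext"
proof (rule groupI)
  have memE: "x i \<in> carrier E" if "(x, u) \<in> carrier central_ext" "i < r" for x u i
    using that by (auto simp: central_ext_carrier PiE_def Pi_def)
  have memF: "u d \<in> carrier F" if "(x, u) \<in> carrier central_ext" "d \<in> D" for x u d
    using that(1) PiE_mem[OF _ that(2)] unfolding central_ext_carrier by blast
  show "X \<otimes>\<^bsub>central_ext\<^esub> Y \<in> carrier central_ext" if "X \<in> carrier central_ext" "Y \<in> carrier central_ext" for X Y
  proof -
    obtain x u y v where XY: "X = (x, u)" "Y = (y, v)" by (metis surj_pair)
    show ?thesis using memE[of x u] memE[of y v] memF[of x u] memF[of y v] that
      unfolding XY central_ext_mult central_ext_carrier[of "restrict _ _"]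
      by (intro conjI restrict_PiE_iff[THEN iffD2] ballI) (auto intro!: h_closed)
  qed
  show "\<one>\<^bsub>central_ext\<^esub> \<in> carrier central_ext" by (auto simp: central_ext_one central_ext_carrier)
  show "X \<otimes>\<^bsub>central_ext\<^esub> Y \<otimes>\<^bsub>central_ext\<^esub> W = X \<otimes>\<^bsub>central_ext\<^esub> (Y \<otimes>\<^bsub>central_ext\<^esub> W)"
    if "X \<in> carrier central_ext" "Y \<in> carrier central_ext" "W \<in> carrier central_ext" for X Y W
  proof -
    obtain x u y v z w where XY: "X = (x, u)" "Y = (y, v)" "W = (z, w)" by (metis surj_pair)
    have m: "\<And>i. i < r \<Longrightarrow> x i \<in> carrier E" "\<And>i. i < r \<Longrightarrow> y i \<in> carrier E" "\<And>i. i < r \<Longrightarrow> z i \<in> carrier E"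
      "\<And>d. d \<in> D \<Longrightarrow> u d \<in> carrier F" "\<And>d. d \<in> D \<Longrightarrow> v d \<in> carrier F" "\<And>d. d \<in> D \<Longrightarrow> w d \<in> carrier F"
      using that memE memF unfolding XY by blast+
    have 1: "x i \<otimes>\<^bsub>E\<^esub> y i \<otimes>\<^bsub>E\<^esub> z i = x i \<otimes>\<^bsub>E\<^esub> (y i \<otimes>\<^bsub>E\<^esub> z i)" if "i < r" for i
      using m(1-3)[OF that] by (rule E.m_assoc)
    \<comment> \<open>The cocycle identity: after expansion both sides contain the values of
      \<open>h\<close> at (x, y), (x, z) and (y, z), once each.\<close>
    have 2: "u d \<otimes>\<^bsub>F\<^esub> v d \<otimes>\<^bsub>F\<^esub> h (x i) (y j) \<otimes>\<^bsub>F\<^esub> w d \<otimes>\<^bsub>F\<^esub> h (x i \<otimes>\<^bsub>E\<^esub> y i) (z j) =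
        u d \<otimes>\<^bsub>F\<^esub> (v d \<otimes>\<^bsub>F\<^esub> w d \<otimes>\<^bsub>F\<^esub> h (y i) (z j)) \<otimes>\<^bsub>F\<^esub> h (x i) (y j \<otimes>\<^bsub>E\<^esub> z j)"
      if d: "d = (i, j)" "i < r" "j < r" for d i j
    proof -
      have dD: "d \<in> D" using d by auto
      have c: "u d \<in> carrier F" "v d \<in> carrier F" "w d \<in> carrier F" "h (x i) (y j) \<in> carrier F"
        "h (x i) (z j) \<in> carrier F" "h (y i) (z j) \<in> carrier F"
        using m dD d h_closed by auto
      show ?thesis using c m d by (simp add: h_left h_right F.m_ac)
    qed
    show ?thesis unfolding XY central_ext_mult using 1 2 by (auto intro!: restrict_ext)
  qed
  show "\<one>\<^bsub>central_ext\<^esub> \<otimes>\<^bsub>central_ext\<^esub> X = X" if "X \<in> carrier central_ext" for X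
  proof -
    obtain x u where X: "X = (x, u)" by (metis surj_pair)
    have m: "x \<in> {..<r} \<rightarrow>\<^sub>E carrier E" "u \<in> D \<rightarrow>\<^sub>E carrier F" using that unfolding X central_ext_carrier by auto
    have "(\<lambda>i\<in>{..<r}. (\<lambda>i\<in>{..<r}. \<one>\<^bsub>E\<^esub>) i \<otimes>\<^bsub>E\<^esub> x i) = x"
      using m(1) by (intro ext) (auto simp: PiE_def Pi_def extensional_def)
    moreover have "(\<lambda>d\<in>D. (\<lambda>d\<in>D. \<one>\<^bsub>F\<^esub>) d \<otimes>\<^bsub>F\<^esub> u d \<otimes>\<^bsub>F\<^esub> h ((\<lambda>i\<in>{..<r}. \<one>\<^bsub>E\<^esub>) (fst d)) (x (snd d))) = u"
    proof (rule ext)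
      fix d
      show "(\<lambda>d\<in>D. (\<lambda>d\<in>D. \<one>\<^bsub>F\<^esub>) d \<otimes>\<^bsub>F\<^esub> u d \<otimes>\<^bsub>F\<^esub> h ((\<lambda>i\<in>{..<r}. \<one>\<^bsub>E\<^esub>) (fst d)) (x (snd d))) d = u d"
        using memE[OF that[unfolded X]] PiE_mem[OF m(2), of d] PiE_arb[OF m(2), of d] h_one_left
        by (cases "d \<in> D") auto
    qed
    ultimately show ?thesis unfolding X central_ext_one central_ext_mult by simp
  qed
  show "\<exists>Y\<in>carrier central_ext. Y \<otimes>\<^bsub>central_ext\<^esub> X = \<one>\<^bsub>central_ext\<^esub>" if "X \<in> carrier central_ext" for X
  proof -
    obtain x u where X: "X = (x, u)" by (metis surj_pair)
    have m: "\<And>i. i < r \<Longrightarrow> x i \<in> carrier E" "\<And>d. d \<in> D \<Longrightarrow> u d \<in> carrier F"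
      using that memE memF unfolding X by blast+
    define y where "y = (\<lambda>i\<in>{..<r}. inv\<^bsub>E\<^esub> x i)"
    define v where "v = (\<lambda>d\<in>D. inv\<^bsub>F\<^esub> (u d \<otimes>\<^bsub>F\<^esub> h (y (fst d)) (x (snd d))))"
    have yc: "y i \<in> carrier E" "y i \<otimes>\<^bsub>E\<^esub> x i = \<one>\<^bsub>E\<^esub>" if "i < r" for i using that m by (auto simp: y_def)
    have vc: "v d \<in> carrier F" "v d \<otimes>\<^bsub>F\<^esub> u d \<otimes>\<^bsub>F\<^esub> h (y (fst d)) (x (snd d)) = \<one>\<^bsub>F\<^esub>" if d: "d \<in> D" for d
    proof -
      have c: "u d \<in> carrier F" "h (y (fst d)) (x (snd d)) \<in> carrier F" using d m yc h_closed by auto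
      then show "v d \<in> carrier F" using d by (simp add: v_def)
      then show "v d \<otimes>\<^bsub>F\<^esub> u d \<otimes>\<^bsub>F\<^esub> h (y (fst d)) (x (snd d)) = \<one>\<^bsub>F\<^esub>"
        using c d F.l_inv[OF F.m_closed[OF c]] by (simp add: v_def F.m_assoc)
    qed
    have "(y, v) \<in> carrier central_ext" unfolding central_ext_carrier using yc(1) vc(1)
      by (auto simp: y_def v_def PiE_def)
    moreover have "(y, v) \<otimes>\<^bsub>central_ext\<^esub> X = \<one>\<^bsub>central_ext\<^esub>"
      unfolding X central_ext_mult central_ext_one using yc(2) vc(2) by (auto intro!: restrict_ext)
    ultimately show ?thesis by blast
  qed
qed

lemma central_ext_commute_iff:
  assumes "X \<in> carrier central_ext" "Y \<in> carrier central_ext"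
  shows "X \<otimes>\<^bsub>central_ext\<^esub> Y = Y \<otimes>\<^bsub>central_ext\<^esub> X \<longleftrightarrow> (\<forall>i<r. \<forall>j<r. h (fst X i) (fst Y j) = h (fst Y i) (fst X j))"
proof -
  obtain x u y v where XY: "X = (x, u)" "Y = (y, v)" by (metis surj_pair)
  have m: "\<And>i. i < r \<Longrightarrow> x i \<in> carrier E" "\<And>i. i < r \<Longrightarrow> y i \<in> carrier E"
    "\<And>d. d \<in> D \<Longrightarrow> u d \<in> carrier F" "\<And>d. d \<in> D \<Longrightarrow> v d \<in> carrier F"
    using assms PiE_mem unfolding XY central_ext_carrier by (auto simp: PiE_def Pi_def)
  have fe: "(\<lambda>i\<in>{..<r}. x i \<otimes>\<^bsub>E\<^esub> y i) = (\<lambda>i\<in>{..<r}. y i \<otimes>\<^bsub>E\<^esub> x i)"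
    using m(1,2) by (intro restrict_ext) (auto simp: E.m_comm)
  have se: "u d \<otimes>\<^bsub>F\<^esub> v d \<otimes>\<^bsub>F\<^esub> h (x i) (y j) = v d \<otimes>\<^bsub>F\<^esub> u d \<otimes>\<^bsub>F\<^esub> h (y i) (x j) \<longleftrightarrow> h (x i) (y j) = h (y i) (x j)"
    if d: "d = (i, j)" "i < r" "j < r" for d i j
  proof -
    have "u d \<in> carrier F" "v d \<in> carrier F" "h (x i) (y j) \<in> carrier F" "h (y i) (x j) \<in> carrier F"
      using m d h_closed by auto
    then show ?thesis using F.m_comm[of "v d" "u d"] by simp
  qed
  have "X \<otimes>\<^bsub>central_ext\<^esub> Y = Y \<otimes>\<^bsub>central_ext\<^esub> X \<longleftrightarrow>
     (\<forall>d\<in>D. u d \<otimes>\<^bsub>F\<^esub> v d \<otimes>\<^bsub>F\<^esub> h (x (fst d)) (y (snd d)) = v d \<otimes>\<^bsub>F\<^esub> u d \<otimes>\<^bsub>F\<^esub> h (y (fst d)) (x (snd d)))"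
    unfolding XY central_ext_mult using fe by (auto simp: fun_eq_iff restrict_def)
  also have "\<dots> \<longleftrightarrow> (\<forall>i<r. \<forall>j<r. h (x i) (y j) = h (y i) (x j))" using se by force
  finally show ?thesis by (simp add: XY)
qed

lemma central_ext_fst_hom: "i < r \<Longrightarrow> (\<lambda>X. fst X i) \<in> hom central_ext E"
  by (auto simp: hom_def central_ext_def)

text \<open>With trivial first component the cocycle contributes nothing, so powers are taken
  entrywise. These are the elements that correspond to \<open>Z\<close>.\<close>

lemma central_ext_pow:
  assumes "u \<in> D \<rightarrow>\<^sub>E carrier F"
  shows "((\<lambda>i\<in>{..<r}. \<one>\<^bsub>E\<^esub>), u) [^]\<^bsub>central_ext\<^esub> (m::nat) = ((\<lambda>i\<in>{..<r}. \<one>\<^bsub>E\<^esub>), \<lambda>d\<in>D. u d [^]\<^bsub>F\<^esub> m)"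
proof (induction m)
  case 0 then show ?case by (simp add: central_ext_one restrict_def)
next
  case (Suc m)
  have "u d \<in> carrier F" if "d \<in> D" for d using PiE_mem[OF assms that] .
  then show ?case using Suc by (auto simp: central_ext_mult h_one_left intro!: restrict_ext)
qed

lemma card_central_ext: "card (carrier central_ext) = card (carrier E) ^ r * card (carrier F) ^ (r * r)"
  by (simp add: central_ext_def card_cartesian_product card_PiE)

end

text \<open>The theorem asks for a group on natural numbers, while the field consists of sets of
  polynomials. The coordinates of the copy are read through \<open>f\<close>, so a bijective
  homomorphism is all that is passed on.\<close>

lemma (in group) nat_copy:
  assumes "finite (carrier G)"
  obtains H :: "nat monoid" and f where "group H" "f \<in> hom H G" "bij_betw f (carrier H) (carrier G)"
proof -
  obtain \<phi> :: "'a \<Rightarrow> nat" where \<phi>: "inj_on \<phi> (carrier G)" using finite_imp_inj_to_nat_seg[OF assms] by metis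
  define f where "f = inv_into (carrier G) \<phi>"
  define H where "H = \<lparr>carrier = \<phi> ` carrier G, monoid.mult = (\<lambda>x y. \<phi> (f x \<otimes> f y)), one = \<phi> \<one>\<rparr>"
  have f\<phi>: "f (\<phi> x) = x" if "x \<in> carrier G" for x using \<phi> that by (simp add: f_def)
  have \<phi>iso: "\<phi> \<in> iso G H"
    using \<phi> by (auto simp: iso_def hom_def bij_betw_def H_def f\<phi>)
  have "monoid H"
    by unfold_locales (auto simp: H_def f\<phi> m_assoc)
  then have gH: "group H" using iso_imp_img_group[OF \<phi>iso] by (simp add: H_def)
  have "f \<in> hom H G" by (auto simp: hom_def H_def f\<phi>)
  moreover have "bij_betw f (carrier H) (carrier G)"
    unfolding f_def H_def using \<phi> by (simp add: bij_betw_inv_into inj_on_imp_bij_betw)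
  ultimately show thesis using that gH by blast
qed

section \<open>The skew-hermitian plane over the field of order q^2\<close>

text \<open>\<open>pow_card\<close> makes the q-th power map an involution and \<open>frob\<close>
  makes it additive; \<open>card_fixed\<close> counts the self-conjugate lines and shows that not
  every element is skew.\<close>

locale quadratic_field = field R for R :: "'a ring" (structure) +
  fixes p q :: nat
  assumes fin: "finite (carrier R)" and card: "card (carrier R) = q\<^sup>2" and q2: "q \<ge> 2"
    and pow_card: "\<And>x. x \<in> carrier R \<Longrightarrow> x [^] (q\<^sup>2) = x"
    and add_pow_p: "\<And>x. x \<in> carrier R \<Longrightarrow> [p] \<cdot> x = \<zero>"
    and frob: "\<And>x y. x \<in> carrier R \<Longrightarrow> y \<in> carrier R \<Longrightarrow> (x \<oplus> y) [^] q = x [^] q \<oplus> y [^] q"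
    and card_fixed: "card {x \<in> carrier R. x [^] q = x} = q"
begin

definition cj where "cj x = x [^] q"
definition form where "form s t = cj (fst s) \<otimes> snd t \<ominus> cj (snd s) \<otimes> fst t"
definition E2 where "E2 = add_monoid R \<times>\<times> add_monoid R"
definition Ra where "Ra = add_monoid R"
text \<open>The projective line: \<open>None\<close> stands for the vertical line and
  \<open>Some c\<close> for the line of slope \<open>c\<close>. Conjugation of lines is therefore
  \<open>map_option cj\<close>.\<close>

definition lines where "lines = insert None (Some ` carrier R)"
definition line where "line l = (case l of None \<Rightarrow> {\<zero>} \<times> carrier R | Some c \<Rightarrow> (\<lambda>s. (s, c \<otimes> s)) ` carrier R)"

lemma cj_closed [simp]: "x \<in> carrier R \<Longrightarrow> cj x \<in> carrier R" by (simp add: cj_def)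
lemma cj_add [simp]: "x \<in> carrier R \<Longrightarrow> y \<in> carrier R \<Longrightarrow> cj (x \<oplus> y) = cj x \<oplus> cj y" by (simp add: cj_def frob)
lemma cj_mult [simp]: "x \<in> carrier R \<Longrightarrow> y \<in> carrier R \<Longrightarrow> cj (x \<otimes> y) = cj x \<otimes> cj y" by (simp add: cj_def nat_pow_distrib)
lemma cj_cj [simp]: "x \<in> carrier R \<Longrightarrow> cj (cj x) = x"
  using pow_card[of x] by (simp add: cj_def nat_pow_pow power2_eq_square)
lemma cj_zero [simp]: "cj \<zero> = \<zero>" using q2 by (simp add: cj_def nat_pow_zero)
lemma cj_one [simp]: "cj \<one> = \<one>" by (simp add: cj_def)
lemma cj_minus [simp]: assumes x: "x \<in> carrier R" shows "cj (\<ominus> x) = \<ominus> cj x"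
proof -
  have "cj (\<ominus> x) \<oplus> cj x = \<zero>" using x cj_add[of "\<ominus> x" x] by (simp add: l_neg)
  then show ?thesis using x minus_equality[of "cj (\<ominus> x)" "cj x"] by simp
qed
lemma cj_inj: "x \<in> carrier R \<Longrightarrow> y \<in> carrier R \<Longrightarrow> cj x = cj y \<Longrightarrow> x = y" by (metis cj_cj)
lemma cj_zero_iff: "x \<in> carrier R \<Longrightarrow> cj x = \<zero> \<longleftrightarrow> x = \<zero>" using cj_inj[of x \<zero>] by auto

lemma E2_simps: "carrier E2 = carrier R \<times> carrier R" "\<one>\<^bsub>E2\<^esub> = (\<zero>, \<zero>)"
   "s \<otimes>\<^bsub>E2\<^esub> t = (fst s \<oplus> fst t, snd s \<oplus> snd t)"
  by (auto simp: E2_def DirProd_def case_prod_beta)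

lemma Ra_simps: "carrier Ra = carrier R" "\<one>\<^bsub>Ra\<^esub> = \<zero>" "x \<otimes>\<^bsub>Ra\<^esub> y = x \<oplus> y"
  by (simp_all add: Ra_def)

lemma comm_group_E2: "comm_group E2"
proof (rule group.group_comm_groupI)
  show "group E2" unfolding E2_def using DirProd_group a_group by blast
qed (auto simp: E2_simps a_comm)

lemma form_closed: "s \<in> carrier E2 \<Longrightarrow> t \<in> carrier E2 \<Longrightarrow> form s t \<in> carrier R"
  by (auto simp: form_def E2_simps)

lemma form_right: "s \<in> carrier E2 \<Longrightarrow> t \<in> carrier E2 \<Longrightarrow> u \<in> carrier E2 \<Longrightarrow>
   form s (t \<otimes>\<^bsub>E2\<^esub> u) = form s t \<oplus> form s u"
  by (cases s; cases t; cases u) (auto simp: form_def E2_simps a_minus_def r_distr l_distr minus_add a_ac)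

lemma form_left: "s \<in> carrier E2 \<Longrightarrow> t \<in> carrier E2 \<Longrightarrow> u \<in> carrier E2 \<Longrightarrow>
   form (s \<otimes>\<^bsub>E2\<^esub> t) u = form s u \<oplus> form t u"
  by (cases s; cases t; cases u) (auto simp: form_def E2_simps a_minus_def r_distr l_distr minus_add a_ac)

text \<open>This yields both the symmetry of orthogonality and the fact that equal values
  \<open>form s t = form t s\<close> lie in \<open>skew\<close>.\<close>

lemma form_skew: assumes "s \<in> carrier E2" "t \<in> carrier E2" shows "form t s = \<ominus> cj (form s t)"
proof -
  obtain s1 s2 t1 t2 where st: "s = (s1, s2)" "t = (t1, t2)" by (metis surj_pair)
  have c: "s1 \<in> carrier R" "s2 \<in> carrier R" "t1 \<in> carrier R" "t2 \<in> carrier R" using assms by (auto simp: st E2_simps)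
  have "cj (form s t) = s1 \<otimes> cj t2 \<ominus> s2 \<otimes> cj t1" using c by (simp add: form_def st a_minus_def)
  moreover have "form t s = cj t1 \<otimes> s2 \<ominus> cj t2 \<otimes> s1" by (simp add: form_def st)
  moreover have "cj t1 \<in> carrier R" "cj t2 \<in> carrier R" using c by auto
  ultimately show ?thesis using c by (simp add: a_minus_def minus_add a_ac m_comm)
qed

text \<open>For \<open>s\<close> on the line of slope \<open>c\<close> the form factors as
  \<open>cj s1 \<otimes> (t2 \<ominus> cj c \<otimes> t1)\<close>, so orthogonality says that
  \<open>t\<close> lies on the line of slope \<open>cj c\<close>. On the vertical line only the
  product of \<open>cj s2\<close> and \<open>t1\<close> remains.\<close>

lemma line_perp_iff:
  assumes l: "l \<in> lines" and s: "s \<in> line l" "s \<noteq> \<one>\<^bsub>E2\<^esub>" and t: "t \<in> carrier E2"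
  shows "form s t = \<zero> \<longleftrightarrow> t \<in> line (map_option cj l)"
proof (cases l)
  case None
  obtain t1 t2 where t': "t = (t1, t2)" "t1 \<in> carrier R" "t2 \<in> carrier R" using t by (auto simp: E2_simps)
  obtain s2 where s': "s = (\<zero>, s2)" "s2 \<in> carrier R" "s2 \<noteq> \<zero>" using s None by (auto simp: line_def E2_simps)
  have "form s t = \<ominus> (cj s2 \<otimes> t1)" using s' t' by (simp add: form_def a_minus_def)
  then have "form s t = \<zero> \<longleftrightarrow> t1 = \<zero>" using s' t' cj_zero_iff integral_iff by (simp add: add.inv_eq_1_iff)
  then show ?thesis using t' None by (auto simp: line_def)
next
  case (Some c)
  have c: "c \<in> carrier R" using l Some by (auto simp: lines_def)
  obtain t1 t2 where t': "t = (t1, t2)" "t1 \<in> carrier R" "t2 \<in> carrier R" using t by (auto simp: E2_simps)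
  obtain s1 where s': "s = (s1, c \<otimes> s1)" "s1 \<in> carrier R" using s Some by (auto simp: line_def)
  have s1: "s1 \<noteq> \<zero>" using s(2) s' c by (auto simp: E2_simps)
  have cc: "cj s1 \<in> carrier R" "cj c \<in> carrier R" using s' c by auto
  have "form s t = cj s1 \<otimes> (t2 \<ominus> cj c \<otimes> t1)"
    using s' t' c cc by (simp add: form_def a_minus_def r_distr r_minus m_ac)
  then have "form s t = \<zero> \<longleftrightarrow> t2 \<ominus> cj c \<otimes> t1 = \<zero>"
    using s' s1 t' c cc cj_zero_iff[of s1] integral_iff[of "cj s1" "t2 \<ominus> cj c \<otimes> t1"] by auto
  also have "\<dots> \<longleftrightarrow> t2 = cj c \<otimes> t1" using t' cc by simp
  finally show ?thesis using t' Some by (auto simp: line_def)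
qed

lemma line_subgroup: "l \<in> lines \<Longrightarrow> subgroup (line l) E2"
proof -
  assume l: "l \<in> lines"
  interpret E: comm_group E2 by (rule comm_group_E2)
  show ?thesis
  proof (cases l)
    case None
    show ?thesis
    proof (rule E.subgroupI)
      fix a assume "a \<in> line l"
      then obtain s where s: "a = (\<zero>, s)" "s \<in> carrier R" using None by (auto simp: line_def)
      have "inv\<^bsub>E2\<^esub> a = (\<zero>, \<ominus> s)" using s by (intro E.inv_equality) (auto simp: E2_simps l_neg)
      then show "inv\<^bsub>E2\<^esub> a \<in> line l" using s None by (auto simp: line_def)
    qed (use None in \<open>auto simp: line_def E2_simps\<close>)
  next
    case (Some c)
    have c: "c \<in> carrier R" using l Some by (auto simp: lines_def)
    have li: "line l = (\<lambda>s. (s, c \<otimes> s)) ` carrier R" using Some by (simp add: line_def)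
    show ?thesis
    proof (rule E.subgroupI)
      show "line l \<subseteq> carrier E2" using c li by (auto simp: E2_simps)
      show "line l \<noteq> {}" using li by auto
      fix a assume "a \<in> line l"
      then obtain s where s: "a = (s, c \<otimes> s)" "s \<in> carrier R" using li by auto
      have "inv\<^bsub>E2\<^esub> a = (\<ominus> s, c \<otimes> \<ominus> s)" using s c by (intro E.inv_equality) (auto simp: E2_simps l_neg r_minus)
      then show "inv\<^bsub>E2\<^esub> a \<in> line l" using s li by auto
      fix b assume "b \<in> line l"
      then obtain t where t: "b = (t, c \<otimes> t)" "t \<in> carrier R" using li by auto
      have "a \<otimes>\<^bsub>E2\<^esub> b = (s \<oplus> t, c \<otimes> (s \<oplus> t))" using s t c by (simp add: E2_simps r_distr)
      then show "a \<otimes>\<^bsub>E2\<^esub> b \<in> line l" using s t li by auto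
    qed
  qed
qed

lemma card_line: "l \<in> lines \<Longrightarrow> card (line l) = q\<^sup>2"
proof (cases l)
  case None then show ?thesis by (simp add: line_def card_cartesian_product card)
next
  case (Some c)
  have "inj_on (\<lambda>s. (s, c \<otimes> s)) (carrier R)" by (auto intro: inj_onI)
  then show ?thesis using Some by (simp add: line_def card_image card)
qed

lemma line_inter: assumes lm: "l \<in> lines" "m \<in> lines" "l \<noteq> m" shows "line l \<inter> line m = {\<one>\<^bsub>E2\<^esub>}"
proof -
  have ss: "s = \<one>\<^bsub>E2\<^esub>" if sc: "s \<in> line (Some c)" "s \<in> line (Some d)" "c \<noteq> d" "c \<in> carrier R" "d \<in> carrier R" for s c d
  proof -
    obtain x where x: "x \<in> carrier R" "s = (x, c \<otimes> x)" "c \<otimes> x = d \<otimes> x" using sc by (auto simp: line_def)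
    then have "x = \<zero>" using m_rcancel[of x c d] sc by auto
    then show ?thesis using x sc by (simp add: E2_simps)
  qed
  have sn: "s = \<one>\<^bsub>E2\<^esub>" if "s \<in> line None" "s \<in> line (Some d)" "d \<in> carrier R" for s d
    using that by (auto simp: line_def E2_simps)
  have "line l \<inter> line m \<subseteq> {\<one>\<^bsub>E2\<^esub>}"
  proof
    fix s assume s: "s \<in> line l \<inter> line m"
    then have sl: "s \<in> line l" "s \<in> line m" by auto
    have "s = \<one>\<^bsub>E2\<^esub>"
    proof (cases l)
      case None
      then obtain d where "m = Some d" using lm(3) by (cases m) auto
      then show ?thesis using sn[of s d] sl lm(2) None by (auto simp: lines_def)
    next
      case (Some c)
      then have c: "c \<in> carrier R" using lm(1) by (auto simp: lines_def)
      show ?thesis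
      proof (cases m)
        case None
        then show ?thesis using sn[of s c] sl c Some by simp
      next
        case (Some d)
        then have "d \<in> carrier R" using lm(2) by (auto simp: lines_def)
        then show ?thesis using ss[of s c d] sl c \<open>l = Some c\<close> Some lm(3) by simp
      qed
    qed
    then show "s \<in> {\<one>\<^bsub>E2\<^esub>}" by simp
  qed
  moreover have "\<one>\<^bsub>E2\<^esub> \<in> line l" "\<one>\<^bsub>E2\<^esub> \<in> line m" using subgroup.one_closed[OF line_subgroup] lm by auto
  ultimately show ?thesis by blast
qed

lemma line_cover: "carrier E2 \<subseteq> (\<Union>l\<in>lines. line l)"
proof
  fix s assume "s \<in> carrier E2"
  then obtain s1 s2 where s: "s = (s1, s2)" "s1 \<in> carrier R" "s2 \<in> carrier R" by (auto simp: E2_simps)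
  show "s \<in> (\<Union>l\<in>lines. line l)"
  proof (cases "s1 = \<zero>")
    case True
    then have "s \<in> line None" using s by (simp add: line_def)
    then show ?thesis by (auto simp: lines_def)
  next
    case False
    then have u: "s1 \<in> Units R" using s field_Units by auto
    then have i: "inv s1 \<in> carrier R" by auto
    have "(s2 \<otimes> inv s1) \<otimes> s1 = s2" using u i s by (simp add: m_assoc)
    then have "s \<in> line (Some (s2 \<otimes> inv s1))" using s by (auto simp: line_def)
    then show ?thesis using s i by (auto simp: lines_def)
  qed
qed

lemma card_lines: "card lines = q\<^sup>2 + 1"
  using fin by (simp add: lines_def card_image card)

lemma card_fixed_lines: "card {l \<in> lines. map_option cj l = l} = q + 1"
proof -
  have "{l \<in> lines. map_option cj l = l} = insert None (Some ` {x \<in> carrier R. x [^] q = x})"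
    by (auto simp: lines_def cj_def)
  then show ?thesis using fin card_fixed by (simp add: card_image)
qed

text \<open>The kernel of the trace \<open>x \<oplus> cj x\<close> to the fixed field.\<close>

definition skew where "skew = {x \<in> carrier R. x = \<ominus> cj x}"

text \<open>If every element were skew, then 1 = -1 and \<open>cj\<close> would be the identity,
  whereas it fixes only q of the q^2 elements. This covers characteristic 2 as well.\<close>

lemma skew_proper: "skew \<subset> carrier R"
proof -
  have "skew \<noteq> carrier R"
  proof
    assume a: "skew = carrier R"
    have m: "x = \<ominus> cj x" if "x \<in> carrier R" for x using that a by (auto simp: skew_def)
    have 1: "\<one> = \<ominus> \<one>" using m[of \<one>] by simp
    have "cj x = x" if x: "x \<in> carrier R" for x
    proof -
      have "x = \<ominus> cj x" using m x .
      also have "\<dots> = \<ominus> \<one> \<otimes> cj x" using x by (simp add: l_minus)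
      also have "\<dots> = cj x" unfolding 1[symmetric] using x by simp
      finally show ?thesis by simp
    qed
    then have "{x \<in> carrier R. x [^] q = x} = carrier R" by (auto simp: cj_def)
    then have "q\<^sup>2 = q" using card card_fixed by simp
    then show False using q2 by (simp add: power2_eq_square)
  qed
  then show ?thesis by (auto simp: skew_def)
qed

sublocale B: bihom E2 Ra form r for r
  using comm_group_E2 a_comm_group[folded Ra_def] form_closed form_right form_left
  by (auto simp: bihom_def bihom_axioms_def Ra_simps)

lemma p_spread_group_copy:
  assumes r: "r \<ge> 3" and H: "group H" and f: "f \<in> hom H (B.central_ext r)" "bij_betw f (carrier H) (carrier (B.central_ext r))"
    and p: "prime p" "q\<^sup>2 = p ^ a"
  shows "p_spread_group H E2 Ra r (q\<^sup>2) (\<lambda>i x. fst (f x) i) form skew lines line (map_option cj) p (a * r) a"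
proof -
  interpret X: group "B.central_ext r" by (rule B.central_ext_group)
  interpret fh: group_hom H "B.central_ext r" f by (simp add: group_hom_def group_hom_axioms_def H X.is_group f)
  interpret E: comm_group E2 by (rule comm_group_E2)
  have finE: "finite (carrier E2)" using fin by (simp add: E2_simps)
  have finX: "finite (carrier (B.central_ext r))"
    using finE fin by (simp add: B.central_ext_def finite_PiE Ra_simps)
  have fc: "f x \<in> carrier (B.central_ext r)" if "x \<in> carrier H" for x using that by simp
  have finj: "x = y" if "x \<in> carrier H" "y \<in> carrier H" "f x = f y" for x y
    using f(2) that by (auto simp: bij_betw_def dest: inj_onD)
  have q4: "q\<^sup>2 \<ge> 2" using q2 mult_le_mono[of 2 q 1 q] by (simp add: power2_eq_square)
  have sg: "spread_group H E2 Ra r (q\<^sup>2) (\<lambda>i x. fst (f x) i) form skew lines line (map_option cj)"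
  proof (intro spread_group.intro spread_group_axioms.intro)
    show "Group.group H" "comm_group E2" "Group.group Ra"
      using H comm_group_E2 a_group by (simp_all add: Ra_def)
    show "3 \<le> r" "2 \<le> q\<^sup>2" using r q4 .
    show "finite (carrier H)" using finX bij_betw_finite[OF f(2)] by simp
    show "card (carrier E2) = (q\<^sup>2)\<^sup>2" by (simp add: E2_simps card_cartesian_product card power2_eq_square)
    show "card (carrier Ra) = q\<^sup>2" by (simp add: card Ra_simps)
    show "(\<lambda>x. fst (f x) i) \<in> hom H E2" if "i < r" for i
      using hom_compose[OF f(1) B.central_ext_fst_hom[OF that]] by (simp add: comp_def)
    show "\<exists>g\<in>carrier H. \<forall>i<r. fst (f g) i = w i" if w: "w \<in> {..<r} \<rightarrow> carrier E2" for w
    proof -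
      have "(restrict w {..<r}, \<lambda>d\<in>{..<r} \<times> {..<r}. \<zero>) \<in> carrier (B.central_ext r)"
        using w by (auto simp: B.central_ext_carrier Ra_simps)
      then have "(restrict w {..<r}, \<lambda>d\<in>{..<r} \<times> {..<r}. \<zero>) \<in> f ` carrier H"
        using bij_betw_imp_surj_on[OF f(2)] by simp
      then obtain g where g: "g \<in> carrier H" "(restrict w {..<r}, \<lambda>d\<in>{..<r} \<times> {..<r}. \<zero>) = f g" by blast
      show ?thesis using g(1) by (intro bexI[of _ g]) (simp_all add: g(2)[symmetric])
    qed
    show "form s t \<in> carrier Ra" if "s \<in> carrier E2" "t \<in> carrier E2" for s t
      using form_closed that by (simp add: Ra_simps)
    show "form s (t \<otimes>\<^bsub>E2\<^esub> u) = form s t \<otimes>\<^bsub>Ra\<^esub> form s u" "form (s \<otimes>\<^bsub>E2\<^esub> t) u = form s u \<otimes>\<^bsub>Ra\<^esub> form t u"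
      if "s \<in> carrier E2" "t \<in> carrier E2" "u \<in> carrier E2" for s t u
      using form_right form_left that by (simp_all add: Ra_simps)
    show "form t s = \<one>\<^bsub>Ra\<^esub>" if "s \<in> carrier E2" "t \<in> carrier E2" "form s t = \<one>\<^bsub>Ra\<^esub>" for s t
      using form_skew[OF that(1,2)] that(3) by (simp add: Ra_simps)
    show "x \<otimes>\<^bsub>H\<^esub> y = y \<otimes>\<^bsub>H\<^esub> x \<longleftrightarrow> (\<forall>i<r. \<forall>j<r. form (fst (f x) i) (fst (f y) j) = form (fst (f y) i) (fst (f x) j))"
      if xy: "x \<in> carrier H" "y \<in> carrier H" for x y
    proof -
      have "x \<otimes>\<^bsub>H\<^esub> y = y \<otimes>\<^bsub>H\<^esub> x \<longleftrightarrow> f x \<otimes>\<^bsub>B.central_ext r\<^esub> f y = f y \<otimes>\<^bsub>B.central_ext r\<^esub> f x"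
        using finj[OF fh.G.m_closed[OF xy] fh.G.m_closed[OF xy(2,1)]]
        unfolding fh.hom_mult[OF xy, symmetric] fh.hom_mult[OF xy(2,1), symmetric] by metis
      then show ?thesis using B.central_ext_commute_iff[OF fc[OF xy(1)] fc[OF xy(2)]] by simp
    qed
    show "form s t \<in> skew" if "s \<in> carrier E2" "t \<in> carrier E2" "form s t = form t s" for s t
      using form_skew[OF that(1,2)] form_closed[OF that(1,2)] that(3) by (simp add: skew_def)
    show "skew \<subset> carrier Ra" using skew_proper by (simp add: Ra_simps)
    show "subgroup (line l) E2" if "l \<in> lines" for l using line_subgroup that .
    show "card (line l) = q\<^sup>2" if "l \<in> lines" for l using card_line that .
    show "line l \<inter> line m = {\<one>\<^bsub>E2\<^esub>}" if "l \<in> lines" "m \<in> lines" "l \<noteq> m" for l m using line_inter that .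
    show "carrier E2 \<subseteq> (\<Union>l\<in>lines. line l)" by (rule line_cover)
    show "map_option cj l \<in> lines" if "l \<in> lines" for l using that by (auto simp: lines_def)
    show "inj_on (map_option cj) lines"
    proof (rule inj_onI)
      fix l m assume "l \<in> lines" "m \<in> lines" "map_option cj l = map_option cj m"
      then show "l = m" by (cases l; cases m) (auto simp: lines_def dest: cj_inj)
    qed
    show "form s t = \<one>\<^bsub>Ra\<^esub> \<longleftrightarrow> t \<in> line (map_option cj l)"
      if "l \<in> lines" "s \<in> line l" "s \<noteq> \<one>\<^bsub>E2\<^esub>" "t \<in> carrier E2" for l s t
      using line_perp_iff[OF that] by (simp add: Ra_simps)
    show "card lines = q\<^sup>2 + 1" by (rule card_lines)
  qed
  interpret S: spread_group H E2 Ra r "q\<^sup>2" "\<lambda>i x. fst (f x) i" form skew lines line "map_option cj" by (rule sg)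
  show ?thesis
  proof (intro p_spread_group.intro[OF sg] p_spread_group_axioms.intro)
    show "prime p" "q\<^sup>2 = p ^ a" "a * r = a * r" using p by auto
    show "x [^]\<^bsub>E2\<^esub> p = \<one>\<^bsub>E2\<^esub>" if "x \<in> carrier E2" for x
    proof -
      have "x [^]\<^bsub>E2\<^esub> m = ([m] \<cdot> fst x, [m] \<cdot> snd x)" for m :: nat
        using that by (induction m) (auto simp: E2_simps)
      then show ?thesis using that add_pow_p by (auto simp: E2_simps)
    qed
    show "z [^]\<^bsub>H\<^esub> p = \<one>\<^bsub>H\<^esub>" if z: "z \<in> S.Z" for z
    proof -
      have zc: "z \<in> carrier H" and ze: "\<forall>i<r. fst (f z) i = \<one>\<^bsub>E2\<^esub>" using z by (auto simp: S.Z_def)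
      obtain x u where xu: "f z = (x, u)" by (metis surj_pair)
      have c: "x \<in> {..<r} \<rightarrow>\<^sub>E carrier E2" "u \<in> {..<r} \<times> {..<r} \<rightarrow>\<^sub>E carrier R"
        using fc[OF zc] by (auto simp: xu B.central_ext_carrier Ra_simps)
      have x1: "x = (\<lambda>i\<in>{..<r}. \<one>\<^bsub>E2\<^esub>)" using c(1) ze xu by (intro ext) (auto simp: PiE_def extensional_def)
      have "f (z [^]\<^bsub>H\<^esub> p) = f z [^]\<^bsub>B.central_ext r\<^esub> p" using fh.hom_nat_pow[OF zc] .
      also have "\<dots> = (\<lambda>i\<in>{..<r}. \<one>\<^bsub>E2\<^esub>, \<lambda>d\<in>{..<r} \<times> {..<r}. u d [^]\<^bsub>Ra\<^esub> p)"
        unfolding xu x1 using c(2) by (intro B.central_ext_pow) (simp add: Ra_simps)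
      also have "\<dots> = \<one>\<^bsub>B.central_ext r\<^esub>" unfolding B.central_ext_one
        using PiE_mem[OF c(2)] add_pow_p[unfolded add_pow_def, folded Ra_def] by (auto simp: add_pow_def Ra_simps Ra_def[symmetric] intro!: restrict_ext)
      also have "\<dots> = f \<one>\<^bsub>H\<^esub>" by simp
      finally show ?thesis using finj[of "z [^]\<^bsub>H\<^esub> p" "\<one>\<^bsub>H\<^esub>"] zc by simp
    qed
    show "\<exists>m. order H = p ^ m"
    proof -
      have "order H = card (carrier (B.central_ext r))" using bij_betw_same_card[OF f(2)] by (simp add: order_def)
      also have "\<dots> = (p ^ a) ^ (2 * r + r * r)"
      proof -
        have "(k * k) ^ r * k ^ (r * r) = k ^ (2 * r + r * r)" for k :: nat
          by (simp add: power_add power_mult_distrib mult_2)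
        then show ?thesis
          unfolding B.card_central_ext E2_simps(1) Ra_simps(1) card_cartesian_product card p(2) .
      qed
      also have "\<dots> = p ^ (a * (2 * r + r * r))" by (simp flip: power_mult)
      finally show ?thesis by blast
    qed
  qed
qed

end

section \<open>Existence\<close>

theorem theorem7:
  fixes p a b r n :: nat
  assumes "prime p"
    and "a > 0" and "b > 0" and "r > 0"
    and "a = 2 * b" and "r \<ge> 3"
    and "n = a * r"
  shows "\<exists>G :: nat monoid.
           finite_p_group p G \<and>
           P1 p G \<and> P2 G \<and> P3 p n G \<and>
           order (G Mod group_center G) = p ^ (2 * n) \<and>
           quasi_antichain (p ^ a + 1) (CD G) \<and>
           card (abelian_atoms G) = p ^ b + 1"
proof -
  define q where "q = p ^ b"
  have p1: "p > 1" using assms(1) by (rule prime_gt_1_nat)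
  have q2: "q \<ge> 2" using power_increasing[of 1 b p] p1 assms(3) by (simp add: q_def)
  have q: "q\<^sup>2 = p ^ a" by (simp add: q_def assms(5) power_mult[symmetric] mult.commute)
  have qa: "p ^ a \<ge> 2" using power_increasing[of 1 a p] p1 assms(2) by simp
  obtain F :: "int poly set ring" where F: "field F" "finite (carrier F)" "card (carrier F) = p ^ a"
    "\<And>x. x \<in> carrier F \<Longrightarrow> x [^]\<^bsub>F\<^esub> (p ^ a) = x"
    "\<And>x. x \<in> carrier F \<Longrightarrow> [p] \<cdot>\<^bsub>F\<^esub> x = \<zero>\<^bsub>F\<^esub>"
    "\<And>x y m. x \<in> carrier F \<Longrightarrow> y \<in> carrier F \<Longrightarrow>
       (x \<oplus>\<^bsub>F\<^esub> y) [^]\<^bsub>F\<^esub> (p ^ m) = x [^]\<^bsub>F\<^esub> (p ^ m) \<oplus>\<^bsub>F\<^esub> y [^]\<^bsub>F\<^esub> (p ^ m)"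
    using finite_field_exists[OF assms(1) qa] by metis
  interpret F: field F by (rule F(1))
  interpret F: quadratic_field F p q
    using F q q2 F.card_fixed_points_of_power[OF F(2), of q]
    by unfold_locales (auto simp: q_def)
  have "finite (carrier (F.B.central_ext r))"
    using F(2) by (simp add: F.B.central_ext_def finite_PiE F.E2_simps F.Ra_simps)
  then obtain H :: "nat monoid" and f where H: "group H" "f \<in> hom H (F.B.central_ext r)" "bij_betw f (carrier H) (carrier (F.B.central_ext r))"
    using group.nat_copy[OF F.B.central_ext_group] by metis
  interpret S: p_spread_group H F.E2 F.Ra r "q\<^sup>2" "\<lambda>i x. fst (f x) i" F.form F.skew F.lines F.line "map_option F.cj" p n a
    using F.p_spread_group_copy[OF assms(6) H assms(1) q] assms(7) by simp
  show ?thesis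
    using S.finite_p_group_G S.P1_G S.P2_G S.P3_G S.order_Q S.quasi_antichain_CD
      S.card_abelian_atoms F.card_fixed_lines
    by (intro exI[of _ H]) (simp add: S.center_eq q flip: q_def)
qed

end
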